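(* There is $c^*\in(0,1]$ such that for every $c\in(0,c^* )$ the transversal fluctuation exponent satisfies $\xi\ge 3/5$, where $$\xi=\sup\Big\{\gamma:\ \limsup_{t\to\infty}\mathbb{P}\big(\mathcal{M}(\Lambda_t,ct)\subset\mathcal{C}_{e_1}(t^\gamma)\big)<1\Big\}.$$
   Context: $\omega$ is a homogeneous unit-intensity Poisson point process on $\mathbb{R}^2\cong\mathbb{C}$. For $s>0$, $x\in\mathbb{R}^2$, $S\subset\mathbb{R}^2$, $A^s(x,S)$ is the infimum of $\frac12\int_0^s|\dot\gamma(u)|^2du-\omega_{pp}(\gamma)$ over piecewise linear paths $\gamma:[0,s]\to\mathbb{R}^2$ with $\gamma(0)=x$, $\gamma(s)\in S$ visiting each Poisson point at most once, $\omega_{pp}(\gamma)$ being the number of Poisson points touched. $\mathcal{M}(S,s)$ is the (a.s. unique) minimizer for $A^s(0,S)$. $e_1=(1,0)$; for $t>0$, $\Lambda_t=\{(t,y):y\in\mathbb{R}\}$. For a unit vector $u$ and $w>0$, $\mathcal{C}_u(w)=\{z\in\mathbb{R}^2:\mathrm{dist}(z,\{au:a\in\mathbb{R}\})\le w\}$. *)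

theory Defs
  imports "HOL-Probability.Probability"
begin

definition poisson_pp :: "'a measure \<Rightarrow> ('a \<Rightarrow> complex set) \<Rightarrow> bool" where
  "poisson_pp M \<omega> \<longleftrightarrow>
     (\<forall>x\<in>space M. \<forall>B. bounded B \<longrightarrow> finite (\<omega> x \<inter> B)) \<and>
     (\<forall>B. B \<in> sets lborel \<and> bounded B \<longrightarrow>
        (\<lambda>x. card (\<omega> x \<inter> B)) \<in> measurable M (count_space UNIV) \<and>
        (\<forall>k::nat. measure M {x\<in>space M. card (\<omega> x \<inter> B) = k}
             = (measure lborel B) ^ k / fact k * exp (- measure lborel B))) \<and>
     (\<forall>(I::nat set) B. finite I \<longrightarrow> disjoint_family_on B I \<longrightarrow>
        (\<forall>i\<in>I. B i \<in> sets lborel \<and> bounded (B i)) \<longrightarrow>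
        prob_space.indep_vars M (\<lambda>_. count_space UNIV) (\<lambda>i x. card (\<omega> x \<inter> B i)) I)"

definition pw_linear :: "(real \<Rightarrow> complex) \<Rightarrow> real \<Rightarrow> bool" where
  "pw_linear \<gamma> s \<longleftrightarrow> (\<exists>ts::real list. sorted ts \<and> length ts \<ge> 2 \<and> hd ts = 0 \<and> last ts = s \<and>
     (\<forall>i < length ts - 1. \<exists>a b. \<forall>u\<in>{ts!i..ts!(Suc i)}. \<gamma> u = a + of_real u * b))"

definition visits_once :: "complex set \<Rightarrow> (real \<Rightarrow> complex) \<Rightarrow> real \<Rightarrow> bool" where
  "visits_once P \<gamma> s \<longleftrightarrow> (\<forall>p\<in>P. connected {u\<in>{0..s}. \<gamma> u = p})"

definition kinetic :: "(real \<Rightarrow> complex) \<Rightarrow> real \<Rightarrow> real" where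
  "kinetic \<gamma> s = integral {0..s} (\<lambda>u. (norm (vector_derivative \<gamma> (at u)))\<^sup>2) / 2"

definition touched :: "complex set \<Rightarrow> (real \<Rightarrow> complex) \<Rightarrow> real \<Rightarrow> nat" where
  "touched P \<gamma> s = card {p\<in>P. p \<in> \<gamma> ` {0..s}}"

definition path_action :: "complex set \<Rightarrow> (real \<Rightarrow> complex) \<Rightarrow> real \<Rightarrow> real" where
  "path_action P \<gamma> s = kinetic \<gamma> s - real (touched P \<gamma> s)"

definition admissible :: "complex set \<Rightarrow> complex \<Rightarrow> complex set \<Rightarrow> real \<Rightarrow> (real \<Rightarrow> complex) \<Rightarrow> bool" where
  "admissible P x S s \<gamma> \<longleftrightarrow> pw_linear \<gamma> s \<and> \<gamma> 0 = x \<and> \<gamma> s \<in> S \<and> visits_once P \<gamma> s"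

definition action :: "complex set \<Rightarrow> real \<Rightarrow> complex \<Rightarrow> complex set \<Rightarrow> real" where
  "action P s x S = Inf {path_action P \<gamma> s | \<gamma>. admissible P x S s \<gamma>}"

definition is_minimizer :: "complex set \<Rightarrow> complex set \<Rightarrow> real \<Rightarrow> (real \<Rightarrow> complex) \<Rightarrow> bool" where
  "is_minimizer P S s \<gamma> \<longleftrightarrow> admissible P 0 S s \<gamma> \<and> path_action P \<gamma> s = action P s 0 S"

text \<open>The event M(S,s) \<subseteq> C. The minimizer is a.s. unique; we require every minimizer
(restricted to [0,s]) to lie in C.\<close>
definition minimizer_in :: "complex set \<Rightarrow> complex set \<Rightarrow> real \<Rightarrow> complex set \<Rightarrow> bool" where
  "minimizer_in P S s C \<longleftrightarrow> (\<forall>\<gamma>. is_minimizer P S s \<gamma> \<longrightarrow> \<gamma> ` {0..s} \<subseteq> C)"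

definition line_at :: "real \<Rightarrow> complex set" where
  "line_at t = {z. Re z = t}"

definition cyl :: "complex \<Rightarrow> real \<Rightarrow> complex set" where
  "cyl u w = {z. infdist z (range (\<lambda>a::real. of_real a * u)) \<le> w}"

definition outer_prob :: "'a measure \<Rightarrow> 'a set \<Rightarrow> real" where
  "outer_prob M A = Inf {measure M E | E. E \<in> sets M \<and> A \<subseteq> E}"

definition xi_exp :: "'a measure \<Rightarrow> ('a \<Rightarrow> complex set) \<Rightarrow> real \<Rightarrow> ereal" where
  "xi_exp M \<omega> c = Sup {ereal g | g.
     Limsup at_top (\<lambda>t. ereal (outer_prob M
        {x\<in>space M. minimizer_in (\<omega> x) (line_at t) (c * t) (cyl 1 (t powr g))})) < 1}"

end

theory Submission
  imports Defs
begin

text \<open>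
  Stopping a path only at Poisson points, a minimiser is a list \<open>l\<close> of distinct points maximising
  \<open>length l - L\<^sup>2 / (2 * s)\<close>, where \<open>L\<close> is the length of the polygon through \<open>0\<close> and \<open>l\<close> continued
  horizontally to the line \<open>\<Lambda>\<^sub>t\<close>. Suppose that for some \<open>g < 3/5\<close> the minimiser stays in the strip of
  width \<open>w = t powr g\<close> with probability close to \<open>1\<close>. By isotropy the same holds for the strip rotated by an
  angle of order \<open>w / t\<close>, and since exchanging the two target lines costs only \<open>O(w\<^sup>2 / t)\<close>, both
  optimal values agree up to this error. Raising the intensity in the far half of the rotated strip
  (disjoint from the original one) by a relative amount of order \<open>1 / sqrt (w * t)\<close> changes the law only by a density
  that is bounded in \<open>L\<^sup>2\<close>, so the minimiser of the enriched configuration still stays in the original strip,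
  where nothing has changed. But of the order of \<open>sqrt (t / w)\<close> new points lie close to the optimal path of
  the rotated strip and can be collected by short detours. For \<open>g < 3/5\<close> this gain exceeds
  \<open>O(w\<^sup>2 / t)\<close>, a contradiction. Small \<open>c\<close> guarantees that paths longer than \<open>2 * t\<close> never pay off, because a
  path of length \<open>L\<close> meets at most \<open>O(L + t)\<close> points.
\<close>

section \<open>Polygons\<close>

text \<open>The law of the points is accessible only through counts in bounded Borel sets, and
  events about minimisers carry no measurability; hence the outer probability. Laws are compared for
  count vectors on a finite grid: these take countably many values, so every set of them is an
  event. The grid is so fine that moving points within cells changes the score of the relevant lists
  by at most 1/2, and exact optimality (\<open>strip_max\<close>) becomes near-optimality
  (\<open>near_max\<close>) of every configuration with the same counts. The added points come from
  an independent copy of the process, dilated to intensity \<open>1 / sqrt (3 * w * t)\<close> and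
  cut to a set of area \<open>3 * w * t\<close>; the chi-square cost of this change is at most 1. By
  Fubini the optimal path can be fixed before the new points are drawn, so that their number near it
  is a plain Poisson variable. Finally, \<open>minimizer_in\<close> holds vacuously when no
  minimiser exists. Existence must therefore be proved, and general position serves this: the
  polyline through an optimal list may not visit a point twice.\<close>

fun plen :: "'a::euclidean_space list \<Rightarrow> real" where
  "plen [] = 0"
| "plen [x] = 0"
| "plen (x # y # l) = norm (y - x) + plen (y # l)"

fun polygon :: "'a::euclidean_space list \<Rightarrow> 'a set" where
  "polygon [] = {}"
| "polygon [x] = {x}"
| "polygon (x # y # l) = closed_segment x y \<union> polygon (y # l)"

lemma plen_nonneg [simp]: "0 \<le> plen l"
  by (induction l rule: plen.induct) auto

lemma plen_Cons_le: "plen l \<le> plen (x # l)"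
  by (cases l) auto

lemma plen_Cons_drop: "plen (x # l) \<le> plen (x # y # l)"
proof (cases l)
  case (Cons z zs)
  have "norm (z - x) \<le> norm (y - x) + norm (z - y)"
    using norm_triangle_ineq[of "y - x" "z - y"] by simp
  then show ?thesis using Cons by simp
qed auto

lemma plen_snoc: "l \<noteq> [] \<Longrightarrow> plen (l @ [y]) = plen l + norm (y - last l)"
  by (induction l rule: plen.induct) auto

text \<open>Dropping a vertex is the triangle inequality between its neighbours, so the induction
  has to carry along an arbitrary common predecessor \<open>x\<close>.\<close>

lemma plen_Cons_mono: "subseq xs ys \<Longrightarrow> plen xs \<le> plen ys \<and> plen (x # xs) \<le> plen (x # ys)"
proof (induction arbitrary: x rule: list_emb.induct)
  case (list_emb_Nil ys)
  then show ?case by simp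
next
  case (list_emb_Cons xs ys y)
  then have "plen xs \<le> plen ys" "plen (x # xs) \<le> plen (x # ys)" by auto
  then show ?case using plen_Cons_drop[of x ys y] plen_Cons_le[of ys y] by linarith
next
  case (list_emb_Cons2 a b xs ys)
  then show ?case by simp
qed

lemma plen_subseq: "subseq xs ys \<Longrightarrow> plen xs \<le> plen ys"
  using plen_Cons_mono by blast

text \<open>A vertex lies on at most two edges, and moving it by \<open>r\<close> changes each of
  them by at most \<open>r\<close>.\<close>

lemma plen_perturb:
  assumes "length xs = length ys" "\<forall>i<length xs. norm (xs ! i - ys ! i) \<le> r" "0 \<le> r"
  shows "plen ys \<le> plen xs + 2 * r * length xs"
  using assms
proof (induction xs arbitrary: ys rule: plen.induct)
  case (2 x)
  then show ?case by (cases ys) auto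
next
  case (3 x y l)
  from "3.prems" obtain x' y' l' where ys: "ys = x' # y' # l'" and len: "length l' = length l"
    by (cases ys; cases "tl ys") auto
  have "plen (y' # l') \<le> plen (y # l) + 2 * r * length (y # l)"
  proof (rule "3.IH")
    show "\<forall>i<length (y # l). norm ((y # l) ! i - (y' # l') ! i) \<le> r"
    proof (intro allI impI)
      fix i assume "i < length (y # l)"
      then show "norm ((y # l) ! i - (y' # l') ! i) \<le> r"
        using "3.prems"(2)[rule_format, of "Suc i"] ys by simp
    qed
  qed (use len "3.prems" in auto)
  moreover have "norm (x - x') \<le> r" "norm (y - y') \<le> r"
    using "3.prems"(2)[rule_format, of 0] "3.prems"(2)[rule_format, of 1] ys by auto
  moreover have "norm (y' - x') \<le> norm (y - x) + norm (x - x') + norm (y - y')"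
  proof -
    have "y' - x' = (y - x) + ((x - x') - (y - y'))" by simp
    then show ?thesis
      using norm_triangle_ineq[of "y - x" "(x - x') - (y - y')"] norm_triangle_ineq4[of "x - x'" "y - y'"]
      by simp
  qed
  ultimately have "plen ys \<le> (norm (y - x) + plen (y # l)) + (2 * r + 2 * r * length (y # l))"
    using ys by simp
  also have "\<dots> = plen (x # y # l) + 2 * r * length (x # y # l)"
    by (simp add: algebra_simps)
  finally show ?case .
qed auto

lemma norm_le_plen: "p \<in> set l \<Longrightarrow> norm (p - a) \<le> plen (a # l)"
proof -
  assume "p \<in> set l"
  then have "subseq [a, p] (a # l)"
    by (simp add: subseq_singleton_left)
  from plen_subseq[OF this] show ?thesis by simp
qed

lemma polygon_set: "set l \<subseteq> polygon l"
  by (induction l rule: plen.induct) auto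

text \<open>The detour runs from \<open>z\<close> to \<open>q\<close> and back. The inclusion of the
  polygons keeps points near the old polygon near the new one, so that insertions can be repeated;
  the two ends are kept because they pin the path.\<close>

lemma polygon_insert:
  assumes "z \<in> polygon vs"
  shows "\<exists>ws. polygon vs \<subseteq> polygon ws \<and> plen ws = plen vs + 2 * norm (q - z) \<and> subseq vs ws \<and>
    q \<in> set ws \<and> ws \<noteq> [] \<and> hd ws = hd vs \<and> last ws = last vs"
  using assms
proof (induction vs rule: plen.induct)
  case (2 x)
  then show ?case
    by (intro exI[of _ "[x, q, x]"]) (auto simp: norm_minus_commute)
next
  case (3 x y l)
  show ?case
  proof (cases "z \<in> closed_segment x y")
    case True
    let ?ws = "x # z # q # z # y # l"
    have "norm (z - x) + norm (y - z) = norm (y - x)"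
      using True unfolding between_mem_segment[symmetric] between by (simp add: dist_norm norm_minus_commute)
    then have "plen ?ws = plen (x # y # l) + 2 * norm (q - z)"
      by (simp add: norm_minus_commute)
    moreover have "closed_segment x y \<subseteq> closed_segment x z \<union> closed_segment z y"
      using Un_closed_segment[OF True] by simp
    then have "polygon (x # y # l) \<subseteq> polygon ?ws" by auto
    moreover have "subseq (x # y # l) ?ws"
      by (rule list_emb_Cons2, rule refl, rule list_emb_Cons, rule list_emb_Cons, rule list_emb_Cons) simp
    ultimately show ?thesis by (intro exI[of _ ?ws]) auto
  next
    case False
    then have "z \<in> polygon (y # l)" using "3.prems" by auto
    from "3.IH"[OF this] obtain ws where ws: "polygon (y # l) \<subseteq> polygon ws"
      "plen ws = plen (y # l) + 2 * norm (q - z)" "subseq (y # l) ws" "q \<in> set ws" "ws \<noteq> []"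
      "hd ws = y" "last ws = last (y # l)" by auto
    then obtain ws' where ws': "ws = y # ws'" by (cases ws) auto
    show ?thesis
      by (intro exI[of _ "x # ws"]) (use ws ws' in auto)
  qed
qed auto

lemma polygon_insert_finite:
  assumes "finite Q" "vs \<noteq> []" "\<forall>q\<in>Q. \<exists>z\<in>polygon vs. norm (q - z) \<le> \<rho>"
  shows "\<exists>ws. polygon vs \<subseteq> polygon ws \<and> plen ws \<le> plen vs + 2 * \<rho> * card Q \<and> subseq vs ws \<and>
    Q \<subseteq> set ws \<and> ws \<noteq> [] \<and> hd ws = hd vs \<and> last ws = last vs"
  using assms
proof (induction Q rule: finite_induct)
  case empty
  then show ?case by (intro exI[of _ vs]) auto
next
  case (insert q Q)
  then obtain ws where ws: "polygon vs \<subseteq> polygon ws" "plen ws \<le> plen vs + 2 * \<rho> * card Q"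
    "subseq vs ws" "Q \<subseteq> set ws" "ws \<noteq> []" "hd ws = hd vs" "last ws = last vs"
    by auto
  obtain z where z: "z \<in> polygon vs" "norm (q - z) \<le> \<rho>" using insert.prems by auto
  from polygon_insert[of z ws q] z ws obtain ws' where ws': "polygon ws \<subseteq> polygon ws'"
    "plen ws' = plen ws + 2 * norm (q - z)" "subseq ws ws'" "q \<in> set ws'" "ws' \<noteq> []"
    "hd ws' = hd ws" "last ws' = last ws" by blast
  have "plen ws' \<le> plen vs + 2 * \<rho> * card (insert q Q)"
  proof -
    have "real (card (insert q Q)) = real (card Q) + 1" using insert.hyps by simp
    then have "2 * \<rho> * card (insert q Q) = 2 * \<rho> * card Q + 2 * \<rho>" by (simp add: distrib_left)
    then show ?thesis using ws(2) ws'(2) z(2) by linarith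
  qed
  moreover have "Q \<subseteq> set ws'" 
  proof
    fix x assume "x \<in> Q"
    then have "subseq [x] ws" using ws(4) by (auto simp: subseq_singleton_left)
    then have "subseq [x] ws'" using ws'(3) by (rule subseq_order.order_trans)
    then show "x \<in> set ws'" by (simp add: subseq_singleton_left)
  qed
  moreover have "subseq vs ws'" using ws(3) ws'(3) by (rule subseq_order.order_trans)
  moreover have "polygon vs \<subseteq> polygon ws'" using ws(1) ws'(1) by (rule order_trans)
  ultimately show ?case
    using ws(6,7) ws'(4,5,6,7) by (intro exI[of _ ws']) simp
qed

section \<open>Paths from the origin to the target line, reduced to the points they visit\<close>

definition pin_len :: "real \<Rightarrow> complex list \<Rightarrow> real" where
  "pin_len t l = plen (0 # l) + \<bar>t - Re (last (0 # l))\<bar>"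

text \<open>The orthogonal projection of the last point ends the shortest continuation to the line.
  Writing \<open>last (0 # l)\<close> makes the origin the last point of the empty list.\<close>

definition foot :: "real \<Rightarrow> complex list \<Rightarrow> complex" where
  "foot t l = Complex t (Im (last (0 # l)))"

lemma norm_foot: "norm (foot t l - last (0 # l)) = \<bar>t - Re (last (0 # l))\<bar>"
  by (simp add: foot_def cmod_def del: last.simps)

lemma pin_len_eq: "pin_len t l = plen (0 # l @ [foot t l])"
  using plen_snoc[of "0 # l" "foot t l"] norm_foot[of t l] by (simp add: pin_len_def)

lemma pin_len_le:
  assumes "Re e = t"
  shows "pin_len t l \<le> plen (0 # l @ [e])"
proof -
  have "\<bar>t - Re (last (0 # l))\<bar> \<le> norm (e - last (0 # l))"
    using abs_Re_le_cmod[of "e - last (0 # l)"] assms by simp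
  then show ?thesis
    using plen_snoc[of "0 # l" e] by (simp add: pin_len_def)
qed

text \<open>Repeating the first vertex \<open>0\<close> and the last vertex of \<open>vs\<close>
  costs no length, and in the list so extended \<open>l\<close> together with both ends is a
  subsequence.\<close>

lemma pin_len_le_visits:
  assumes "subseq l vs" "vs \<noteq> []" "hd vs = 0" "Re (last vs) = t"
  shows "pin_len t l \<le> plen vs"
proof -
  obtain vs' where vs': "vs = 0 # vs'" using assms by (cases vs) auto
  have "pin_len t l \<le> plen (0 # l @ [last vs])"
    using assms by (intro pin_len_le) auto
  also have "\<dots> \<le> plen (0 # vs @ [last vs])"
  proof (rule plen_subseq)
    show "subseq (0 # l @ [last vs]) (0 # vs @ [last vs])"
      using assms(1) by (simp add: list_emb_append_mono)
  qed
  also have "\<dots> = plen vs"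
    using plen_snoc[of "0 # vs" "last vs"] vs' by simp
  finally show ?thesis .
qed

lemma subseq_remdups: "subseq (remdups xs) xs"
  by (induction xs) auto

text \<open>Shortcutting: of a walk with repetitions and auxiliary vertices only the points of
  \<open>T\<close> are kept, each once, which cannot increase the length.\<close>

lemma visit_list:
  assumes "T \<subseteq> set vs" "vs \<noteq> []" "hd vs = 0" "Re (last vs) = t"
  obtains l where "distinct l" "set l = T" "pin_len t l \<le> plen vs"
proof -
  define l where "l = remdups (filter (\<lambda>p. p \<in> T) vs)"
  have "subseq l vs"
    unfolding l_def by (rule subseq_order.order_trans[OF subseq_remdups subseq_filter_left])
  then have "pin_len t l \<le> plen vs" by (rule pin_len_le_visits[OF _ assms(2-4)])
  moreover have "distinct l" "set l = T" using assms(1) by (auto simp: l_def)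
  ultimately show ?thesis using that by blast
qed

lemma pin_len_ge: "\<bar>t\<bar> \<le> pin_len t l"
proof -
  have "subseq [0, foot t l] (0 # l @ [foot t l])" by (simp add: subseq_singleton_left)
  from plen_subseq[OF this] have "norm (foot t l) \<le> pin_len t l"
    by (simp add: pin_len_eq)
  moreover have "\<bar>t\<bar> \<le> norm (foot t l)"
    using abs_Re_le_cmod[of "foot t l"] by (simp add: foot_def)
  ultimately show ?thesis by simp
qed

lemma norm_le_pin_len: "p \<in> set l \<Longrightarrow> norm p \<le> pin_len t l"
  using norm_le_plen[of p l 0] by (simp add: pin_len_def)

lemma polygon_Re:
  assumes "vs \<noteq> []" "Re (hd vs) \<le> a" "a \<le> Re (last vs)" "\<forall>v\<in>set vs. \<bar>Im v\<bar> \<le> w"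
  shows "\<exists>z\<in>polygon vs. Re z = a \<and> \<bar>Im z\<bar> \<le> w"
  using assms
proof (induction vs rule: polygon.induct)
  case (3 x y l)
  show ?case
  proof (cases "a \<le> Re y")
    case True
    \<comment> \<open>On a vertical edge both ends have real part \<open>a\<close>, and the value
      \<open>0\<close> selects one of them.\<close>
    define s where "s = (if Re x = Re y then 0 else (a - Re x) / (Re y - Re x))"
    have s: "0 \<le> s" "s \<le> 1" and eq: "(1 - s) * Re x + s * Re y = a"
      using True "3.prems"(2) by (auto simp: s_def field_simps)
    define z where "z = (1 - s) *\<^sub>R x + s *\<^sub>R y"
    have "z \<in> closed_segment x y" using s by (auto simp: z_def in_segment)
    moreover have "Re z = a" using eq by (simp add: z_def)
    moreover have "\<bar>Im z\<bar> \<le> (1 - s) * \<bar>Im x\<bar> + s * \<bar>Im y\<bar>"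
      using s abs_triangle_ineq[of "(1 - s) * Im x" "s * Im y"] by (simp add: z_def abs_mult)
    moreover have "\<dots> \<le> (1 - s) * w + s * w"
      using s "3.prems"(4) by (intro add_mono mult_left_mono) auto
    ultimately show ?thesis by (intro bexI[of _ z]) (auto simp: algebra_simps)
  next
    case False
    then show ?thesis using "3.IH" "3.prems" by auto
  qed
qed auto

section \<open>Piecewise linear paths and minimisers\<close>

fun pwl :: "(real \<Rightarrow> complex) \<Rightarrow> real list \<Rightarrow> bool" where
  "pwl \<gamma> [] = True"
| "pwl \<gamma> [a] = True"
| "pwl \<gamma> (a # b # ts) = ((\<exists>c d. \<forall>u\<in>{a..b}. \<gamma> u = c + of_real u * d) \<and> pwl \<gamma> (b # ts))"

text \<open>Twice the kinetic energy of a path that is affine between consecutive times. A repeated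
  time contributes \<open>0\<close>, since its quotient is \<open>0 / 0\<close>.\<close>

fun ksum :: "(real \<Rightarrow> complex) \<Rightarrow> real list \<Rightarrow> real" where
  "ksum \<gamma> [] = 0"
| "ksum \<gamma> [a] = 0"
| "ksum \<gamma> (a # b # ts) = (norm (\<gamma> b - \<gamma> a))\<^sup>2 / (b - a) + ksum \<gamma> (b # ts)"

lemma pwl_iff:
  "pwl \<gamma> ts \<longleftrightarrow> (\<forall>i < length ts - 1. \<exists>c d. \<forall>u\<in>{ts!i..ts!(Suc i)}. \<gamma> u = c + of_real u * d)"
proof (induction \<gamma> ts rule: pwl.induct)
  case (3 \<gamma> a b ts)
  then show ?case by (simp add: All_less_Suc2 del: atLeastAtMost_iff)
qed auto

lemma hd_le_last: "sorted ts \<Longrightarrow> ts \<noteq> [] \<Longrightarrow> hd ts \<le> last ts" for ts :: "real list"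
  by (cases ts) auto

lemma integral_affine_piece:
  fixes \<gamma> :: "real \<Rightarrow> complex"
  assumes "a \<le> b" "\<forall>u\<in>{a..b}. \<gamma> u = c + of_real u * d"
  shows "((\<lambda>u. (norm (vector_derivative \<gamma> (at u)))\<^sup>2) has_integral (norm (\<gamma> b - \<gamma> a))\<^sup>2 / (b - a)) {a..b}"
proof (cases "a = b")
  case False
  then have ab: "a < b" using assms(1) by simp
  have "\<gamma> b - \<gamma> a = of_real (b - a) * d"
    using assms by (simp add: algebra_simps)
  then have eq: "(norm (\<gamma> b - \<gamma> a))\<^sup>2 / (b - a) = (b - a) * (norm d)\<^sup>2"
    using ab by (simp add: norm_mult power_mult_distrib power2_eq_square del: of_real_diff)
  have "((\<lambda>u. (norm d)\<^sup>2) has_integral (b - a) * (norm d)\<^sup>2) {a..b}"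
    using has_integral_const_real[of "(norm d)\<^sup>2" a b] ab by simp
  \<comment> \<open>The path may have kinks at the break points, so the derivative is computed in
    the interior; two points do not affect the integral.\<close>
  moreover have "(norm (vector_derivative \<gamma> (at u)))\<^sup>2 = (norm d)\<^sup>2" if "u \<in> {a..b} - {a, b}" for u
  proof -
    have "((\<lambda>u. c + of_real u * d) has_vector_derivative d) (at u)"
      by (auto intro!: derivative_eq_intros)
    then have "(\<gamma> has_vector_derivative d) (at u)"
      by (rule has_vector_derivative_transform_within_open[where S = "{a<..<b}"])
        (use that assms(2) in auto)
    then show ?thesis by (simp add: vector_derivative_at)
  qed
  ultimately show ?thesis unfolding eq
    by (subst has_integral_spike_finite_eq[of "{a, b}"]) auto
qed (auto intro: has_integral_refl)

lemma has_integral_pwl: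
  assumes "sorted ts" "pwl \<gamma> ts" "ts \<noteq> []"
  shows "((\<lambda>u. (norm (vector_derivative \<gamma> (at u)))\<^sup>2) has_integral ksum \<gamma> ts) {hd ts..last ts}"
  using assms
proof (induction \<gamma> ts rule: ksum.induct)
  case (2 \<gamma> a)
  then show ?case by (auto intro: has_integral_refl)
next
  case (3 \<gamma> a b ts)
  from "3.prems" obtain c d where "\<forall>u\<in>{a..b}. \<gamma> u = c + of_real u * d" by auto
  with "3.prems" have "((\<lambda>u. (norm (vector_derivative \<gamma> (at u)))\<^sup>2) has_integral
      (norm (\<gamma> b - \<gamma> a))\<^sup>2 / (b - a)) {a..b}"
    by (intro integral_affine_piece) auto
  moreover have "((\<lambda>u. (norm (vector_derivative \<gamma> (at u)))\<^sup>2) has_integral ksum \<gamma> (b # ts)) {b..last (b # ts)}"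
    using "3.IH" "3.prems" by simp
  ultimately have "((\<lambda>u. (norm (vector_derivative \<gamma> (at u)))\<^sup>2) has_integral
      (norm (\<gamma> b - \<gamma> a))\<^sup>2 / (b - a) + ksum \<gamma> (b # ts)) {a..last (b # ts)}"
    using "3.prems"(1) hd_le_last[of "b # ts"] by (intro has_integral_combine[of a b]) auto
  then show ?case by simp
qed auto

text \<open>Linearised Cauchy-Schwarz: expanding \<open>(D - v * \<tau>)^2 \<ge> 0\<close> bounds
  \<open>D^2 / \<tau>\<close> from below by an expression linear in distance and duration. Such
  bounds add up over the pieces, with \<open>v\<close> left free.\<close>

lemma ksum_ge:
  assumes "sorted ts" "ts \<noteq> []"
  shows "2 * v * plen (map \<gamma> ts) - v\<^sup>2 * (last ts - hd ts) \<le> ksum \<gamma> ts"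
  using assms
proof (induction \<gamma> ts rule: ksum.induct)
  case (3 \<gamma> a b ts)
  define D where "D = norm (\<gamma> b - \<gamma> a)"
  have "2 * v * D - v\<^sup>2 * (b - a) \<le> D\<^sup>2 / (b - a)"
  proof (cases "a = b")
    case False
    then have ab: "0 < b - a" using "3.prems" by simp
    have "0 \<le> (D - v * (b - a))\<^sup>2" by simp
    then have "(2 * v * D - v\<^sup>2 * (b - a)) * (b - a) \<le> D\<^sup>2"
      by (simp add: power2_eq_square algebra_simps)
    then show ?thesis using ab by (simp add: pos_le_divide_eq)
  qed (simp add: D_def)
  moreover have "2 * v * plen (map \<gamma> (b # ts)) - v\<^sup>2 * (last (b # ts) - b) \<le> ksum \<gamma> (b # ts)"
    using "3.IH" "3.prems" by simp
  ultimately show ?case unfolding D_def by (simp add: algebra_simps)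
qed auto

text \<open>The mean speed is the optimal parameter in the linearised bound.\<close>

lemma ksum_ge_square:
  assumes "sorted ts" "ts \<noteq> []" "last ts - hd ts = s" "0 < s"
  shows "(plen (map \<gamma> ts))\<^sup>2 / s \<le> ksum \<gamma> ts"
proof -
  define P where "P = plen (map \<gamma> ts)"
  have "2 * (P / s) * P - (P / s)\<^sup>2 * s \<le> ksum \<gamma> ts"
    using ksum_ge[OF assms(1,2), of "P / s" \<gamma>] assms(3) by (simp add: P_def)
  moreover have "2 * (P / s) * P - (P / s)\<^sup>2 * s = P\<^sup>2 / s"
    using assms(4) by (simp add: power2_eq_square field_simps)
  ultimately show ?thesis by (simp add: P_def)
qed

lemma pwl_refine:
  assumes "sorted ts" "pwl \<gamma> ts" "ts \<noteq> []" "hd ts \<le> u" "u \<le> last ts"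
  shows "\<exists>ts'. sorted ts' \<and> pwl \<gamma> ts' \<and> ts' \<noteq> [] \<and> hd ts' = hd ts \<and> last ts' = last ts \<and>
    insert u (set ts) \<subseteq> set ts'"
  using assms
proof (induction \<gamma> ts rule: ksum.induct)
  case (2 \<gamma> a)
  then show ?case by (intro exI[of _ "[a]"]) auto
next
  case (3 \<gamma> a b ts)
  show ?case
  proof (cases "u \<le> b")
    case True
    obtain c d where "\<forall>u\<in>{a..b}. \<gamma> u = c + of_real u * d" using "3.prems" by auto
    then have "\<forall>x\<in>{a..u}. \<gamma> x = c + of_real x * d" "\<forall>x\<in>{u..b}. \<gamma> x = c + of_real x * d"
      using True "3.prems" by auto
    then have "pwl \<gamma> (a # u # b # ts)"
      using "3.prems"(2) by (simp del: atLeastAtMost_iff) blast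
    moreover have "sorted (a # u # b # ts)" using "3.prems" True by auto
    ultimately show ?thesis by (intro exI[of _ "a # u # b # ts"]) auto
  next
    case False
    then obtain ts' where ts': "sorted ts'" "pwl \<gamma> ts'" "ts' \<noteq> []" "hd ts' = b"
      "last ts' = last (b # ts)" "insert u (set (b # ts)) \<subseteq> set ts'"
      using "3.IH" "3.prems" by auto
    then obtain ts'' where ts'': "ts' = b # ts''" by (cases ts') auto
    show ?thesis
      using ts' "3.prems" unfolding ts'' by (intro exI[of _ "a # b # ts''"]) auto
  qed
qed auto

lemma pwl_refine_finite:
  assumes "finite U" "sorted ts" "pwl \<gamma> ts" "ts \<noteq> []" "U \<subseteq> {hd ts..last ts}"
  shows "\<exists>ts'. sorted ts' \<and> pwl \<gamma> ts' \<and> ts' \<noteq> [] \<and> hd ts' = hd ts \<and> last ts' = last ts \<and>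
    U \<subseteq> set ts'"
  using assms(1,5)
proof (induction U rule: finite_induct)
  case empty
  then show ?case using assms by blast
next
  case (insert u U)
  then obtain ts' where ts': "sorted ts'" "pwl \<gamma> ts'" "ts' \<noteq> []" "hd ts' = hd ts"
      "last ts' = last ts" "U \<subseteq> set ts'" by auto
  obtain ts'' where "sorted ts''" "pwl \<gamma> ts''" "ts'' \<noteq> []" "hd ts'' = hd ts'"
      "last ts'' = last ts'" "insert u (set ts') \<subseteq> set ts''"
    using pwl_refine[OF ts'(1,2,3), of u] ts'(4,5) insert.prems by auto
  then show ?case using ts' by (intro exI[of _ ts'']) auto
qed

lemma pwl_bounded:
  assumes "sorted ts" "pwl \<gamma> ts" "ts \<noteq> []"
  shows "bounded (\<gamma> ` {hd ts..last ts})"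
  using assms
proof (induction \<gamma> ts rule: ksum.induct)
  case (3 \<gamma> a b ts)
  obtain c d where cd: "\<forall>u\<in>{a..b}. \<gamma> u = c + of_real u * d" using "3.prems" by auto
  have "bounded ((\<lambda>u::real. c + of_real u * d) ` {a..b})"
    by (intro compact_imp_bounded compact_continuous_image continuous_intros) auto
  moreover have "\<gamma> ` {a..b} = (\<lambda>u::real. c + of_real u * d) ` {a..b}"
    using cd by (intro image_cong) auto
  moreover have "bounded (\<gamma> ` {b..last (b # ts)})" using "3.IH" "3.prems" by simp
  moreover have "{a..last (b # ts)} \<subseteq> {a..b} \<union> {b..last (b # ts)}" by auto
  ultimately have "bounded (\<gamma> ` {a..b} \<union> \<gamma> ` {b..last (b # ts)})"
      "\<gamma> ` {a..last (b # ts)} \<subseteq> \<gamma> ` {a..b} \<union> \<gamma> ` {b..last (b # ts)}"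
    by (simp, blast)
  then have "bounded (\<gamma> ` {a..last (b # ts)})" by (rule bounded_subset)
  then show ?case by simp
qed auto

text \<open>A path of length \<open>L\<close> run at constant speed in time \<open>s\<close> has
  kinetic energy \<open>L^2 / (2 * s)\<close>. The score is thus minus the action of the
  constant-speed path through \<open>l\<close> when it touches no further point, and minimal action
  becomes maximal score.\<close>

definition score :: "real \<Rightarrow> real \<Rightarrow> complex list \<Rightarrow> real" where
  "score t s l = real (length l) - (pin_len t l)\<^sup>2 / (2 * s)"

lemma pw_linear_pwl:
  "pw_linear \<gamma> s \<longleftrightarrow> (\<exists>ts. sorted ts \<and> length ts \<ge> 2 \<and> hd ts = 0 \<and> last ts = s \<and> pwl \<gamma> ts)"
  unfolding pw_linear_def pwl_iff by blast

text \<open>Straightening a path between the points it touches shortens it, and constant speed is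
  the cheapest way to cover a given length. One time of contact for each touched point is first
  added to the break points, so that the touched points are among the vertices.\<close>

lemma path_action_ge:
  assumes "pw_linear \<gamma> s" "\<gamma> 0 = 0" "Re (\<gamma> s) = t" "0 < s"
    and loc: "\<And>B. bounded B \<Longrightarrow> finite (P \<inter> B)"
  shows "\<exists>l. distinct l \<and> set l \<subseteq> P \<and> - score t s l \<le> path_action P \<gamma> s"
proof -
  obtain ts where ts: "sorted ts" "pwl \<gamma> ts" "hd ts = 0" "last ts = s" "ts \<noteq> []"
    using assms(1) unfolding pw_linear_pwl by fastforce
  define T where "T = {p\<in>P. p \<in> \<gamma> ` {0..s}}"
  have "T = P \<inter> \<gamma> ` {0..s}" by (auto simp: T_def)
  then have finT: "finite T" using loc pwl_bounded[OF ts(1,2,5)] ts by auto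
  obtain \<tau> where \<tau>: "\<And>p. p \<in> T \<Longrightarrow> \<tau> p \<in> {0..s} \<and> \<gamma> (\<tau> p) = p"
  proof -
    have "\<forall>p\<in>T. \<exists>u. u \<in> {0..s} \<and> \<gamma> u = p" by (auto simp: T_def)
    then show ?thesis using that by metis
  qed
  obtain ts' where ts': "sorted ts'" "pwl \<gamma> ts'" "ts' \<noteq> []" "hd ts' = 0" "last ts' = s"
      "\<tau> ` T \<subseteq> set ts'"
  proof -
    have "\<tau> ` T \<subseteq> {hd ts..last ts}" using \<tau> ts by auto
    then have "\<exists>ts'. sorted ts' \<and> pwl \<gamma> ts' \<and> ts' \<noteq> [] \<and> hd ts' = hd ts \<and> last ts' = last ts \<and>
        \<tau> ` T \<subseteq> set ts'"
      using finT by (intro pwl_refine_finite[OF _ ts(1,2,5)]) auto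
    then show ?thesis using that ts(3,4) by metis
  qed
  have "T \<subseteq> set (map \<gamma> ts')"
  proof
    fix p assume "p \<in> T"
    then show "p \<in> set (map \<gamma> ts')" using \<tau>[of p] ts'(6) by force
  qed
  then obtain l where l: "distinct l" "set l = T" "pin_len t l \<le> plen (map \<gamma> ts')"
    using visit_list[of T "map \<gamma> ts'" t] ts' assms(2,3) by (auto simp: hd_map last_map)
  have "(plen (map \<gamma> ts'))\<^sup>2 / s \<le> ksum \<gamma> ts'"
    using ts' assms(4) by (intro ksum_ge_square) auto
  moreover have "(pin_len t l)\<^sup>2 / s \<le> (plen (map \<gamma> ts'))\<^sup>2 / s"
    using l(3) pin_len_ge[of t l] assms(4) by (intro divide_right_mono power_mono) auto
  moreover have "kinetic \<gamma> s = ksum \<gamma> ts' / 2"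
    using has_integral_pwl[OF ts'(1-3)] ts'(4,5) by (simp add: kinetic_def integral_unique)
  moreover have "touched P \<gamma> s = length l"
    using distinct_card[OF l(1)] l(2) by (simp add: touched_def T_def)
  ultimately have "- score t s l \<le> path_action P \<gamma> s"
    by (simp add: score_def path_action_def field_simps)
  then show ?thesis using l by (intro exI[of _ l]) (auto simp: T_def)
qed

text \<open>Agreement is asked for only from the first time on, because
  \<open>polyline_exists\<close> glues a new first edge to a path that starts later.\<close>

lemma pwl_cong:
  assumes "sorted ts" "ts \<noteq> []" "\<And>u. hd ts \<le> u \<Longrightarrow> \<gamma> u = \<gamma>' u"
  shows "pwl \<gamma> ts = pwl \<gamma>' ts \<and> ksum \<gamma> ts = ksum \<gamma>' ts \<and> map \<gamma> ts = map \<gamma>' ts"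
  using assms
proof (induction \<gamma> ts rule: ksum.induct)
  case (3 \<gamma> a b ts)
  have "pwl \<gamma> (b # ts) = pwl \<gamma>' (b # ts) \<and> ksum \<gamma> (b # ts) = ksum \<gamma>' (b # ts) \<and>
      map \<gamma> (b # ts) = map \<gamma>' (b # ts)"
    using "3.prems" by (intro "3.IH") auto
  moreover have "\<gamma> a = \<gamma>' a" "\<gamma> b = \<gamma>' b" using "3.prems" by auto
  moreover have "(\<forall>u\<in>{a..b}. \<gamma> u = c + of_real u * d) = (\<forall>u\<in>{a..b}. \<gamma>' u = c + of_real u * d)" for c d
    using "3.prems" by simp
  ultimately show ?case by simp
qed auto

text \<open>Run through \<open>vs\<close> at constant speed \<open>v\<close> from time
  \<open>t0\<close>. The clause with \<open>zip\<close> keeps the time next to the vertex, which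
  later shows that a point is met at one time only; the Lipschitz clause serves the rounding of
  paths to lattice walks.\<close>

definition polyline :: "real \<Rightarrow> real \<Rightarrow> complex list \<Rightarrow> (real \<Rightarrow> complex) \<Rightarrow> real list \<Rightarrow> bool" where
  "polyline v t0 vs \<gamma> ts \<longleftrightarrow>
    length ts = length vs \<and> sorted ts \<and> hd ts = t0 \<and> last ts = t0 + plen vs / v \<and>
    pwl \<gamma> ts \<and> map \<gamma> ts = vs \<and> ksum \<gamma> ts = v * plen vs \<and>
    (\<forall>u. t0 \<le> u \<and> u \<le> last ts \<longrightarrow> (u, \<gamma> u) \<in> set (zip ts vs) \<or>
       (\<exists>i. Suc i < length vs \<and> \<gamma> u \<in> open_segment (vs ! i) (vs ! Suc i))) \<and>
    (\<forall>u w. t0 \<le> u \<and> u \<le> w \<and> w \<le> last ts \<longrightarrow> norm (\<gamma> w - \<gamma> u) \<le> v * (w - u)) \<and>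
    (\<forall>i. Suc i < length vs \<longrightarrow> ts ! Suc i - ts ! i = norm (vs ! Suc i - vs ! i) / v)"

lemma polyline_exists:
  assumes "0 < v" "vs \<noteq> []"
  shows "\<exists>\<gamma> ts. polyline v t0 vs \<gamma> ts"
  using assms(2)
proof (induction vs arbitrary: t0 rule: plen.induct)
  case (2 x)
  then show ?case by (intro exI[of _ "\<lambda>_. x"] exI[of _ "[t0]"]) (use assms(1) in \<open>auto simp: polyline_def\<close>)
next
  case (3 x y l t0)
  define T where "T = norm (y - x) / v"
  have T0: "0 \<le> T" using assms(1) by (simp add: T_def)
  have "\<exists>\<gamma>' ts'. polyline v (t0 + T) (y # l) \<gamma>' ts'" by (rule "3.IH") simp
  then obtain \<gamma>' ts' where pl: "polyline v (t0 + T) (y # l) \<gamma>' ts'" by blast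
  then have IH: "length ts' = length (y # l)" "sorted ts'" "hd ts' = t0 + T"
    "last ts' = t0 + T + plen (y # l) / v" "pwl \<gamma>' ts'" "map \<gamma>' ts' = y # l"
    "ksum \<gamma>' ts' = v * plen (y # l)"
    unfolding polyline_def by blast+
  have seg: "(u, \<gamma>' u) \<in> set (zip ts' (y # l)) \<or>
       (\<exists>i. Suc i < length (y # l) \<and> \<gamma>' u \<in> open_segment ((y # l) ! i) ((y # l) ! Suc i))"
    if "t0 + T \<le> u" "u \<le> last ts'" for u
    using pl that unfolding polyline_def by blast
  have lip: "norm (\<gamma>' w - \<gamma>' u) \<le> v * (w - u)" if "t0 + T \<le> u" "u \<le> w" "w \<le> last ts'" for u w
    using pl that unfolding polyline_def by blast
  have dif: "ts' ! Suc i - ts' ! i = norm ((y # l) ! Suc i - (y # l) ! i) / v"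
    if "Suc i < length (y # l)" for i
    using pl that unfolding polyline_def by blast
  obtain r where r: "ts' = (t0 + T) # r" using IH(1,3) by (cases ts') auto
  have y: "\<gamma>' (t0 + T) = y" using IH(6) r by simp
  \<comment> \<open>If \<open>x = y\<close>, then \<open>T = 0\<close> and
    \<open>sgn (y - x) = 0\<close>, and the edge degenerates to a single point.\<close>
  define \<gamma> where "\<gamma> u = (if u \<le> t0 + T then x + of_real ((u - t0) * v) * sgn (y - x) else \<gamma>' u)" for u
  have "of_real (norm (y - x)) * sgn (y - x) = y - x" by (simp add: sgn_eq)
  then have gT: "x + of_real (T * v) * sgn (y - x) = y"
    using assms(1) by (simp add: T_def)
  have eq: "\<gamma> u = \<gamma>' u" if "t0 + T \<le> u" for u
    using that y gT by (auto simp: \<gamma>_def)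
  have cong: "pwl \<gamma> ts'" "ksum \<gamma> ts' = v * plen (y # l)" "map \<gamma> ts' = y # l"
    using pwl_cong[OF IH(2), of \<gamma> \<gamma>'] eq IH r by auto
  have \<gamma>0: "\<gamma> t0 = x" using T0 by (simp add: \<gamma>_def)
  have \<gamma>T: "\<gamma> (t0 + T) = y" using eq[of "t0 + T"] y by simp
  have aff: "\<gamma> u = (x - of_real (t0 * v) * sgn (y - x)) + of_real u * (of_real v * sgn (y - x))"
    if "u \<le> t0 + T" for u
    using that by (simp add: \<gamma>_def algebra_simps)
  have last_ge: "t0 + T \<le> last ts'" using hd_le_last[of ts'] IH(2) r by simp
  have pwl: "pwl \<gamma> (t0 # ts')" unfolding r pwl.simps
  proof
    show "\<exists>c d. \<forall>u\<in>{t0..t0 + T}. \<gamma> u = c + of_real u * d"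
      by (rule exI[of _ "x - of_real (t0 * v) * sgn (y - x)"], rule exI[of _ "of_real v * sgn (y - x)"])
        (use aff in simp)
  qed (use cong(1) r in simp)
  have ks: "ksum \<gamma> (t0 # ts') = v * plen (x # y # l)"
  proof -
    have "(norm (y - x))\<^sup>2 / T = v * norm (y - x)"
      using assms(1) by (cases "x = y") (auto simp: T_def power2_eq_square)
    then show ?thesis using cong(2) unfolding r by (simp add: \<gamma>0 \<gamma>T distrib_left)
  qed
  have seg': "(u, \<gamma> u) \<in> set (zip (t0 # ts') (x # y # l)) \<or>
       (\<exists>i. Suc i < length (x # y # l) \<and> \<gamma> u \<in> open_segment ((x # y # l) ! i) ((x # y # l) ! Suc i))"
    if u: "t0 \<le> u" "u \<le> last ts'" for u
  proof (cases "t0 + T \<le> u")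
    case True
    then have "(u, \<gamma>' u) \<in> set (zip ts' (y # l)) \<or>
       (\<exists>i. Suc i < length (y # l) \<and> \<gamma>' u \<in> open_segment ((y # l) ! i) ((y # l) ! Suc i))"
      using u by (intro seg) auto
    then show ?thesis
    proof
      assume "\<exists>i. Suc i < length (y # l) \<and> \<gamma>' u \<in> open_segment ((y # l) ! i) ((y # l) ! Suc i)"
      then obtain i where "Suc i < length (y # l) \<and> \<gamma>' u \<in> open_segment ((y # l) ! i) ((y # l) ! Suc i)"
        by blast
      then show ?thesis using eq[OF True] by (intro disjI2 exI[of _ "Suc i"]) auto
    qed (use eq[OF True] in auto)
  next
    case False
    show ?thesis
    proof (cases "u = t0")
      case True
      then show ?thesis using \<gamma>0 by simp
    next
      case False
      then have u': "t0 < u" "u < t0 + T" using u \<open>\<not> t0 + T \<le> u\<close> by auto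
      then have Tpos: "0 < T" by simp
      then have xy: "x \<noteq> y" by (auto simp: T_def)
      define k where "k = (u - t0) / T"
      have k: "0 < k" "k < 1" using u' Tpos by (auto simp: k_def field_simps)
      have "(u - t0) * v = k * norm (y - x)"
        using xy assms(1) by (simp add: k_def T_def)
      then have "\<gamma> u = x + of_real (k * norm (y - x)) * sgn (y - x)"
        using u' by (simp add: \<gamma>_def del: of_real_mult)
      also have "\<dots> = x + of_real k * (of_real (norm (y - x)) * sgn (y - x))" by simp
      also have "\<dots> = x + of_real k * (y - x)" by (simp add: sgn_eq)
      also have "\<dots> = (1 - k) *\<^sub>R x + k *\<^sub>R y" by (simp add: scaleR_conv_of_real algebra_simps)
      finally have "\<gamma> u \<in> open_segment x y" using k xy by (auto simp: in_segment)
      then show ?thesis by (intro disjI2 exI[of _ 0]) auto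
    qed
  qed
  have l1: "norm (\<gamma> w - \<gamma> u) \<le> v * (w - u)" if "u \<le> w" "w \<le> t0 + T" for u w
  proof -
    have "\<gamma> w - \<gamma> u = of_real (v * (w - u)) * sgn (y - x)"
      using that by (simp add: \<gamma>_def algebra_simps)
    then have "norm (\<gamma> w - \<gamma> u) = v * (w - u) * norm (sgn (y - x))"
      using assms(1) that by (simp add: norm_mult del: of_real_mult of_real_diff)
    also have "\<dots> \<le> v * (w - u)"
      using assms(1) that by (intro mult_left_le) (auto simp: norm_sgn)
    finally show ?thesis .
  qed
  have lip': "norm (\<gamma> w - \<gamma> u) \<le> v * (w - u)" if "t0 \<le> u" "u \<le> w" "w \<le> last ts'" for u w
  proof -
    consider "w \<le> t0 + T" | "t0 + T \<le> u" | "u \<le> t0 + T" "t0 + T \<le> w" by linarith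
    then show ?thesis
    proof cases
      case 1
      then show ?thesis using l1 that by simp
    next
      case 2
      then show ?thesis using lip[of u w] eq that by simp
    next
      case 3
      have "norm (\<gamma> w - y) \<le> v * (w - (t0 + T))"
        using lip[of "t0 + T" w] eq[of w] y 3 that by simp
      moreover have "norm (y - \<gamma> u) \<le> v * ((t0 + T) - u)"
        using l1[of u "t0 + T"] 3 \<gamma>T by simp
      moreover have "norm (\<gamma> w - \<gamma> u) \<le> norm (\<gamma> w - y) + norm (y - \<gamma> u)"
        using norm_triangle_ineq[of "\<gamma> w - y" "y - \<gamma> u"] by simp
      ultimately show ?thesis by (simp add: algebra_simps)
    qed
  qed
  have dif': "(t0 # ts') ! Suc i - (t0 # ts') ! i = norm ((x # y # l) ! Suc i - (x # y # l) ! i) / v"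
    if "Suc i < length (x # y # l)" for i
  proof (cases i)
    case 0
    then show ?thesis by (simp add: r T_def)
  next
    case (Suc j)
    then show ?thesis using dif[of j] that by simp
  qed
  have "last (t0 # ts') = t0 + plen (x # y # l) / v"
    using IH(4) r by (simp add: T_def add_divide_distrib)
  moreover have "sorted (t0 # ts')" using IH(2) T0 r by auto
  moreover have "last (t0 # ts') = last ts'" using r by simp
  moreover have "map \<gamma> (t0 # ts') = x # y # l" using cong(3) \<gamma>0 by simp
  moreover have "length (t0 # ts') = length (x # y # l)" using IH(1) by simp
  ultimately have "polyline v t0 (x # y # l) \<gamma> (t0 # ts')"
    unfolding polyline_def using pwl ks seg' lip' dif' by simp
  then show ?case by blast
qed auto

section \<open>General position and existence of minimisers\<close>

definition locfin :: "complex set \<Rightarrow> bool" where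
  "locfin P \<longleftrightarrow> (\<forall>B. bounded B \<longrightarrow> finite (P \<inter> B))"

text \<open>Each clause protects one kind of edge. The first two keep points off the final
  horizontal edge, whether it starts at the origin or at a point; the third protects the edge
  leaving the origin, the last the edges between points. The polyline through a list then meets
  points at vertices only.\<close>

definition generic :: "complex set \<Rightarrow> bool" where
  "generic P \<longleftrightarrow> (\<forall>p\<in>P. Im p \<noteq> 0) \<and> (\<forall>p\<in>P. \<forall>q\<in>P. p \<noteq> q \<longrightarrow> Im p \<noteq> Im q) \<and>
    (\<forall>p\<in>P. \<forall>q\<in>P. p \<notin> open_segment 0 q) \<and>
    (\<forall>p\<in>P. \<forall>q\<in>P. \<forall>w\<in>P. p \<notin> open_segment q w)"

lemma open_segment_Im: "Im a = Im b \<Longrightarrow> p \<in> open_segment a b \<Longrightarrow> Im p = Im a"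
  by (auto simp: in_segment) (simp add: algebra_simps)

lemma generic_open_segment:
  assumes "generic P" "set l \<subseteq> P" "p \<in> P" "vs = 0 # l @ [foot t l]" "Suc i < length vs"
  shows "p \<notin> open_segment (vs ! i) (vs ! Suc i)"
proof
  assume p: "p \<in> open_segment (vs ! i) (vs ! Suc i)"
  show False
  proof (cases "Suc i = Suc (length l)")
    case True
    have l: "vs ! Suc i = foot t l" "vs ! i = last (0 # l)"
      using True assms(4) by (auto simp: nth_append nth_Cons' last_conv_nth)
    have Im: "Im p = Im (last (0 # l))"
      using open_segment_Im[of "last (0 # l)" "foot t l" p] p l by (simp add: foot_def del: last.simps)
    show False
    proof (cases "l = []")
      case True
      then show False using Im assms(1,3) by (auto simp: generic_def)
    next
      case False
      then have "last l \<in> P" "Im p = Im (last l)" using assms(2) Im by auto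
      then have "p = last l" using assms(1,3) by (auto simp: generic_def)
      then show False using p l False by (auto simp: open_segment_def)
    qed
  next
    case False
    then have i: "i < length l" using assms(4,5) by simp
    then have "vs ! Suc i \<in> P" using assms(2,4) by (auto simp: nth_append)
    moreover have "vs ! i = 0 \<or> vs ! i \<in> P"
    proof (cases i)
      case (Suc j)
      then have "l ! j \<in> set l" using i by (intro nth_mem) simp
      then have "l ! j \<in> P" using assms(2) by blast
      then show ?thesis using assms(4) Suc i by (simp add: nth_append)
    qed (use assms(4) in simp)
    ultimately show False using p assms(1,3) unfolding generic_def by metis
  qed
qed

text \<open>As \<open>l\<close> is distinct, only the two ends of the vertex list could repeat a
  point. The origin is no point by general position, and if the foot is one, it equals the last
  point of \<open>l\<close>: the last edge has length zero, and both vertices carry the same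
  time.\<close>

lemma visits_unique:
  assumes "generic P" "distinct l" "set l \<subseteq> P" "p \<in> P" "polyline v t0 (0 # l @ [foot t l]) \<gamma> ts"
    "(a, p) \<in> set (zip ts (0 # l @ [foot t l]))" "(b, p) \<in> set (zip ts (0 # l @ [foot t l]))"
  shows "a = b"
proof -
  define vs where "vs = 0 # l @ [foot t l]"
  have pl: "length ts = length vs"
    and dif: "\<And>i. Suc i < length vs \<Longrightarrow> ts ! Suc i - ts ! i = norm (vs ! Suc i - vs ! i) / v"
    using assms(5) by (auto simp: polyline_def vs_def)
  have p0: "p \<noteq> 0" using assms(1,4) by (auto simp: generic_def)
  have last: "ts ! Suc (length l) = ts ! length l \<and> l \<noteq> [] \<and> l ! (length l - 1) = p" if "foot t l = p"
  proof -
    have "l \<noteq> []" using that assms(1,4) by (auto simp: foot_def generic_def)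
    then have "last l \<in> P" using assms(3) by auto
    moreover have "Im p = Im (last l)" using that \<open>l \<noteq> []\<close> by (auto simp: foot_def)
    ultimately have "p = last l" using assms(1,4) by (auto simp: generic_def)
    moreover have "vs ! Suc (length l) = p" using that by (simp add: vs_def nth_append)
    moreover have "vs ! length l = last l"
      using \<open>l \<noteq> []\<close> by (simp add: vs_def nth_append nth_Cons' last_conv_nth)
    ultimately show ?thesis using dif[of "length l"] \<open>l \<noteq> []\<close> by (simp add: vs_def last_conv_nth)
  qed
  have pos: "\<exists>j<length l. l ! j = p \<and> c = ts ! Suc j" if c: "(c, p) \<in> set (zip ts vs)" for c
  proof -
    obtain i where i: "i < length vs" "ts ! i = c" "vs ! i = p"
      using c pl by (auto simp: in_set_zip)
    consider "i = 0" | j where "i = Suc j" "j < length l" | "i = Suc (length l)"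
      using i(1) by (cases i) (auto simp: vs_def less_Suc_eq)
    then show ?thesis
    proof cases
      case 1
      then show ?thesis using i p0 by (simp add: vs_def)
    next
      case (2 j)
      then show ?thesis using i by (intro exI[of _ j]) (simp add: vs_def nth_append)
    next
      case 3
      then have "foot t l = p" using i by (simp add: vs_def nth_append)
      from last[OF this] show ?thesis using 3 i by (intro exI[of _ "length l - 1"]) auto
    qed
  qed
  from pos[of a] pos[of b] assms(6,7) obtain i j where
    "i < length l" "l ! i = p" "a = ts ! Suc i" "j < length l" "l ! j = p" "b = ts ! Suc j"
    unfolding vs_def[symmetric] by blast
  then show ?thesis using assms(2) nth_eq_iff_index_eq[of l i j] by auto
qed

text \<open>The constant-speed polyline through \<open>l\<close> touches at least the points of
  \<open>l\<close>, so its action is at most \<open>- score t s l\<close>, and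
  \<open>path_action_ge\<close> bounds every admissible path from below by the same value. General
  position makes the polyline admissible.\<close>

lemma minimizer_exists:
  assumes P: "locfin P" "generic P" and st: "0 < s" "0 < t"
    and l: "distinct l" "set l \<subseteq> P"
    and max: "\<And>l'. distinct l' \<Longrightarrow> set l' \<subseteq> P \<Longrightarrow> score t s l' \<le> score t s l"
  shows "\<exists>\<gamma>. is_minimizer P (line_at t) s \<gamma> \<and> set l \<subseteq> \<gamma> ` {0..s}"
proof -
  define vs where "vs = 0 # l @ [foot t l]"
  define L where "L = pin_len t l"
  have L: "plen vs = L" by (simp add: L_def vs_def pin_len_eq)
  have Lpos: "0 < L" using pin_len_ge[of t l] st by (simp add: L_def)
  define v where "v = L / s"
  have v: "0 < v" using Lpos st by (simp add: v_def)
  obtain \<gamma> ts where pl: "polyline v 0 vs \<gamma> ts"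
    using polyline_exists[OF v, of vs 0] by (auto simp: vs_def)
  then have ts: "length ts = length vs" "sorted ts" "hd ts = 0" "last ts = s" "pwl \<gamma> ts"
    "map \<gamma> ts = vs" "ksum \<gamma> ts = v * L"
    using L Lpos st by (auto simp: polyline_def v_def)
  have tsne: "ts \<noteq> []" using ts(1) by (auto simp: vs_def)
  have \<gamma>0: "\<gamma> 0 = 0"
    using ts(3,6) tsne by (cases ts) (auto simp: vs_def)
  have \<gamma>s: "\<gamma> s = foot t l"
    using ts(4,6) tsne last_map[of ts \<gamma>] by (auto simp: vs_def)
  have pw: "pw_linear \<gamma> s"
    unfolding pw_linear_pwl using ts by (intro exI[of _ ts]) (auto simp: vs_def)
  have mem: "set ts \<subseteq> {0..s}"
  proof
    fix x assume "x \<in> set ts"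
    then obtain i where i: "i < length ts" "x = ts ! i" by (auto simp: in_set_conv_nth)
    have "ts ! 0 \<le> ts ! i" "ts ! i \<le> ts ! (length ts - 1)"
      using i by (auto intro!: sorted_nth_mono[OF ts(2)])
    then show "x \<in> {0..s}" using i ts(3,4) tsne by (simp add: hd_conv_nth last_conv_nth)
  qed
  have "set l \<subseteq> \<gamma> ` set ts"
  proof -
    have "set (map \<gamma> ts) = set vs" using ts(6) by simp
    then show ?thesis by (auto simp: vs_def)
  qed
  then have img: "set l \<subseteq> \<gamma> ` {0..s}" using mem by blast
  have visits: "visits_once P \<gamma> s"
    unfolding visits_once_def
  proof
    fix p assume p: "p \<in> P"
    have zip: "(u, p) \<in> set (zip ts vs)" if "0 \<le> u" "u \<le> s" "\<gamma> u = p" for u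
    proof -
      have "(u, \<gamma> u) \<in> set (zip ts vs) \<or> (\<exists>i. Suc i < length vs \<and> \<gamma> u \<in> open_segment (vs ! i) (vs ! Suc i))"
        using pl that ts(4) unfolding polyline_def by blast
      then show ?thesis
        using generic_open_segment[OF P(2) l(2) p vs_def] that by blast
    qed
    have "a = b" if "a \<in> {u\<in>{0..s}. \<gamma> u = p}" "b \<in> {u\<in>{0..s}. \<gamma> u = p}" for a b
      using that visits_unique[OF P(2) l(1,2) p, of v 0 t \<gamma> ts a b] pl zip
      unfolding vs_def[symmetric] by simp
    then have "{u\<in>{0..s}. \<gamma> u = p} = {} \<or> (\<exists>a. {u\<in>{0..s}. \<gamma> u = p} = {a})" by blast
    then show "connected {u\<in>{0..s}. \<gamma> u = p}" by (metis connected_empty connected_sing)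
  qed
  have adm: "admissible P 0 (line_at t) s \<gamma>"
    using pw \<gamma>0 \<gamma>s visits by (simp add: admissible_def line_at_def foot_def)
  have "bounded (\<gamma> ` {0..s})" using pwl_bounded[OF ts(2,5) tsne] ts by simp
  then have "finite (P \<inter> \<gamma> ` {0..s})" using P(1) by (simp add: locfin_def)
  moreover have "set l \<subseteq> P \<inter> \<gamma> ` {0..s}" using img l by blast
  ultimately have "length l \<le> card (P \<inter> \<gamma> ` {0..s})"
    using card_mono distinct_card[OF l(1)] by metis
  also have "P \<inter> \<gamma> ` {0..s} = {p\<in>P. p \<in> \<gamma> ` {0..s}}" by blast
  finally have "length l \<le> touched P \<gamma> s" by (simp add: touched_def)
  moreover have "kinetic \<gamma> s = L\<^sup>2 / (2 * s)"
    using has_integral_pwl[OF ts(2,5) tsne] ts(3,4,7)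
    by (simp add: kinetic_def integral_unique v_def power2_eq_square)
  ultimately have up: "path_action P \<gamma> s \<le> - score t s l"
    by (simp add: path_action_def score_def L_def)
  have lower: "- score t s l \<le> path_action P \<eta> s" if adm': "admissible P 0 (line_at t) s \<eta>" for \<eta>
  proof -
    obtain l' where "distinct l'" "set l' \<subseteq> P" "- score t s l' \<le> path_action P \<eta> s"
      using path_action_ge[of \<eta> s t P] adm' st P(1)
      by (auto simp: admissible_def line_at_def locfin_def)
    then show ?thesis using max[of l'] by linarith
  qed
  have "path_action P \<gamma> s = action P s 0 (line_at t)"
    unfolding action_def
  proof (rule sym, rule cInf_eq_minimum)
    show "path_action P \<gamma> s \<in> {path_action P \<gamma> s |\<gamma>. admissible P 0 (line_at t) s \<gamma>}"
      using adm by blast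
    show "path_action P \<gamma> s \<le> x" if "x \<in> {path_action P \<gamma> s |\<gamma>. admissible P 0 (line_at t) s \<gamma>}" for x
      using that lower up by fastforce
  qed
  then show ?thesis using adm img by (auto simp: is_minimizer_def)
qed

lemma cyl_1: "cyl 1 w = {z. \<bar>Im z\<bar> \<le> w}"
proof -
  have "infdist z (range (\<lambda>a::real. of_real a * 1)) = \<bar>Im z\<bar>" for z
  proof (rule antisym)
    have "infdist z (range (\<lambda>a::real. of_real a * 1)) \<le> dist z (of_real (Re z) * 1)"
      by (rule infdist_le) blast
    also have "\<dots> = \<bar>Im z\<bar>" by (simp add: dist_norm cmod_def)
    finally show "infdist z (range (\<lambda>a::real. of_real a * 1)) \<le> \<bar>Im z\<bar>" .
    have "\<bar>Im z\<bar> \<le> dist z (complex_of_real x * 1)" for x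
      using abs_Im_le_cmod[of "z - of_real x"] by (simp add: dist_norm)
    then show "\<bar>Im z\<bar> \<le> infdist z (range (\<lambda>a::real. of_real a * 1))"
      by (subst infdist_notempty) (auto intro!: cINF_greatest)
  qed
  then show ?thesis by (simp add: cyl_def)
qed

section \<open>Poisson counts\<close>

abbreviation area :: "complex set \<Rightarrow> real" where
  "area \<equiv> measure lborel"

definition pois :: "real \<Rightarrow> nat \<Rightarrow> real" where
  "pois r k = r ^ k / fact k * exp (- r)"

text \<open>Point probabilities of the whole vector encode the marginals and the independence at
  once, and can be compared across probability spaces.\<close>

definition poisson_counts :: "'a measure \<Rightarrow> (nat \<Rightarrow> 'a \<Rightarrow> nat) \<Rightarrow> (nat \<Rightarrow> real) \<Rightarrow> nat set \<Rightarrow> bool" where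
  "poisson_counts M N lam I \<longleftrightarrow> (\<forall>i\<in>I. N i \<in> measurable M (count_space UNIV)) \<and>
     (\<forall>k. measure M {x\<in>space M. \<forall>i\<in>I. N i x = k i} = (\<Prod>i\<in>I. pois (lam i) (k i)))"

lemma pois_nonneg: "0 \<le> r \<Longrightarrow> 0 \<le> pois r k"
  by (simp add: pois_def)

lemma pois_pos: "0 < r \<Longrightarrow> 0 < pois r k"
  by (simp add: pois_def)

text \<open>The library's \<open>poisson_pmf\<close> requires a positive rate, but null sets have rate \<open>0\<close>.\<close>

definition pois_pmf :: "real \<Rightarrow> nat pmf" where
  "pois_pmf r = (if r = 0 then return_pmf 0 else poisson_pmf r)"

lemma pmf_pois_pmf: "0 \<le> r \<Longrightarrow> pmf (pois_pmf r) k = pois r k"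
  by (auto simp: pois_pmf_def pois_def indicator_def)

lemma pois_add: "(\<Sum>j\<le>k. pois a j * pois b (k - j)) = pois (a + b) k"
proof -
  have "pois a j * pois b (k - j) = exp (- (a + b)) / fact k * (of_nat (k choose j) * a ^ j * b ^ (k - j))"
    if "j \<le> k" for j
    using that by (simp add: pois_def binomial_fact exp_add[symmetric] field_simps)
  then have "(\<Sum>j\<le>k. pois a j * pois b (k - j)) =
      exp (- (a + b)) / fact k * (\<Sum>j\<le>k. of_nat (k choose j) * a ^ j * b ^ (k - j))"
    by (simp add: sum_distrib_left)
  then show ?thesis by (simp add: binomial_ring[symmetric] pois_def)
qed

lemma poisson_counts_sets:
  assumes "poisson_counts M N lam I" "finite I"
  shows "{x\<in>space M. \<forall>i\<in>I. N i x = k i} \<in> sets M"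
proof -
  have "{x\<in>space M. N i x = k i} \<in> sets M" if "i \<in> I" for i
  proof -
    have "N i -` {k i} \<inter> space M \<in> sets M"
      using assms(1) that unfolding poisson_counts_def by (intro measurable_sets) auto
    also have "N i -` {k i} \<inter> space M = {x\<in>space M. N i x = k i}" by auto
    finally show ?thesis .
  qed
  then show ?thesis using assms(2) by (cases "I = {}") (auto intro!: sets.sets_Collect_finite_All')
qed

lemma poisson_pp_counts:
  assumes M: "prob_space M" and pp: "poisson_pp M \<omega>" and I: "finite I" "disjoint_family_on B I"
    and B: "\<And>i. i \<in> I \<Longrightarrow> B i \<in> sets lborel \<and> bounded (B i)"
  shows "poisson_counts M (\<lambda>i x. card (\<omega> x \<inter> B i)) (\<lambda>i. area (B i)) I"
proof -
  interpret prob_space M by fact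
  have iv: "indep_vars (\<lambda>_. count_space (UNIV :: nat set)) (\<lambda>i x. card (\<omega> x \<inter> B i)) I"
    using pp I B by (auto simp: poisson_pp_def)
  have meas: "(\<lambda>x. card (\<omega> x \<inter> B i)) \<in> measurable M (count_space UNIV)" if "i \<in> I" for i
    using pp B[OF that] by (auto simp: poisson_pp_def)
  have "prob {x\<in>space M. \<forall>i\<in>I. card (\<omega> x \<inter> B i) = k i} = (\<Prod>i\<in>I. pois (area (B i)) (k i))" for k
  proof (cases "I = {}")
    case True
    then show ?thesis using prob_space by simp
  next
    case False
    have "{x\<in>space M. \<forall>i\<in>I. card (\<omega> x \<inter> B i) = k i} =
        (\<Inter>i\<in>I. (\<lambda>x. card (\<omega> x \<inter> B i)) -` {k i} \<inter> space M)"
      using False by auto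
    then have "prob {x\<in>space M. \<forall>i\<in>I. card (\<omega> x \<inter> B i) = k i} =
        (\<Prod>i\<in>I. prob ((\<lambda>x. card (\<omega> x \<inter> B i)) -` {k i} \<inter> space M))"
      using indep_varsD_finite[OF iv False I(1), of "\<lambda>i. {k i}"] by simp
    also have "\<dots> = (\<Prod>i\<in>I. pois (area (B i)) (k i))"
    proof (rule prod.cong)
      fix i assume "i \<in> I"
      then have "prob {x\<in>space M. card (\<omega> x \<inter> B i) = k i} = pois (area (B i)) (k i)"
        using pp B by (auto simp: poisson_pp_def pois_def)
      moreover have "(\<lambda>x. card (\<omega> x \<inter> B i)) -` {k i} \<inter> space M = {x\<in>space M. card (\<omega> x \<inter> B i) = k i}"
        by auto
      ultimately show "prob ((\<lambda>x. card (\<omega> x \<inter> B i)) -` {k i} \<inter> space M) = pois (area (B i)) (k i)"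
        by simp
    qed simp
    finally show ?thesis .
  qed
  then show ?thesis using meas by (simp add: poisson_counts_def)
qed

text \<open>Superposition of independent processes. The event is split by the contribution
  \<open>j\<close> of the first one; extensional \<open>j\<close> make the pieces finite in number
  and disjoint, and exchanging sum and product leaves the convolution \<open>pois_add\<close> in
  each coordinate.\<close>

lemma poisson_counts_add:
  assumes M1: "prob_space M1" and M2: "prob_space M2" and I: "finite I"
    and N1: "poisson_counts M1 N1 l1 I" and N2: "poisson_counts M2 N2 l2 I"
  shows "poisson_counts (M1 \<Otimes>\<^sub>M M2) (\<lambda>i z. N1 i (fst z) + N2 i (snd z)) (\<lambda>i. l1 i + l2 i) I"
proof -
  interpret M1: prob_space M1 by fact
  interpret M2: prob_space M2 by fact
  interpret pair_prob_space M1 M2 ..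
  have meas: "(\<lambda>z. N1 i (fst z) + N2 i (snd z)) \<in> measurable (M1 \<Otimes>\<^sub>M M2) (count_space UNIV)" if "i \<in> I" for i
  proof -
    have [measurable]: "N1 i \<in> measurable M1 (count_space UNIV)" "N2 i \<in> measurable M2 (count_space UNIV)"
      using N1 N2 that by (auto simp: poisson_counts_def)
    show ?thesis by measurable
  qed
  have "measure (M1 \<Otimes>\<^sub>M M2) {z\<in>space (M1 \<Otimes>\<^sub>M M2). \<forall>i\<in>I. N1 i (fst z) + N2 i (snd z) = k i} =
      (\<Prod>i\<in>I. pois (l1 i + l2 i) (k i))" for k
  proof -
    define J where "J = PiE I (\<lambda>i. {..k i})"
    define A where "A j = {x\<in>space M1. \<forall>i\<in>I. N1 i x = j i}" for j
    define B where "B j = {x\<in>space M2. \<forall>i\<in>I. N2 i x = k i - j i}" for j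
    have A: "A j \<in> sets M1" and B: "B j \<in> sets M2" for j
      using poisson_counts_sets[OF N1 I] poisson_counts_sets[OF N2 I] by (auto simp: A_def B_def)
    have finJ: "finite J" using I by (auto simp: J_def intro: finite_PiE)
    have eq: "{z\<in>space (M1 \<Otimes>\<^sub>M M2). \<forall>i\<in>I. N1 i (fst z) + N2 i (snd z) = k i} = (\<Union>j\<in>J. A j \<times> B j)"
    proof (intro equalityI subsetI)
      fix z assume z: "z \<in> {z\<in>space (M1 \<Otimes>\<^sub>M M2). \<forall>i\<in>I. N1 i (fst z) + N2 i (snd z) = k i}"
      define j where "j = restrict (\<lambda>i. N1 i (fst z)) I"
      have le: "N1 i (fst z) \<le> k i" "N2 i (snd z) = k i - N1 i (fst z)" if "i \<in> I" for i
        using z that by (auto dest!: bspec)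
      have "j \<in> J" using le by (auto simp: j_def J_def)
      moreover have "z \<in> A j \<times> B j"
        using z le by (auto simp: A_def B_def j_def space_pair_measure mem_Times_iff)
      ultimately show "z \<in> (\<Union>j\<in>J. A j \<times> B j)" by blast
    next
      fix z assume "z \<in> (\<Union>j\<in>J. A j \<times> B j)"
      then obtain j where j: "j \<in> J" "z \<in> A j \<times> B j" by blast
      then have "N1 i (fst z) + N2 i (snd z) = k i" if "i \<in> I" for i
        using that by (auto simp: A_def B_def J_def PiE_iff)
      then show "z \<in> {z\<in>space (M1 \<Otimes>\<^sub>M M2). \<forall>i\<in>I. N1 i (fst z) + N2 i (snd z) = k i}"
        using j by (auto simp: A_def B_def space_pair_measure)
    qed
    have dis: "disjoint_family_on (\<lambda>j. A j \<times> B j) J"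
    proof (unfold disjoint_family_on_def, intro ballI impI)
      fix j j' assume "j \<in> J" "j' \<in> J" "j \<noteq> j'"
      then obtain i where "i \<in> I" "j i \<noteq> j' i" unfolding J_def by (metis PiE_ext)
      then have "A j \<inter> A j' = {}" by (auto simp: A_def)
      then show "A j \<times> B j \<inter> A j' \<times> B j' = {}" by auto
    qed
    have "measure (M1 \<Otimes>\<^sub>M M2) (\<Union>j\<in>J. A j \<times> B j) = (\<Sum>j\<in>J. measure (M1 \<Otimes>\<^sub>M M2) (A j \<times> B j))"
      using A B finJ dis by (intro finite_measure_finite_Union) auto
    also have "\<dots> = (\<Sum>j\<in>J. measure M1 (A j) * measure M2 (B j))"
      using A B by (intro sum.cong refl) (simp add: measure_def M2.emeasure_pair_measure_Times enn2real_mult)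
    also have "\<dots> = (\<Sum>j\<in>J. \<Prod>i\<in>I. pois (l1 i) (j i) * pois (l2 i) (k i - j i))"
      using N1 N2 unfolding A_def B_def poisson_counts_def by (simp add: prod.distrib)
    also have "\<dots> = (\<Prod>i\<in>I. \<Sum>j\<le>k i. pois (l1 i) j * pois (l2 i) (k i - j))"
      unfolding J_def using I by (subst prod_sum_PiE) auto
    finally show ?thesis by (simp add: eq pois_add)
  qed
  then show ?thesis using meas by (simp add: poisson_counts_def)
qed

section \<open>Count vectors as a countable model of the configuration, and change of
  intensity\<close>

definition count_vec :: "nat set \<Rightarrow> (nat \<Rightarrow> 'a \<Rightarrow> nat) \<Rightarrow> 'a \<Rightarrow> nat \<Rightarrow> nat" where
  "count_vec I N x = (\<lambda>i. if i \<in> I then N i x else 0)"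

lemma countable_finite_support: "finite I \<Longrightarrow> countable {f::nat \<Rightarrow> nat. \<forall>i. i \<notin> I \<longrightarrow> f i = 0}"
proof -
  assume I: "finite I"
  have "{f::nat \<Rightarrow> nat. \<forall>i. i \<notin> I \<longrightarrow> f i = 0} \<subseteq> (\<lambda>g i. if i \<in> I then g i else 0) ` (PiE I (\<lambda>_. UNIV))"
  proof
    fix f :: "nat \<Rightarrow> nat" assume "f \<in> {f. \<forall>i. i \<notin> I \<longrightarrow> f i = 0}"
    then show "f \<in> (\<lambda>g i. if i \<in> I then g i else 0) ` (PiE I (\<lambda>_. UNIV))"
      by (intro image_eqI[of _ _ "restrict f I"]) auto
  qed
  moreover have "countable (PiE I (\<lambda>_. UNIV :: nat set))" using I by (intro countable_PiE) auto
  ultimately show ?thesis by (rule countable_subset[OF _ countable_image])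
qed

text \<open>The default value \<open>0\<close> outside \<open>I\<close> leaves only countably many
  vectors, so \<open>E\<close> may be any set whatever. This is how properties of unclear
  measurability enter: they are read off from counts.\<close>

lemma count_vec_event:
  assumes M: "prob_space M" and N: "poisson_counts M N lam I" and I: "finite I"
    and lam: "\<And>i. i \<in> I \<Longrightarrow> 0 \<le> lam i"
  shows "{x\<in>space M. count_vec I N x \<in> E} \<in> sets M"
    and "emeasure M {x\<in>space M. count_vec I N x \<in> E} =
      (\<integral>\<^sup>+ k. ennreal (\<Prod>i\<in>I. pois (lam i) (k i)) \<partial>count_space (E \<inter> {f. \<forall>i. i \<notin> I \<longrightarrow> f i = 0}))"
proof -
  interpret prob_space M by fact
  define V where "V = E \<inter> {f::nat \<Rightarrow> nat. \<forall>i. i \<notin> I \<longrightarrow> f i = 0}"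
  define A where "A k = {x\<in>space M. \<forall>i\<in>I. N i x = k i}" for k
  have cV: "countable V" unfolding V_def by (rule countable_Int2[OF countable_finite_support[OF I]])
  have A: "A k \<in> sets M" for k unfolding A_def by (rule poisson_counts_sets[OF N I])
  have eq: "{x\<in>space M. count_vec I N x \<in> E} = (\<Union>k\<in>V. A k)"
  proof (intro equalityI subsetI)
    fix x assume "x \<in> {x\<in>space M. count_vec I N x \<in> E}"
    then have "count_vec I N x \<in> V" "x \<in> A (count_vec I N x)" by (auto simp: V_def A_def count_vec_def)
    then show "x \<in> (\<Union>k\<in>V. A k)" by blast
  next
    fix x assume "x \<in> (\<Union>k\<in>V. A k)"
    then obtain k where k: "k \<in> V" "x \<in> A k" by blast
    then have "count_vec I N x = k" by (auto simp: V_def A_def count_vec_def)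
    then show "x \<in> {x\<in>space M. count_vec I N x \<in> E}" using k by (auto simp: V_def A_def)
  qed
  show "{x\<in>space M. count_vec I N x \<in> E} \<in> sets M"
    unfolding eq using A cV by (intro sets.countable_UN') auto
  have dis: "disjoint_family_on A V"
  proof (unfold disjoint_family_on_def, intro ballI impI)
    fix k k' assume k: "k \<in> V" "k' \<in> V" "k \<noteq> k'"
    then obtain i where i: "k i \<noteq> k' i" by auto
    then have "i \<in> I" using k by (auto simp: V_def)
    then show "A k \<inter> A k' = {}" using i by (auto simp: A_def)
  qed
  have "emeasure M (\<Union>k\<in>V. A k) = (\<integral>\<^sup>+ k. emeasure M (A k) \<partial>count_space V)"
    using A cV dis by (intro emeasure_UN_countable) auto
  also have "\<dots> = (\<integral>\<^sup>+ k. ennreal (\<Prod>i\<in>I. pois (lam i) (k i)) \<partial>count_space V)"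
    using N by (intro nn_integral_cong) (simp add: emeasure_eq_measure A_def poisson_counts_def)
  finally show "emeasure M {x\<in>space M. count_vec I N x \<in> E} =
      (\<integral>\<^sup>+ k. ennreal (\<Prod>i\<in>I. pois (lam i) (k i)) \<partial>count_space (E \<inter> {f. \<forall>i. i \<notin> I \<longrightarrow> f i = 0}))"
    unfolding eq V_def .
qed

text \<open>The weights are the point masses of a product of Poisson laws. The bound is wanted for
  the tilted rates in the Cauchy-Schwarz estimate, which belong to no given process.\<close>

lemma poisson_mass_le_1:
  assumes I: "finite I" and lam: "\<And>i. i \<in> I \<Longrightarrow> 0 \<le> lam i"
  shows "(\<integral>\<^sup>+ k. ennreal (\<Prod>i\<in>I. pois (lam i) (k i)) \<partial>count_space (E \<inter> {f. \<forall>i. i \<notin> I \<longrightarrow> f i = 0})) \<le> 1"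
proof -
  define p where "p = Pi_pmf I 0 (\<lambda>i. pois_pmf (lam i))"
  have "(\<integral>\<^sup>+ k. ennreal (\<Prod>i\<in>I. pois (lam i) (k i)) \<partial>count_space (E \<inter> {f. \<forall>i. i \<notin> I \<longrightarrow> f i = 0})) =
      (\<integral>\<^sup>+ k. ennreal (pmf p k) \<partial>count_space (E \<inter> {f. \<forall>i. i \<notin> I \<longrightarrow> f i = 0}))"
  proof (intro nn_integral_cong)
    fix k assume "k \<in> space (count_space (E \<inter> {f. \<forall>i. i \<notin> I \<longrightarrow> f i = 0}))"
    then have "pmf p k = (\<Prod>i\<in>I. pmf (pois_pmf (lam i)) (k i))"
      unfolding p_def using I by (subst pmf_Pi') auto
    then show "ennreal (\<Prod>i\<in>I. pois (lam i) (k i)) = ennreal (pmf p k)"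
      using lam by (simp add: pmf_pois_pmf)
  qed
  also have "\<dots> = emeasure (measure_pmf p) (E \<inter> {f. \<forall>i. i \<notin> I \<longrightarrow> f i = 0})"
    by (rule nn_integral_pmf)
  also have "\<dots> \<le> 1" by (rule measure_pmf.emeasure_le_1)
  finally show ?thesis .
qed

text \<open>The tilted rate \<open>(l + m)^2 / l\<close> is chosen so that the powers agree; the
  exponents then differ by \<open>m^2 / l\<close>, the chi-square contribution of one cell.\<close>

lemma pois_square:
  assumes "0 < l"
  shows "(pois (l + m) k)\<^sup>2 = pois l k * pois ((l + m)\<^sup>2 / l) k * exp (m\<^sup>2 / l)"
proof -
  have "exp (- (l + m)) * exp (- (l + m)) = exp (- l) * exp (- ((l + m)\<^sup>2 / l)) * exp (m\<^sup>2 / l)"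
    unfolding exp_add[symmetric] using assms
    by (simp add: power2_eq_square field_simps)
  moreover have "(l + m) ^ k * (l + m) ^ k = l ^ k * ((l + m)\<^sup>2 / l) ^ k"
    using assms by (simp add: power_mult_distrib[symmetric] power2_eq_square)
  ultimately have "((l + m) ^ k * (l + m) ^ k) * (exp (- (l + m)) * exp (- (l + m))) =
    (l ^ k * ((l + m)\<^sup>2 / l) ^ k) * (exp (- l) * exp (- ((l + m)\<^sup>2 / l)) * exp (m\<^sup>2 / l))"
    by (simp only:)
  moreover have "(pois (l + m) k)\<^sup>2 = ((l + m) ^ k * (l + m) ^ k) * (exp (- (l + m)) * exp (- (l + m))) / (fact k * fact k)"
    by (simp add: pois_def power2_eq_square)
  ultimately show ?thesis
    by (simp add: pois_def)
qed

text \<open>Change of intensity: a Cauchy-Schwarz estimate for the likelihood ratio \<open>q / p\<close>, whose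
  second moment under \<open>p\<close> is \<open>exp (\<Sum>i\<in>I. (mu i)\<^sup>2 / lam i)\<close>.\<close>

lemma poisson_transfer:
  assumes M1: "prob_space M1" and M2: "prob_space M2" and I: "finite I"
    and N1: "poisson_counts M1 N1 lam I" and N2: "poisson_counts M2 N2 (\<lambda>i. lam i + mu i) I"
    and lam: "\<And>i. i \<in> I \<Longrightarrow> 0 < lam i" and mu: "\<And>i. i \<in> I \<Longrightarrow> 0 \<le> mu i" and K: "0 < K"
  shows "measure M2 {x\<in>space M2. count_vec I N2 x \<in> E} \<le>
    K * measure M1 {x\<in>space M1. count_vec I N1 x \<in> E} + exp (\<Sum>i\<in>I. (mu i)\<^sup>2 / lam i) / K"
proof -
  interpret M1: prob_space M1 by fact
  interpret M2: prob_space M2 by fact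
  define V where "V = E \<inter> {f::nat \<Rightarrow> nat. \<forall>i. i \<notin> I \<longrightarrow> f i = 0}"
  define p where "p k = (\<Prod>i\<in>I. pois (lam i) (k i))" for k
  define q where "q k = (\<Prod>i\<in>I. pois (lam i + mu i) (k i))" for k
  define h where "h k = (\<Prod>i\<in>I. pois ((lam i + mu i)\<^sup>2 / lam i) (k i))" for k
  define e where "e = exp (\<Sum>i\<in>I. (mu i)\<^sup>2 / lam i)"
  have pos: "0 < p k" "0 < q k" "0 < h k" for k
    unfolding p_def q_def h_def
    using lam mu by (auto intro!: prod_pos pois_pos divide_pos_pos zero_less_power add_pos_nonneg)
  have e0: "0 < e" by (simp add: e_def)
  have sq: "(q k)\<^sup>2 = p k * h k * e" for k
    unfolding p_def q_def h_def e_def prod_power_distrib exp_sum[OF I] prod.distrib[symmetric]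
    using lam by (intro prod.cong refl pois_square) auto
  \<comment> \<open>Either \<open>q / p\<close> is at most \<open>K\<close>, or
    \<open>q * (K * p) \<le> q^2 = p * h * e\<close>, which bounds \<open>q\<close> by the second
    summand.\<close>
  have le: "q k \<le> K * p k + e / K * h k" for k
  proof (cases "q k \<le> K * p k")
    case True
    moreover have "0 \<le> e / K * h k" using e0 K pos(3)[of k] by simp
    ultimately show ?thesis by linarith
  next
    case False
    then have "q k * (K * p k) \<le> q k * q k" using pos(2)[of k] by simp
    also have "\<dots> = p k * h k * e" using sq[of k] by (simp add: power2_eq_square)
    finally have "q k * K \<le> h k * e" using pos(1)[of k] by (simp add: mult_ac)
    then have "q k \<le> e / K * h k" using K by (simp add: field_simps)
    moreover have "0 \<le> K * p k" using K pos(1)[of k] by simp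
    ultimately show ?thesis by linarith
  qed
  have "ennreal (measure M2 {x\<in>space M2. count_vec I N2 x \<in> E}) = (\<integral>\<^sup>+ k. ennreal (q k) \<partial>count_space V)"
    unfolding M2.emeasure_eq_measure[symmetric] V_def q_def
    by (rule count_vec_event(2)[OF M2 N2 I]) (use lam mu in \<open>auto intro!: add_nonneg_nonneg simp: less_imp_le\<close>)
  also have "\<dots> \<le> (\<integral>\<^sup>+ k. ennreal K * ennreal (p k) + ennreal (e / K) * ennreal (h k) \<partial>count_space V)"
  proof (rule nn_integral_mono)
    fix k
    have "ennreal (q k) \<le> ennreal (K * p k + e / K * h k)" using le[of k] by (rule ennreal_leI)
    also have "\<dots> = ennreal K * ennreal (p k) + ennreal (e / K) * ennreal (h k)"
    proof -
      have "ennreal (K * p k) = ennreal K * ennreal (p k)" "ennreal (e / K * h k) = ennreal (e / K) * ennreal (h k)"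
        using K e0 pos[of k] by (intro ennreal_mult; simp)+
      then show ?thesis using K e0 pos[of k] by (subst ennreal_plus) auto
    qed
    finally show "ennreal (q k) \<le> ennreal K * ennreal (p k) + ennreal (e / K) * ennreal (h k)" .
  qed
  also have "\<dots> = ennreal K * (\<integral>\<^sup>+ k. ennreal (p k) \<partial>count_space V) +
      ennreal (e / K) * (\<integral>\<^sup>+ k. ennreal (h k) \<partial>count_space V)"
    by (subst nn_integral_add) (auto simp: nn_integral_cmult)
  also have "\<dots> \<le> ennreal K * ennreal (measure M1 {x\<in>space M1. count_vec I N1 x \<in> E}) + ennreal (e / K) * 1"
  proof (intro add_mono mult_left_mono)
    show "(\<integral>\<^sup>+ k. ennreal (p k) \<partial>count_space V) \<le> ennreal (measure M1 {x\<in>space M1. count_vec I N1 x \<in> E})"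
      unfolding M1.emeasure_eq_measure[symmetric] V_def p_def
      using count_vec_event(2)[OF M1 N1 I] lam by (simp add: less_imp_le)
    show "(\<integral>\<^sup>+ k. ennreal (h k) \<partial>count_space V) \<le> 1"
      unfolding h_def V_def using lam by (intro poisson_mass_le_1 I) (simp add: less_imp_le)
  qed auto
  also have "\<dots> = ennreal (K * measure M1 {x\<in>space M1. count_vec I N1 x \<in> E} + e / K)"
    using K e0 by (simp add: ennreal_plus ennreal_mult less_imp_le)
  finally show ?thesis
    unfolding e_def by (subst (asm) ennreal_le_iff) (use K in auto)
qed

section \<open>Law and tails of a single count\<close>

lemma poisson_pp_prob:
  assumes M: "prob_space M" and pp: "poisson_pp M \<omega>" and B: "B \<in> sets lborel" "bounded B"
  shows "{x\<in>space M. card (\<omega> x \<inter> B) \<in> A} \<in> sets M"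
    and "measure M {x\<in>space M. card (\<omega> x \<inter> B) \<in> A} = measure_pmf.prob (pois_pmf (area B)) A"
proof -
  interpret prob_space M by fact
  define N where "N x = card (\<omega> x \<inter> B)" for x
  have N[measurable]: "N \<in> measurable M (count_space UNIV)"
    using pp B unfolding N_def[abs_def] poisson_pp_def by blast
  have pk: "measure M {x\<in>space M. card (\<omega> x \<inter> B) = k} =
      (area B) ^ k / fact k * exp (- area B)" for k
    using pp B unfolding poisson_pp_def by blast
  have set: "{x\<in>space M. N x \<in> A} = N -` A \<inter> space M" for A by auto
  show "{x\<in>space M. card (\<omega> x \<inter> B) \<in> A} \<in> sets M"
    using measurable_sets[OF N, of A] unfolding set[of A, symmetric] N_def by simp
  have "distr M (count_space UNIV) N = measure_pmf (pois_pmf (area B))"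
  proof (rule measure_eqI_countable)
    fix k :: nat
    have "{x\<in>space M. N x = k} = N -` {k} \<inter> space M" by auto
    then have "measure M (N -` {k} \<inter> space M) = (area B) ^ k / fact k * exp (- area B)"
      using pk[of k] by (simp add: N_def)
    then show "emeasure (distr M (count_space UNIV) N) {k} =
        emeasure (measure_pmf (pois_pmf (area B))) {k}"
      by (simp add: emeasure_distr emeasure_eq_measure emeasure_pmf_single pmf_pois_pmf pois_def)
  qed auto
  then have "measure (distr M (count_space UNIV) N) A = measure_pmf.prob (pois_pmf (area B)) A"
    by simp
  then show "measure M {x\<in>space M. card (\<omega> x \<inter> B) \<in> A} = measure_pmf.prob (pois_pmf (area B)) A"
    by (simp add: measure_distr set[symmetric] N_def)
qed

text \<open>Exponential tilting in pointwise form: on the tail a Poisson law is dominated by one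
  with doubled or halved rate, whose total mass is at most 1.\<close>

lemma measure_pmf_domination:
  assumes "\<And>k. k \<in> A \<Longrightarrow> pmf p k \<le> c * pmf q k" "0 \<le> c"
  shows "measure_pmf.prob p A \<le> c"
proof -
  have "ennreal (measure_pmf.prob p A) = (\<integral>\<^sup>+ k. ennreal (pmf p k) \<partial>count_space A)"
    by (simp add: nn_integral_pmf measure_pmf.emeasure_eq_measure)
  also have "\<dots> \<le> (\<integral>\<^sup>+ k. ennreal c * ennreal (pmf q k) \<partial>count_space A)"
    using assms by (intro nn_integral_mono) (simp add: ennreal_mult[symmetric] ennreal_leI)
  also have "\<dots> = ennreal c * ennreal (measure_pmf.prob q A)"
    by (simp add: nn_integral_cmult nn_integral_pmf measure_pmf.emeasure_eq_measure)
  also have "\<dots> \<le> ennreal c * 1"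
    by (intro mult_left_mono) auto
  finally show ?thesis using assms(2) by (simp add: ennreal_le_iff)
qed

lemma poisson_upper_tail:
  assumes "0 \<le> a"
  shows "measure_pmf.prob (pois_pmf a) {m..} \<le> exp a / 2 ^ m"
proof (rule measure_pmf_domination[where q = "pois_pmf (2 * a)"])
  fix k assume "k \<in> {m..}"
  then have "(2::real) ^ m \<le> 2 ^ k" by simp
  then have "pois a k * 2 ^ m \<le> pois a k * 2 ^ k"
    using pois_nonneg[OF assms] by (intro mult_left_mono) auto
  also have "\<dots> = exp a * pois (2 * a) k"
  proof -
    have "exp a * exp (- (2 * a)) = exp (- a)" by (simp flip: exp_add)
    then show ?thesis by (simp add: pois_def power_mult_distrib mult_ac)
  qed
  finally show "pmf (pois_pmf a) k \<le> exp a / 2 ^ m * pmf (pois_pmf (2 * a)) k"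
    using assms by (simp add: pmf_pois_pmf field_simps)
qed auto

lemma poisson_lower_tail:
  assumes "0 \<le> a"
  shows "measure_pmf.prob (pois_pmf a) {..m} \<le> 2 ^ m * exp (- (a / 2))"
proof (rule measure_pmf_domination[where q = "pois_pmf (a / 2)"])
  fix k assume "k \<in> {..m}"
  then have "(2::real) ^ k \<le> 2 ^ m" by simp
  have "exp (- a) = exp (- (a / 2)) * exp (- (a / 2))" by (simp flip: exp_add)
  then have "pois a k = 2 ^ k * exp (- (a / 2)) * pois (a / 2) k"
    by (simp add: pois_def power_divide)
  also have "\<dots> \<le> 2 ^ m * exp (- (a / 2)) * pois (a / 2) k"
    using \<open>(2::real) ^ k \<le> 2 ^ m\<close> pois_nonneg[of "a / 2"] assms by (intro mult_right_mono) auto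
  finally show "pmf (pois_pmf a) k \<le> 2 ^ m * exp (- (a / 2)) * pmf (pois_pmf (a / 2)) k"
    using assms by (simp add: pmf_pois_pmf)
qed auto

lemma poisson_ge_1:
  assumes "0 \<le> a"
  shows "measure_pmf.prob (pois_pmf a) {1..} \<le> a"
proof -
  have "{1..} = UNIV - {0::nat}" by auto
  then have "measure_pmf.prob (pois_pmf a) {1..} = 1 - measure_pmf.prob (pois_pmf a) {0}"
    using measure_pmf.prob_compl[of "{0}" "pois_pmf a"] by simp
  also have "\<dots> = 1 - exp (- a)" using assms by (simp add: measure_pmf_single pmf_pois_pmf pois_def)
  also have "\<dots> \<le> a" using exp_ge_add_one_self[of "- a"] by simp
  finally show ?thesis .
qed

text \<open>The quadratic bound makes double occupation negligible when it is summed over about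
  \<open>1 / a\<close> cells of area \<open>a\<close>.\<close>

lemma poisson_ge_2:
  assumes "0 \<le> a"
  shows "measure_pmf.prob (pois_pmf a) {2..} \<le> a\<^sup>2"
proof -
  have "{2..} = UNIV - {0::nat, 1}" by auto
  then have "measure_pmf.prob (pois_pmf a) {2..} = 1 - measure_pmf.prob (pois_pmf a) {0, 1}"
    using measure_pmf.prob_compl[of "{0, 1}" "pois_pmf a"] by simp
  also have "measure_pmf.prob (pois_pmf a) {0, 1} = exp (- a) * (1 + a)"
    using assms by (subst measure_measure_pmf_finite) (auto simp: algebra_simps pmf_pois_pmf pois_def)
  also have "1 - exp (- a) * (1 + a) \<le> 1 - (1 - a) * (1 + a)"
    using exp_ge_add_one_self[of "- a"] assms by (intro diff_left_mono mult_right_mono) auto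
  also have "\<dots> = a\<^sup>2" by (simp add: power2_eq_square algebra_simps)
  finally show ?thesis .
qed

section \<open>Invariance of the law and linear growth of the number of points on a path\<close>

text \<open>The determinant formula for linear images lives on \<open>real ^ 2\<close>; areas in the
  complex plane are carried over along this isometry.\<close>

definition of_vec2 :: "real ^ 2 \<Rightarrow> complex" where
  "of_vec2 v = Complex (v $ 1) (v $ 2)"

definition to_vec2 :: "complex \<Rightarrow> real ^ 2" where
  "to_vec2 z = vector [Re z, Im z]"

lemma of_to_vec2 [simp]: "of_vec2 (to_vec2 z) = z" "to_vec2 (of_vec2 v) = v"
  by (simp_all add: of_vec2_def to_vec2_def vec_eq_iff forall_2)

lemma linear_of_vec2: "linear of_vec2"
  by (intro linearI) (simp_all add: of_vec2_def complex_eq_iff)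

lemma linear_to_vec2: "linear to_vec2"
  by (intro linearI) (simp_all add: to_vec2_def vec_eq_iff forall_2)

lemma of_vec2_measurable [measurable]: "of_vec2 \<in> borel_measurable borel"
  by (intro borel_measurable_continuous_onI linear_continuous_on linear_conv_bounded_linear[THEN iffD1] linear_of_vec2)

lemma lborel_of_vec2: "distr lborel borel of_vec2 = lborel"
proof (rule sym, rule lborel_eqI)
  fix l u :: complex
  assume le: "\<And>b. b \<in> Basis \<Longrightarrow> l \<bullet> b \<le> u \<bullet> b"
  have lu: "Re l \<le> Re u" "Im l \<le> Im u"
    using le[of 1] le[of \<i>] by (simp_all add: Basis_complex_def)
  have B: "(Basis :: (real^2) set) = {axis 1 1, axis 2 1}"
    by (auto simp: Basis_vec_def UNIV_2)
  have ne: "axis 1 (1::real) \<noteq> (axis 2 1 :: real^2)" by (simp add: axis_eq_axis)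
  have "of_vec2 -` box l u = box (to_vec2 l) (to_vec2 u)"
    by (auto simp: box_def Basis_complex_def B of_vec2_def to_vec2_def inner_axis)
  then have "emeasure (distr lborel borel of_vec2) (box l u) = emeasure lborel (box (to_vec2 l) (to_vec2 u))"
    by (simp add: emeasure_distr)
  also have "\<dots> = ennreal ((Re u - Re l) * (Im u - Im l))"
    using lu ne by (subst emeasure_lborel_box) (auto simp: B to_vec2_def inner_axis)
  also have "\<dots> = ennreal (\<Prod>b\<in>Basis. (u - l) \<bullet> b)"
    by (simp add: Basis_complex_def)
  finally show "emeasure (distr lborel borel of_vec2) (box l u) = ennreal (\<Prod>b\<in>Basis. (u - l) \<bullet> b)" .
qed simp

text \<open>Multiplication by \<open>u\<close> is a linear map of determinant
  \<open>(norm u)^2\<close>. For \<open>norm u = 1\<close> this yields isotropy; for large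
  \<open>u\<close> the image of the process is a sparse process of intensity
  \<open>1 / (norm u)^2\<close>.\<close>

lemma measure_mult_vimage:
  fixes u :: complex
  assumes u: "u \<noteq> 0" and B: "B \<in> sets borel" "bounded B"
  shows "(*) u -` B \<in> sets borel" "bounded ((*) u -` B)"
    and "area ((*) u -` B) = area B / (norm u)\<^sup>2"
proof -
  have m: "(*) u \<in> borel_measurable borel" by (intro borel_measurable_continuous_onI continuous_intros)
  show S: "(*) u -` B \<in> sets borel" using measurable_sets[OF m B(1)] by simp
  obtain b where b: "\<And>z. z \<in> B \<Longrightarrow> norm z \<le> b" using B(2) by (auto simp: bounded_iff)
  show bS: "bounded ((*) u -` B)"
    unfolding bounded_iff
  proof (intro exI ballI)
    fix z assume "z \<in> (*) u -` B"
    then have "norm u * norm z \<le> b" using b by (fastforce simp: norm_mult)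
    then show "norm z \<le> b / norm u" using u by (simp add: field_simps)
  qed
  define f where "f = (\<lambda>v. to_vec2 (u * of_vec2 v))"
  have lin: "linear f"
    unfolding f_def using linear_compose[OF linear_of_vec2 linear_compose[OF _ linear_to_vec2], of "(*) u"]
    by (simp add: o_def linear_times)
  have det: "det (matrix f) = (norm u)\<^sup>2"
    by (simp add: det_2 matrix_def f_def of_vec2_def to_vec2_def axis_def cmod_power2)
      (simp add: power2_eq_square)
  define V where "V = of_vec2 -` ((*) u -` B)"
  have V: "V \<in> sets borel" unfolding V_def using measurable_sets[OF of_vec2_measurable S] by simp
  have "to_vec2 ` ((*) u -` B) = V" unfolding V_def by (auto intro: rev_image_eqI simp: image_iff)
  then have "bounded V"
    using bounded_linear_image[OF bS linear_conv_bounded_linear[THEN iffD1, OF linear_to_vec2]] by simp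
  then have Vm: "V \<in> lmeasurable" using V by (intro bounded_set_imp_lmeasurable) auto
  have "f ` V = of_vec2 -` B"
  proof (intro equalityI subsetI)
    fix v assume "v \<in> of_vec2 -` B"
    then have "f (to_vec2 (of_vec2 v / u)) = v" "to_vec2 (of_vec2 v / u) \<in> V"
      using u by (auto simp: f_def V_def)
    then show "v \<in> f ` V" by (metis imageI)
  qed (auto simp: f_def V_def)
  then have "measure lebesgue (of_vec2 -` B) = (norm u)\<^sup>2 * measure lebesgue V"
    using measure_linear_image[OF lin Vm] det by simp
  moreover have "of_vec2 -` B \<in> sets borel" using measurable_sets[OF of_vec2_measurable B(1)] by simp
  ultimately have "measure lborel (of_vec2 -` B) = (norm u)\<^sup>2 * measure lborel V"
    using V by (simp add: measure_completion)
  moreover have "area X = measure lborel (of_vec2 -` X)" if "X \<in> sets borel" for X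
    using that by (subst lborel_of_vec2[symmetric]) (simp add: measure_distr)
  ultimately show "area ((*) u -` B) = area B / (norm u)\<^sup>2"
    using B S u by (simp add: V_def)
qed

lemma card_image_mult: "u \<noteq> 0 \<Longrightarrow> card ((*) u ` W \<inter> B) = card (W \<inter> (*) u -` B)" for u :: complex
proof -
  assume "u \<noteq> 0"
  then have "inj_on ((*) u) (W \<inter> (*) u -` B)" by (auto simp: inj_on_def)
  moreover have "(*) u ` W \<inter> B = (*) u ` (W \<inter> (*) u -` B)" by auto
  ultimately show ?thesis by (simp add: card_image)
qed

lemma poisson_pp_image_prob:
  fixes u :: complex
  assumes M: "prob_space M" and pp: "poisson_pp M \<omega>" and u: "u \<noteq> 0" and B: "B \<in> sets borel" "bounded B"
  shows "{x\<in>space M. card ((*) u ` \<omega> x \<inter> B) \<in> A} \<in> sets M"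
    and "measure M {x\<in>space M. card ((*) u ` \<omega> x \<inter> B) \<in> A} =
      measure_pmf.prob (pois_pmf (area B / (norm u)\<^sup>2)) A"
  using measure_mult_vimage[OF u B] poisson_pp_prob[OF M pp, of "(*) u -` B" A]
  by (simp_all add: card_image_mult[OF u])

lemma poisson_counts_image:
  fixes u :: complex
  assumes M: "prob_space M" and pp: "poisson_pp M \<omega>" and I: "finite I" "disjoint_family_on B I" and u: "u \<noteq> 0"
    and B: "\<And>i. i \<in> I \<Longrightarrow> B i \<in> sets borel \<and> bounded (B i)"
  shows "poisson_counts M (\<lambda>i x. card ((*) u ` \<omega> x \<inter> B i)) (\<lambda>i. area (B i) / (norm u)\<^sup>2) I"
proof -
  have "poisson_counts M (\<lambda>i x. card (\<omega> x \<inter> (*) u -` B i)) (\<lambda>i. area ((*) u -` B i)) I"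
  proof (rule poisson_pp_counts[OF M pp I(1)])
    show "disjoint_family_on (\<lambda>i. (*) u -` B i) I"
      using I(2) by (fastforce simp: disjoint_family_on_def)
    show "(*) u -` B i \<in> sets lborel \<and> bounded ((*) u -` B i)" if "i \<in> I" for i
      using measure_mult_vimage[OF u] B[OF that] by simp
  qed
  then show ?thesis
    unfolding poisson_counts_def using measure_mult_vimage(3)[OF u] B u
    by (simp add: card_image_mult cong: prod.cong)
qed

section \<open>Covering a path of given length by a king walk\<close>

lemma measure_rect:
  assumes "Re a \<le> Re b" "Im a \<le> Im b"
  shows "area (cbox a b) = (Re b - Re a) * (Im b - Im a)"
    "area (box a b) = (Re b - Re a) * (Im b - Im a)"
  using assms by (simp_all add: measure_lborel_cbox_eq measure_lborel_box_eq Basis_complex_def)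

lemma floor_step:
  fixes x y :: real
  assumes "\<bar>y - x\<bar> \<le> 1"
  shows "\<lfloor>y\<rfloor> - \<lfloor>x\<rfloor> \<in> {-1, 0, 1}"
proof -
  have "\<lfloor>y\<rfloor> \<le> \<lfloor>x + 1\<rfloor>" "\<lfloor>x\<rfloor> \<le> \<lfloor>y + 1\<rfloor>" using assms by (intro floor_mono; linarith)+
  then show ?thesis by auto
qed

definition king :: "complex set" where
  "king = (\<lambda>(a, b). Complex a b) ` ({-1, 0, 1} \<times> {-1, 0, 1})"

lemma kingI: "a \<in> {-1, 0, 1} \<Longrightarrow> b \<in> {-1, 0, 1} \<Longrightarrow> Complex a b \<in> king"
  unfolding king_def by (rule image_eqI[of _ _ "(a, b)"], simp, rule SigmaI)

text \<open>A position of the walk is the lower left corner of a unit square; the box consists of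
  that square and its eight neighbours.\<close>

definition king_region :: "nat \<Rightarrow> complex list \<Rightarrow> complex set" where
  "king_region n st = (\<Union>j\<le>n. cbox (sum_list (take j st) - Complex 1 1) (sum_list (take j st) + Complex 2 2))"

lemma finite_king: "finite king" "card king \<le> 9"
proof -
  show "finite king" by (auto simp: king_def)
  have "card king \<le> card ({-1, 0, 1::real} \<times> {-1, 0, 1::real})"
    unfolding king_def by (intro card_image_le) auto
  then show "card king \<le> 9" by (simp add: card_insert_if)
qed

lemma king_region_sets: "king_region n st \<in> sets borel" "bounded (king_region n st)"
  unfolding king_region_def by (auto intro!: sets.finite_UN bounded_UN)

lemma king_region_measure: "area (king_region n st) \<le> 9 * (real n + 1)"
proof -
  have "area (king_region n st) \<le>
      (\<Sum>j\<le>n. area (cbox (sum_list (take j st) - Complex 1 1) (sum_list (take j st) + Complex 2 2)))"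
    unfolding king_region_def
    by (rule measure_UNION_le) (auto simp: emeasure_lborel_cbox_finite less_top[symmetric])
  also have "\<dots> = (\<Sum>j\<le>n. 9)" by (intro sum.cong) (auto simp: measure_rect)
  finally show ?thesis by simp
qed

text \<open>The path is run at unit speed, sampled at integer times and rounded down. Consecutive
  samples are at distance at most 1, so rounding gives king steps; every point is within distance 1
  of the sample before it, hence in the box around its square.\<close>

lemma king_region_covers:
  assumes "plen (0 # l) \<le> real n"
  shows "\<exists>st. set st \<subseteq> king \<and> length st = n \<and> set l \<subseteq> king_region n st"
proof -
  define L where "L = plen (0 # l)"
  obtain \<gamma> ts where pl: "polyline 1 0 (0 # l) \<gamma> ts" using polyline_exists[of 1 "0 # l" 0] by auto
  then have ts: "sorted ts" "hd ts = 0" "last ts = L" "map \<gamma> ts = 0 # l" "ts \<noteq> []"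
    by (auto simp: polyline_def L_def)
  have lip: "norm (\<gamma> w - \<gamma> u) \<le> w - u" if "0 \<le> u" "u \<le> w" "w \<le> L" for u w
    using pl that ts(3) by (auto simp: polyline_def)
  have L0: "0 \<le> L" by (simp add: L_def)
  have \<gamma>0: "\<gamma> 0 = 0" using ts(2,4,5) by (cases ts) auto
  \<comment> \<open>The minimum lets the walker rest at the end of the path, so the walk has exactly
    \<open>n\<close> steps.\<close>
  define y where "y j = \<gamma> (min (real j) L)" for j
  have ystep: "norm (y (Suc j) - y j) \<le> 1" for j
  proof -
    have "norm (y (Suc j) - y j) \<le> min (real (Suc j)) L - min (real j) L"
      unfolding y_def using L0 by (intro lip) auto
    also have "\<dots> \<le> 1" by auto
    finally show ?thesis .
  qed
  define c where "c j = Complex (of_int \<lfloor>Re (y j)\<rfloor>) (of_int \<lfloor>Im (y j)\<rfloor>)" for j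
  have c0: "c 0 = 0" using \<gamma>0 L0 by (simp add: c_def y_def complex_eq_iff)
  define st where "st = map (\<lambda>j. c (Suc j) - c j) [0..<n]"
  have sum: "sum_list (take j st) = c j" if "j \<le> n" for j
    using that
  proof (induction j)
    case (Suc j)
    then show ?case by (simp add: st_def take_Suc_conv_app_nth)
  qed (simp add: c0)
  have "c (Suc j) - c j \<in> king" for j
  proof -
    have "\<bar>Re (y (Suc j)) - Re (y j)\<bar> \<le> 1" "\<bar>Im (y (Suc j)) - Im (y j)\<bar> \<le> 1"
      using abs_Re_le_cmod[of "y (Suc j) - y j"] abs_Im_le_cmod[of "y (Suc j) - y j"] ystep[of j] by auto
    then have "\<lfloor>Re (y (Suc j))\<rfloor> - \<lfloor>Re (y j)\<rfloor> \<in> {-1, 0, 1}" "\<lfloor>Im (y (Suc j))\<rfloor> - \<lfloor>Im (y j)\<rfloor> \<in> {-1, 0, 1}"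
      by (intro floor_step; simp)+
    then have "real_of_int (\<lfloor>Re (y (Suc j))\<rfloor> - \<lfloor>Re (y j)\<rfloor>) \<in> {-1, 0, 1}"
      "real_of_int (\<lfloor>Im (y (Suc j))\<rfloor> - \<lfloor>Im (y j)\<rfloor>) \<in> {-1, 0, 1}"
      by auto
    moreover have "c (Suc j) - c j = Complex (real_of_int (\<lfloor>Re (y (Suc j))\<rfloor> - \<lfloor>Re (y j)\<rfloor>))
        (real_of_int (\<lfloor>Im (y (Suc j))\<rfloor> - \<lfloor>Im (y j)\<rfloor>))"
      by (simp add: c_def complex_eq_iff)
    ultimately show ?thesis by (simp only: kingI)
  qed
  then have "set st \<subseteq> king" by (auto simp: st_def)
  moreover have "length st = n" by (simp add: st_def)
  moreover have "p \<in> king_region n st" if "p \<in> set l" for p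
  proof -
    have "p \<in> set (map \<gamma> ts)" using that ts(4) by simp
    then obtain \<tau> where \<tau>: "\<tau> \<in> set ts" "\<gamma> \<tau> = p" by auto
    obtain i where i: "i < length ts" "\<tau> = ts ! i" using \<tau> by (auto simp: in_set_conv_nth)
    have "ts ! 0 \<le> ts ! i" "ts ! i \<le> ts ! (length ts - 1)"
      using i by (auto intro!: sorted_nth_mono[OF ts(1)])
    then have \<tau>L: "0 \<le> \<tau>" "\<tau> \<le> L" using i ts(2,3,5) by (simp_all add: hd_conv_nth last_conv_nth)
    define j where "j = nat \<lfloor>\<tau>\<rfloor>"
    have j: "real j \<le> \<tau>" "\<tau> \<le> real j + 1" using \<tau>L by (auto simp: j_def)
    have "real j \<le> real n" using j \<tau>L assms unfolding L_def by linarith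
    then have jn: "j \<le> n" by simp
    have "y j = \<gamma> (real j)" using j \<tau>L by (simp add: y_def min_def)
    then have "norm (p - y j) \<le> 1" using lip[of "real j" \<tau>] j \<tau>L \<tau>(2) by simp
    then have "\<bar>Re p - Re (y j)\<bar> \<le> 1" "\<bar>Im p - Im (y j)\<bar> \<le> 1"
      using abs_Re_le_cmod[of "p - y j"] abs_Im_le_cmod[of "p - y j"] by auto
    then have "p \<in> cbox (c j - Complex 1 1) (c j + Complex 2 2)"
      unfolding in_cbox_complex_iff c_def using floor_correct[of "Re (y j)"] floor_correct[of "Im (y j)"] by simp linarith
    then show ?thesis using jn sum[OF jn] unfolding king_region_def by (intro UN_I[of j]) auto
  qed
  ultimately show ?thesis by blast
qed

text \<open>A path of length \<open>n\<close> follows one of at most \<open>9 ^ n\<close> king walks, and the number of points near a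
  fixed walk has exponential tails.\<close>

lemma path_points_linear:
  assumes M: "prob_space M" and pp: "poisson_pp M \<omega>" and n: "1 \<le> n"
  shows "\<exists>E\<in>sets M. measure M E \<le> (1/2) ^ n \<and>
    (\<forall>x\<in>space M - E. \<forall>l. distinct l \<and> set l \<subseteq> \<omega> x \<and> plen (0 # l) \<le> real n \<longrightarrow> length l < 40 * n)"
proof -
  interpret prob_space M by fact
  define W where "W = {st. set st \<subseteq> king \<and> length st = n}"
  define F where "F st = {x\<in>space M. card (\<omega> x \<inter> king_region n st) \<in> {40 * n..}}" for st
  have W: "finite W" "card W \<le> 9 ^ n"
    unfolding W_def using finite_lists_length_eq[OF finite_king(1), of n] card_lists_length_eq[OF finite_king(1), of n]
      power_mono[OF finite_king(2), of n] by auto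
  have F: "F st \<in> sets M" for st
    unfolding F_def by (rule poisson_pp_prob(1)[OF M pp]) (use king_region_sets in auto)
  have PF: "prob (F st) \<le> exp (9 * (real n + 1)) / 2 ^ (40 * n)" for st
  proof -
    have "prob (F st) = measure_pmf.prob (pois_pmf (area (king_region n st))) {40 * n..}"
      unfolding F_def by (rule poisson_pp_prob(2)[OF M pp]) (use king_region_sets in auto)
    also have "\<dots> \<le> exp (area (king_region n st)) / 2 ^ (40 * n)"
      by (rule poisson_upper_tail) simp
    also have "\<dots> \<le> exp (9 * (real n + 1)) / 2 ^ (40 * n)"
      using king_region_measure[of n st] by (intro divide_right_mono) auto
    finally show ?thesis .
  qed
  have "prob (\<Union>st\<in>W. F st) \<le> (\<Sum>st\<in>W. prob (F st))"
    using W F by (intro finite_measure_subadditive_finite) auto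
  also have "\<dots> \<le> real (card W) * (exp (9 * (real n + 1)) / 2 ^ (40 * n))"
    using PF by (intro sum_bounded_above) auto
  also have "\<dots> \<le> 9 ^ n * (exp (9 * (real n + 1)) / 2 ^ (40 * n))"
  proof (intro mult_right_mono)
    show "real (card W) \<le> 9 ^ n" using W(2) by (metis of_nat_le_iff of_nat_numeral of_nat_power)
  qed auto
  also have "\<dots> \<le> 9 ^ n * (3 ^ (18 * n) / 2 ^ (40 * n))"
  proof (intro mult_left_mono divide_right_mono)
    have "exp (9 * (real n + 1)) \<le> exp (real (18 * n))" using n by simp
    also have "\<dots> = exp 1 ^ (18 * n)" by (simp add: exp_of_nat_mult[symmetric])
    also have "\<dots> \<le> 3 ^ (18 * n)" using exp_le by (intro power_mono) auto
    finally show "exp (9 * (real n + 1)) \<le> 3 ^ (18 * n)" .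
  qed auto
  \<comment> \<open>The base is \<open>(3 / 4) ^ 20\<close>, far below \<open>1 / 2\<close>; 40
    points per unit of length are ample for this.\<close>
  also have "\<dots> = (9 * 3 ^ 18 / 2 ^ 40) ^ n"
    by (simp only: power_mult power_mult_distrib power_divide times_divide_eq_right)
  also have "\<dots> \<le> (1/2) ^ n" by (intro power_mono) auto
  finally have small: "prob (\<Union>st\<in>W. F st) \<le> (1/2) ^ n" .
  moreover have "length l < 40 * n"
    if x: "x \<in> space M - (\<Union>st\<in>W. F st)" "distinct l" "set l \<subseteq> \<omega> x" "plen (0 # l) \<le> real n" for x l
  proof -
    obtain st where st: "st \<in> W" "set l \<subseteq> king_region n st"
      using king_region_covers[OF x(4)] by (auto simp: W_def)
    have fin: "finite (\<omega> x \<inter> king_region n st)"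
      using pp x(1) king_region_sets(2) by (auto simp: poisson_pp_def)
    have "length l = card (set l)" using x(2) by (simp add: distinct_card)
    also have "\<dots> \<le> card (\<omega> x \<inter> king_region n st)"
      using x(3) st(2) fin by (intro card_mono) auto
    also have "\<dots> < 40 * n" using x(1) st(1) by (auto simp: F_def not_le)
    finally show ?thesis .
  qed
  moreover have "(\<Union>st\<in>W. F st) \<in> sets M" using W F by (intro sets.finite_UN) auto
  ultimately show ?thesis by (intro bexI[of _ "\<Union>st\<in>W. F st"]) blast+
qed

text \<open>A union bound over the lengths \<open>m\<close>, \<open>m + 1\<close> and so on, with a
  geometric series. Shorter lists are treated as having length \<open>m\<close>, whence the additive
  \<open>m\<close>; the \<open>+ 1\<close> comes from rounding the length up.\<close>

lemma path_points_linear_all: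
  assumes M: "prob_space M" and pp: "poisson_pp M \<omega>" and m: "1 \<le> m"
  shows "\<exists>E\<in>sets M. measure M E \<le> 2 * (1/2) ^ m \<and>
    (\<forall>x\<in>space M - E. \<forall>l. distinct l \<and> set l \<subseteq> \<omega> x \<longrightarrow> real (length l) \<le> 40 * (plen (0 # l) + m + 1))"
proof -
  interpret prob_space M by fact
  have "\<forall>k. \<exists>E. E \<in> sets M \<and> measure M E \<le> (1/2) ^ (m + k) \<and>
    (\<forall>x\<in>space M - E. \<forall>l. distinct l \<and> set l \<subseteq> \<omega> x \<and> plen (0 # l) \<le> real (m + k) \<longrightarrow> length l < 40 * (m + k))"
    (is "\<forall>k. ?P k")
  proof
    fix k
    show "?P k"
      using path_points_linear[OF M pp, of "m + k"] m by auto
  qed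
  then obtain E where E: "\<And>k. E k \<in> sets M" "\<And>k. measure M (E k) \<le> (1/2) ^ (m + k)"
    "\<And>k x l. x \<in> space M - E k \<Longrightarrow> distinct l \<Longrightarrow> set l \<subseteq> \<omega> x \<Longrightarrow> plen (0 # l) \<le> real (m + k) \<Longrightarrow> length l < 40 * (m + k)"
    unfolding choice_iff by blast
  have sum: "(\<lambda>k. (1/2::real) ^ (m + k)) sums (2 * (1/2) ^ m)"
    using sums_mult[OF geometric_sums[of "1/2::real"], of "(1/2) ^ m"] by (simp add: power_add mult.commute)
  have summ: "summable (\<lambda>k. measure M (E k))"
    using E(2) by (intro summable_comparison_test'[OF sums_summable[OF sum], of 0]) auto
  have "prob (\<Union>k. E k) \<le> (\<Sum>k. prob (E k))"
    using E(1) summ by (intro finite_measure_subadditive_countably) auto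
  also have "\<dots> \<le> (\<Sum>k. (1/2) ^ (m + k))"
    using E(2) summ sums_summable[OF sum] by (intro suminf_le) auto
  also have "\<dots> = 2 * (1/2) ^ m" using sum by (rule sums_unique[symmetric])
  finally have "prob (\<Union>k. E k) \<le> 2 * (1/2) ^ m" .
  moreover have "real (length l) \<le> 40 * (plen (0 # l) + m + 1)"
    if x: "x \<in> space M - (\<Union>k. E k)" and l: "distinct l" "set l \<subseteq> \<omega> x" for x l
  proof -
    define k where "k = nat \<lceil>plen (0 # l)\<rceil>"
    have k: "plen (0 # l) \<le> real k" "real k \<le> plen (0 # l) + 1"
      using of_nat_ceiling[of "plen (0 # l)"] plen_nonneg[of "0 # l"] unfolding k_def by linarith+
    show ?thesis
    proof (cases "m \<le> k")
      case True
      then have "length l < 40 * (m + (k - m))"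
        using x l k by (intro E(3)[of x "k - m"]) auto
      then have "real (length l) < 40 * real k" using True by simp
      also have "\<dots> \<le> 40 * (plen (0 # l) + m + 1)" using k by simp
      finally show ?thesis by simp
    next
      case False
      then have "length l < 40 * (m + 0)"
        using x l k by (intro E(3)[of x 0]) auto
      then have "real (length l) < 40 * real m" by simp
      also have "\<dots> \<le> 40 * (plen (0 # l) + m + 1)" using plen_nonneg[of "0 # l"] by simp
      finally show ?thesis by simp
    qed
  qed
  moreover have "(\<Union>k. E k) \<in> sets M" using E(1) by auto
  ultimately show ?thesis by (intro bexI[of _ "\<Union>k. E k"]) blast+
qed

section \<open>General position\<close>

definition cell_of :: "real \<Rightarrow> complex \<Rightarrow> int \<times> int" where
  "cell_of r z = (\<lfloor>Re z / r\<rfloor>, \<lfloor>Im z / r\<rfloor>)"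

text \<open>As fibres of \<open>cell_of\<close> these half-open squares partition the plane.\<close>

definition cell :: "real \<Rightarrow> int \<times> int \<Rightarrow> complex set" where
  "cell r g = {z. cell_of r z = g}"

definition corner :: "real \<Rightarrow> int \<times> int \<Rightarrow> complex" where
  "corner r g = Complex (r * of_int (fst g)) (r * of_int (snd g))"

lemma cell_iff:
  assumes "0 < r"
  shows "z \<in> cell r g \<longleftrightarrow> Re (corner r g) \<le> Re z \<and> Re z < Re (corner r g) + r \<and>
    Im (corner r g) \<le> Im z \<and> Im z < Im (corner r g) + r"
proof -
  have "\<lfloor>x / r\<rfloor> = a \<longleftrightarrow> r * of_int a \<le> x \<and> x < r * of_int a + r" for x :: real and a :: int
    using assms by (auto simp: floor_eq_iff field_simps)
  then show ?thesis by (cases g) (auto simp: cell_def cell_of_def corner_def)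
qed

lemma cell_corner: "0 < r \<Longrightarrow> z \<in> cell r g \<Longrightarrow> norm (z - corner r g) \<le> 2 * r"
  using cmod_le[of "z - corner r g"] by (simp add: cell_iff)

lemma cell_measure:
  assumes "0 < r"
  shows "cell r g \<in> sets borel" "bounded (cell r g)" "area (cell r g) = r\<^sup>2"
proof -
  let ?a = "corner r g" and ?b = "corner r g + Complex r r"
  have "cell r g = {z. Re ?a \<le> Re z} \<inter> {z. Re z < Re ?a + r} \<inter> {z. Im ?a \<le> Im z} \<inter> {z. Im z < Im ?a + r}"
    by (intro set_eqI) (simp add: cell_iff[OF assms, of _ g])
  also have "\<dots> \<in> sets borel"
    by (intro sets.Int borel_closed borel_open closed_Collect_le open_Collect_less continuous_intros)
  finally show S: "cell r g \<in> sets borel" .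
  have sub: "box ?a ?b \<subseteq> cell r g" "cell r g \<subseteq> cbox ?a ?b"
    by (intro subsetI; simp add: cell_iff[OF assms, of _ g] in_box_complex_iff in_cbox_complex_iff)+
  show "bounded (cell r g)" using sub(2) bounded_cbox bounded_subset by blast
  have "area (box ?a ?b) \<le> area (cell r g)"
    using sub(1) S bounded_subset[OF bounded_cbox sub(2)]
    by (intro measure_mono_fmeasurable) (auto intro!: fmeasurableI emeasure_bounded_finite)
  moreover have "area (cell r g) \<le> area (cbox ?a ?b)"
    using sub(2) S by (intro measure_mono_fmeasurable) (auto intro!: fmeasurableI emeasure_lborel_cbox_finite)
  ultimately show "area (cell r g) = r\<^sup>2"
    using assms by (simp add: measure_rect power2_eq_square)
qed

text \<open>Disjoint sets are occupied independently, and each with probability at most its expected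
  number of points.\<close>

lemma prob_all_occupied:
  assumes M: "prob_space M" and pp: "poisson_pp M \<omega>" and I: "finite I" "disjoint_family_on B (I :: nat set)"
    and B: "\<And>i. i \<in> I \<Longrightarrow> B i \<in> sets borel \<and> bounded (B i)"
  shows "{x\<in>space M. \<forall>i\<in>I. 1 \<le> card (\<omega> x \<inter> B i)} \<in> sets M"
    and "measure M {x\<in>space M. \<forall>i\<in>I. 1 \<le> card (\<omega> x \<inter> B i)} \<le> (\<Prod>i\<in>I. area (B i))"
proof -
  interpret prob_space M by fact
  have iv: "indep_vars (\<lambda>_. count_space (UNIV :: nat set)) (\<lambda>i x. card (\<omega> x \<inter> B i)) I"
    using pp I B by (auto simp: poisson_pp_def)
  have set: "{x\<in>space M. card (\<omega> x \<inter> B i) \<in> {1..}} \<in> sets M" if "i \<in> I" for i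
    by (rule poisson_pp_prob(1)[OF M pp]) (use B[OF that] in auto)
  then show "{x\<in>space M. \<forall>i\<in>I. 1 \<le> card (\<omega> x \<inter> B i)} \<in> sets M"
    using I by (cases "I = {}") (auto intro!: sets.sets_Collect_finite_All')
  have pr: "prob {x\<in>space M. card (\<omega> x \<inter> B i) \<in> {1..}} \<le> area (B i)" if "i \<in> I" for i
  proof -
    have "prob {x\<in>space M. card (\<omega> x \<inter> B i) \<in> {1..}} = measure_pmf.prob (pois_pmf (area (B i))) {1..}"
      by (rule poisson_pp_prob(2)[OF M pp]) (use B[OF that] in auto)
    then show ?thesis using poisson_ge_1[of "area (B i)"] by simp
  qed
  show "measure M {x\<in>space M. \<forall>i\<in>I. 1 \<le> card (\<omega> x \<inter> B i)} \<le> (\<Prod>i\<in>I. area (B i))"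
  proof (cases "I = {}")
    case False
    have "{x\<in>space M. \<forall>i\<in>I. 1 \<le> card (\<omega> x \<inter> B i)} = (\<Inter>i\<in>I. (\<lambda>x. card (\<omega> x \<inter> B i)) -` {1..} \<inter> space M)"
      using False by auto
    then have "prob {x\<in>space M. \<forall>i\<in>I. 1 \<le> card (\<omega> x \<inter> B i)} =
        (\<Prod>i\<in>I. prob ((\<lambda>x. card (\<omega> x \<inter> B i)) -` {1..} \<inter> space M))"
      using indep_varsD_finite[OF iv False I(1), of "\<lambda>i. {1..}"] by simp
    also have "\<dots> = (\<Prod>i\<in>I. prob {x\<in>space M. card (\<omega> x \<inter> B i) \<in> {1..}})"
      by (intro prod.cong refl arg_cong[where f = prob]) auto
    also have "\<dots> \<le> (\<Prod>i\<in>I. area (B i))"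
      using pr by (intro prod_mono) auto
    finally show ?thesis .
  qed (simp add: prob_space)
qed

lemma one_le_card: "finite A \<Longrightarrow> p \<in> A \<Longrightarrow> 1 \<le> card A"
  by (metis One_nat_def Suc_leI card_gt_0_iff empty_iff)

lemma two_le_card: "finite A \<Longrightarrow> p \<in> A \<Longrightarrow> q \<in> A \<Longrightarrow> p \<noteq> q \<Longrightarrow> 2 \<le> card A"
  using card_mono[of A "{p, q}"] by simp

text \<open>The ball leaves finitely many cells to sum over, and its integer radius leaves countably
  many events to exclude.\<close>

definition tuple_hits :: "nat \<Rightarrow> nat \<Rightarrow> (complex list \<Rightarrow> complex \<Rightarrow> bool) \<Rightarrow> complex set \<Rightarrow> bool" where
  "tuple_hits R m Rel P \<longleftrightarrow> (\<exists>qs p. length qs = m \<and> distinct (p # qs) \<and>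
     set (p # qs) \<subseteq> P \<inter> cball 0 (real R) \<and> Rel qs p)"

text \<open>A point lying in a set of vanishing area determined by \<open>m\<close> other points is almost surely absent:
  discretise the \<open>m\<close> points to cells of side \<open>r\<close>, whose total expected number stays bounded
  as \<open>r\<close> tends to \<open>0\<close>.\<close>

lemma rare_tuple:
  fixes R m :: nat
  assumes M: "prob_space M" and pp: "poisson_pp M \<omega>" and R: "1 \<le> R" and K: "0 \<le> K"
    and T: "\<And>r cs. 0 < r \<Longrightarrow> r \<le> 1 \<Longrightarrow> length cs = m \<Longrightarrow> set cs \<subseteq> cball 0 (2 * real R) \<Longrightarrow>
      T r cs \<in> sets borel \<and> bounded (T r cs) \<and> area (T r cs) \<le> K * r"
    and Rel: "\<And>r qs cs p. 0 < r \<Longrightarrow> r \<le> 1 \<Longrightarrow> length qs = m \<Longrightarrow> length cs = m \<Longrightarrow>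
      \<forall>i<m. norm (qs ! i - cs ! i) \<le> 2 * r \<Longrightarrow> set (p # qs) \<subseteq> cball 0 (real R) \<Longrightarrow> Rel qs p \<Longrightarrow> p \<in> T r cs"
  shows "AE x in M. \<not> tuple_hits R m Rel (\<omega> x)"
proof -
  interpret prob_space M by fact
  define C where "C = 9 * real R ^ 2 + (9 * real R ^ 2) ^ m * K"
  define bad where "bad x = tuple_hits R m Rel (\<omega> x)" for x
  have ex: "\<exists>E\<in>sets M. measure M E \<le> C / real N \<and> {x\<in>space M. bad x} \<subseteq> E" if N: "1 \<le> N" for N :: nat
  proof -
    define r where "r = 1 / real N"
    have r: "0 < r" "r \<le> 1" using N by (auto simp: r_def)
    define G where "G = {- int (R * N)..int (R * N)} \<times> {- int (R * N)..int (R * N)}"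
    define GS where "GS = {gs. set gs \<subseteq> G \<and> length gs = m \<and> distinct gs}"
    \<comment> \<open>Two points sharing a cell: the case in which the cells of the tuple cannot be
      kept distinct.\<close>
    define A where "A g = {x\<in>space M. card (\<omega> x \<inter> cell r g) \<in> {2..}}" for g
    \<comment> \<open>Index \<open>m\<close> is the target region for \<open>p\<close>. Removing the
      cells of the tuple makes the family disjoint, as independence requires; in the case of
      distinct cells \<open>p\<close> survives the removal.\<close>
    define F where "F gs i = (if i < m then cell r (gs ! i) else
        T r (map (corner r) gs) - (\<Union>g\<in>set gs. cell r g))" for gs :: "(int \<times> int) list" and i :: nat
    define D where "D gs = {x\<in>space M. \<forall>i\<in>{..m}. 1 \<le> card (\<omega> x \<inter> F gs i)}" for gs
    have finG: "finite G" by (simp add: G_def)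
    have cardG: "real (card G) * r\<^sup>2 \<le> 9 * real R ^ 2"
    proof -
      have "real (card G) = (2 * real (R * N) + 1)\<^sup>2"
        by (simp add: G_def power2_eq_square mult.commute)
      also have "\<dots> \<le> (3 * real (R * N))\<^sup>2"
      proof (intro power_mono)
        have "1 \<le> R * N" using R N by simp
        then have "1 \<le> real (R * N)" by linarith
        then show "2 * real (R * N) + 1 \<le> 3 * real (R * N)" by linarith
      qed simp
      finally have "real (card G) * r\<^sup>2 \<le> (3 * real (R * N))\<^sup>2 * r\<^sup>2" by (intro mult_right_mono) auto
      also have "\<dots> = 9 * real R ^ 2" using N by (simp add: r_def power2_eq_square)
      finally show ?thesis .
    qed
    have finGS: "finite GS" "card GS \<le> card G ^ m"
    proof -
      have sub: "GS \<subseteq> {gs. set gs \<subseteq> G \<and> length gs = m}" by (auto simp: GS_def)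
      show "finite GS" using finite_subset[OF sub finite_lists_length_eq[OF finG]] .
      show "card GS \<le> card G ^ m"
        using card_mono[OF finite_lists_length_eq[OF finG] sub] card_lists_length_eq[OF finG, of m] by simp
    qed
    have cornerG: "corner r g \<in> cball 0 (2 * real R)" if "g \<in> G" for g
    proof -
      have "\<bar>real_of_int a\<bar> * r \<le> real R" if "a \<in> {- int (R * N)..int (R * N)}" for a
      proof -
        have "\<bar>a\<bar> \<le> int (R * N)" using that by auto
        then have "\<bar>real_of_int a\<bar> \<le> real (R * N)" by linarith
        then have "\<bar>real_of_int a\<bar> * r \<le> real (R * N) * r" using r by (intro mult_right_mono) auto
        also have "\<dots> = real R" using N by (simp add: r_def)
        finally show ?thesis .
      qed
      then have "\<bar>Re (corner r g)\<bar> \<le> real R" "\<bar>Im (corner r g)\<bar> \<le> real R"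
        using that r by (auto simp: G_def corner_def abs_mult mult.commute)
      then show ?thesis using cmod_le[of "corner r g"] by simp
    qed
    have TT: "T r (map (corner r) gs) \<in> sets borel \<and> bounded (T r (map (corner r) gs)) \<and>
        area (T r (map (corner r) gs)) \<le> K * r" if "gs \<in> GS" for gs
      using that cornerG r by (intro T) (auto simp: GS_def)
    have Fset: "F gs i \<in> sets borel \<and> bounded (F gs i)" if "gs \<in> GS" for gs i
    proof -
      have "T r (map (corner r) gs) - (\<Union>g\<in>set gs. cell r g) \<in> sets borel"
        using TT[OF that] cell_measure(1)[OF r(1)] by (intro sets.Diff sets.finite_UN) auto
      moreover have "bounded (T r (map (corner r) gs) - (\<Union>g\<in>set gs. cell r g))"
        using TT[OF that] by (meson Diff_subset bounded_subset)
      ultimately show ?thesis using cell_measure(1,2)[OF r(1)] by (simp add: F_def)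
    qed
    have Fdis: "disjoint_family_on (F gs) {..m}" if "gs \<in> GS" for gs
    proof (unfold disjoint_family_on_def, intro ballI impI)
      fix i j assume ij: "i \<in> {..m}" "j \<in> {..m}" "i \<noteq> j"
      have dis: "cell r (gs ! i) \<inter> cell r (gs ! j) = {}" if "i < m" "j < m"
        using that \<open>gs \<in> GS\<close> ij(3) nth_eq_iff_index_eq[of gs i j] by (auto simp: cell_def GS_def)
      have mem: "gs ! i \<in> set gs" if "i < m" for i using \<open>gs \<in> GS\<close> that by (auto simp: GS_def)
      show "F gs i \<inter> F gs j = {}"
        using dis mem[of i] mem[of j] ij by (auto simp: F_def)
    qed
    have Dset: "D gs \<in> sets M" if "gs \<in> GS" for gs
      unfolding D_def using Fdis[OF that] Fset[OF that] by (intro prob_all_occupied[OF M pp]) auto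
    have Aset: "A g \<in> sets M" for g
      unfolding A_def by (rule poisson_pp_prob(1)[OF M pp]) (use cell_measure(1,2)[OF r(1)] in auto)
    have PA: "prob (A g) \<le> (r\<^sup>2)\<^sup>2" for g
    proof -
      have "prob (A g) = measure_pmf.prob (pois_pmf (area (cell r g))) {2..}"
        unfolding A_def by (rule poisson_pp_prob(2)[OF M pp]) (use cell_measure(1,2)[OF r(1)] in auto)
      then show ?thesis using poisson_ge_2[of "r\<^sup>2"] cell_measure(3)[OF r(1)] by simp
    qed
    have PD: "prob (D gs) \<le> (r\<^sup>2) ^ m * (K * r)" if "gs \<in> GS" for gs
    proof -
      have "prob (D gs) \<le> (\<Prod>i\<in>{..m}. area (F gs i))"
        unfolding D_def using Fdis[OF that] Fset[OF that] by (intro prob_all_occupied[OF M pp]) auto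
      also have "\<dots> = (\<Prod>i<m. area (F gs i)) * area (F gs m)"
        by (simp add: lessThan_Suc_atMost[symmetric])
      also have "(\<Prod>i<m. area (F gs i)) = (\<Prod>i<m. r\<^sup>2)"
        by (intro prod.cong) (auto simp: F_def cell_measure(3)[OF r(1)])
      also have "(\<Prod>i<m. r\<^sup>2) * area (F gs m) \<le> (\<Prod>i<m. r\<^sup>2) * (K * r)"
      proof (intro mult_left_mono)
        have "area (F gs m) \<le> area (T r (map (corner r) gs))"
          using TT[OF that] Fset[OF that, of m]
          by (intro measure_mono_fmeasurable) (auto simp: F_def intro!: fmeasurableI emeasure_bounded_finite)
        then show "area (F gs m) \<le> K * r" using TT[OF that] by linarith
      qed auto
      finally show ?thesis by simp
    qed
    define E where "E = (\<Union>g\<in>G. A g) \<union> (\<Union>gs\<in>GS. D gs)"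
    have Eset: "E \<in> sets M" unfolding E_def using finG finGS(1) Aset Dset by (intro sets.Un sets.finite_UN) auto
    have "prob E \<le> prob (\<Union>g\<in>G. A g) + prob (\<Union>gs\<in>GS. D gs)"
      unfolding E_def using finG finGS(1) Aset Dset by (intro measure_Un_le sets.finite_UN) auto
    also have "prob (\<Union>g\<in>G. A g) \<le> (\<Sum>g\<in>G. prob (A g))"
      using finG Aset by (intro finite_measure_subadditive_finite) auto
    also have "\<dots> \<le> real (card G) * (r\<^sup>2)\<^sup>2" using PA by (intro sum_bounded_above) auto
    also have "prob (\<Union>gs\<in>GS. D gs) \<le> (\<Sum>gs\<in>GS. prob (D gs))"
      using finGS Dset by (intro finite_measure_subadditive_finite) auto
    also have "\<dots> \<le> real (card GS) * ((r\<^sup>2) ^ m * (K * r))" using PD by (intro sum_bounded_above) auto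
    also have "\<dots> \<le> real (card G) ^ m * ((r\<^sup>2) ^ m * (K * r))"
    proof (intro mult_right_mono)
      show "real (card GS) \<le> real (card G) ^ m" using finGS(2) by (metis of_nat_le_iff of_nat_power)
    qed (use K r in auto)
    \<comment> \<open>About \<open>r^(-2 m)\<close> tuples of cells, each with probability at most
      \<open>r^(2 m) * K * r\<close>: the factor \<open>r\<close> remains.\<close>
    also have "\<dots> = (real (card G) * r\<^sup>2) ^ m * K * r" by (simp add: power_mult_distrib)
    also have "\<dots> \<le> (9 * real R ^ 2) ^ m * K * r"
      using cardG K r by (intro mult_right_mono power_mono) auto
    also have "real (card G) * (r\<^sup>2)\<^sup>2 \<le> 9 * real R ^ 2 * r"
    proof -
      have "real (card G) * (r\<^sup>2)\<^sup>2 = (real (card G) * r\<^sup>2) * r\<^sup>2" by (simp add: power2_eq_square)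
      also have "\<dots> \<le> (9 * real R ^ 2) * r\<^sup>2" using cardG by (intro mult_right_mono) auto
      also have "\<dots> \<le> (9 * real R ^ 2) * r"
        using r by (intro mult_left_mono) (auto simp: power2_eq_square mult_left_le)
      finally show ?thesis .
    qed
    finally have PE: "prob E \<le> C / real N" by (simp add: C_def r_def algebra_simps add_divide_distrib)
    have "x \<in> E" if x: "x \<in> space M" and "bad x" for x
    proof -
      obtain qs p where q: "length qs = m" "distinct (p # qs)" "set (p # qs) \<subseteq> \<omega> x \<inter> cball 0 (real R)" "Rel qs p"
        using \<open>bad x\<close> unfolding bad_def tuple_hits_def by blast
      have fin: "finite (\<omega> x \<inter> B)" if "bounded B" for B using pp x that by (auto simp: poisson_pp_def)
      have inG: "cell_of r z \<in> G" if "z \<in> cball 0 (real R)" for z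
      proof -
        have *: "\<lfloor>a / r\<rfloor> \<in> {- int (R * N)..int (R * N)}" if "\<bar>a\<bar> \<le> real R" for a
        proof -
          have "a / r = a * real N" by (simp add: r_def)
          moreover have "\<bar>a * real N\<bar> \<le> real R * real N"
            using that by (simp add: abs_mult mult_right_mono)
          ultimately have "- real_of_int (int (R * N)) \<le> a / r" "a / r \<le> real_of_int (int (R * N))"
            by (simp_all add: abs_le_iff)
          then show ?thesis by (auto simp: le_floor_iff floor_le_iff)
        qed
        have "\<bar>Re z\<bar> \<le> real R" "\<bar>Im z\<bar> \<le> real R"
          using that abs_Re_le_cmod[of z] abs_Im_le_cmod[of z] by auto
        then show ?thesis using * by (simp add: G_def cell_of_def)
      qed
      show ?thesis
      proof (cases "distinct (map (cell_of r) (p # qs))")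
        case False
        then have "\<not> inj_on (cell_of r) (set (p # qs))" using q(2) by (simp only: distinct_map) simp
        then obtain a b where ab: "a \<in> set (p # qs)" "b \<in> set (p # qs)" "a \<noteq> b" "cell_of r a = cell_of r b"
          unfolding inj_on_def by blast
        have "2 \<le> card (\<omega> x \<inter> cell r (cell_of r a))"
          using ab q(3) fin[OF cell_measure(2)[OF r(1)]] by (intro two_le_card[of _ a b]) (auto simp: cell_def)
        moreover have "cell_of r a \<in> G" using ab q(3) by (intro inG) blast
        ultimately show ?thesis using x by (auto simp: E_def A_def)
      next
        case True
        define gs where "gs = map (cell_of r) qs"
        have gs: "gs \<in> GS" using True q(1,3) inG by (auto simp: GS_def gs_def)
        have "p \<in> T r (map (corner r) gs)"
        proof (rule Rel[OF r q(1) _ _ _ q(4)])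
          show "\<forall>i<m. norm (qs ! i - map (corner r) gs ! i) \<le> 2 * r"
            using q(1) by (auto simp: gs_def cell_def intro!: cell_corner[OF r(1)])
        qed (use q in \<open>auto simp: gs_def\<close>)
        moreover have "p \<notin> (\<Union>g\<in>set gs. cell r g)" using True by (auto simp: cell_def gs_def)
        ultimately have pF: "p \<in> F gs m" by (simp add: F_def)
        have "1 \<le> card (\<omega> x \<inter> F gs i)" if "i \<le> m" for i
        proof (cases "i < m")
          case True
          then have "qs ! i \<in> \<omega> x \<inter> F gs i"
            using q(1,3) nth_mem[of i qs] by (auto simp: F_def gs_def cell_def)
          then show ?thesis using fin Fset[OF gs] by (intro one_le_card) auto
        next
          case False
          then have "i = m" using that by simp
          then show ?thesis using pF q(3) fin Fset[OF gs] by (intro one_le_card[of _ p]) auto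
        qed
        then have "x \<in> D gs" using x by (simp add: D_def)
        then show ?thesis using gs by (auto simp: E_def)
      qed
    qed
    then have "{x\<in>space M. bad x} \<subseteq> E" by blast
    then show ?thesis using Eset PE by blast
  qed
  then obtain E where E: "\<And>N. 1 \<le> N \<Longrightarrow> E N \<in> sets M \<and> prob (E N) \<le> C / real N \<and> {x\<in>space M. bad x} \<subseteq> E N"
    by metis
  \<comment> \<open>The covers for the mesh sizes \<open>1 / N\<close> intersect in a measurable
    null set that still contains the bad set.\<close>
  have int: "(\<Inter>N. E (Suc N)) \<in> sets M" using E by auto
  have "prob (\<Inter>N. E (Suc N)) \<le> C / real (Suc N)" for N
  proof -
    have "prob (\<Inter>N. E (Suc N)) \<le> prob (E (Suc N))" using E by (intro finite_measure_mono) auto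
    also have "\<dots> \<le> C / real (Suc N)" using E[of "Suc N"] by simp
    finally show ?thesis .
  qed
  moreover have "(\<lambda>N. C / real (Suc N)) \<longlonglongrightarrow> 0"
    using tendsto_mult_left[OF LIMSEQ_inverse_real_of_nat, of C] by (simp add: field_simps)
  ultimately have "prob (\<Inter>N. E (Suc N)) \<le> 0" by (intro LIMSEQ_le_const) auto
  then have "emeasure M (\<Inter>N. E (Suc N)) = 0" by (simp add: emeasure_eq_measure measure_le_0_iff)
  moreover have "{x\<in>space M. \<not> \<not> bad x} \<subseteq> (\<Inter>N. E (Suc N))" using E by fastforce
  ultimately have "AE x in M. \<not> bad x" using int by (intro AE_I[of _ _ "\<Inter>N. E (Suc N)"])
  then show ?thesis unfolding bad_def .
qed

text \<open>A thickened segment made of balls: about \<open>1 / r\<close> of them, each of area of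
  order \<open>r^2\<close>, have total area of order \<open>r\<close>.\<close>

definition tube :: "nat \<Rightarrow> real \<Rightarrow> complex \<Rightarrow> complex \<Rightarrow> complex set" where
  "tube n r a b = (\<Union>k\<le>n. cball (a + of_real (real k / real n) * (b - a)) (4 * r))"

lemma tube_measure:
  assumes "0 \<le> r"
  shows "tube n r a b \<in> sets borel" "bounded (tube n r a b)"
    "area (tube n r a b) \<le> (real n + 1) * (16 * pi * r\<^sup>2)"
proof -
  show "tube n r a b \<in> sets borel" "bounded (tube n r a b)"
    unfolding tube_def by (auto intro!: sets.finite_UN bounded_UN)
  have "area (tube n r a b) \<le>
      (\<Sum>k\<le>n. area (cball (a + of_real (real k / real n) * (b - a)) (4 * r)))"
    unfolding tube_def by (rule measure_UNION_le) (auto simp: emeasure_lborel_cball_finite less_top[symmetric])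
  also have "\<dots> = (\<Sum>k\<le>n. 16 * pi * r\<^sup>2)"
    using assms by (intro sum.cong) (simp_all add: content_cball power_mult_distrib unit_ball_vol_2)
  finally show "area (tube n r a b) \<le> (real n + 1) * (16 * pi * r\<^sup>2)" by (simp add: add.commute)
qed

text \<open>The displaced ends account for \<open>2 * r\<close> and the spacing of the centres for
  \<open>r\<close>, which fits into the radius \<open>4 * r\<close>.\<close>

lemma in_tube:
  assumes "0 < r" "1 \<le> n" "norm (b - a) \<le> r * real n" "norm (q - a) \<le> 2 * r" "norm (w - b) \<le> 2 * r"
    "p \<in> open_segment q w"
  shows "p \<in> tube n r a b"
proof -
  obtain s where s: "0 < s" "s < 1" "p = (1 - s) *\<^sub>R q + s *\<^sub>R w"
    using assms(6) by (auto simp: in_segment)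
  define k where "k = nat \<lfloor>s * real n\<rfloor>"
  have sn: "0 \<le> s * real n" "s * real n \<le> real n" using s by (auto simp: mult_left_le_one_le)
  have k: "real k \<le> s * real n" "s * real n \<le> real k + 1"
    using sn(1) by (auto simp: k_def)
  have kn: "k \<le> n" using k(1) sn(2) by linarith
  have "p - (a + of_real (real k / real n) * (b - a)) =
      ((1 - s) *\<^sub>R (q - a) + s *\<^sub>R (w - b)) + (s - real k / real n) *\<^sub>R (b - a)"
    using s(3) by (simp add: scaleR_conv_of_real algebra_simps)
  then have "norm (p - (a + of_real (real k / real n) * (b - a))) \<le>
      norm ((1 - s) *\<^sub>R (q - a) + s *\<^sub>R (w - b)) + norm ((s - real k / real n) *\<^sub>R (b - a))"
    using norm_triangle_ineq by metis
  also have "norm ((1 - s) *\<^sub>R (q - a) + s *\<^sub>R (w - b)) \<le> (1 - s) * norm (q - a) + s * norm (w - b)"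
    using norm_triangle_ineq[of "(1 - s) *\<^sub>R (q - a)" "s *\<^sub>R (w - b)"] s by simp
  also have "\<dots> \<le> (1 - s) * (2 * r) + s * (2 * r)"
    using s assms by (intro add_mono mult_left_mono) auto
  also have "(1 - s) * (2 * r) + s * (2 * r) = 2 * r" by (simp add: algebra_simps)
  also have "norm ((s - real k / real n) *\<^sub>R (b - a)) \<le> (1 / real n) * (r * real n)"
  proof -
    have "0 \<le> s - real k / real n" "s - real k / real n \<le> 1 / real n"
    proof -
      have "s - real k / real n = (s * real n - real k) / real n" using assms(2) by (simp add: diff_divide_distrib)
      then show "0 \<le> s - real k / real n" "s - real k / real n \<le> 1 / real n"
        using k by (auto intro!: divide_right_mono)
    qed
    then show ?thesis using assms(3) by (simp only: norm_scaleR) (intro mult_mono, auto)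
  qed
  also have "(1 / real n) * (r * real n) = r" using assms(2) by simp
  finally have "norm (p - (a + of_real (real k / real n) * (b - a))) \<le> 4 * r" using assms(1) by simp
  then have "p \<in> cball (a + of_real (real k / real n) * (b - a)) (4 * r)"
    by (simp add: dist_norm norm_minus_commute)
  then show ?thesis using kn unfolding tube_def by blast
qed

definition tube_steps :: "nat \<Rightarrow> real \<Rightarrow> nat" where
  "tube_steps R r = nat \<lceil>4 * real R / r\<rceil>"

text \<open>Each clause of \<open>generic\<close> confines a point to a line or segment determined
  by \<open>m = 0\<close>, \<open>1\<close>, \<open>1\<close> or \<open>2\<close> other points;
  thickened to width of order \<open>r\<close>, these have area of order \<open>r\<close> within a
  bounded region.\<close>

lemma AE_generic:
  assumes M: "prob_space M" and pp: "poisson_pp M \<omega>"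
  shows "AE x in M. generic (\<omega> x)"
proof -
  have n: "1 \<le> tube_steps R r" "4 * real R \<le> r * real (tube_steps R r)"
    "real (tube_steps R r) + 1 \<le> (4 * real R + 2) / r"
    if "1 \<le> R" "0 < r" "r \<le> 1" for R :: nat and r :: real
  proof -
    have pos: "0 < 4 * real R / r" using that by simp
    then show "1 \<le> tube_steps R r" unfolding tube_steps_def by linarith
    have "4 * real R / r \<le> real (tube_steps R r)" unfolding tube_steps_def by linarith
    then show "4 * real R \<le> r * real (tube_steps R r)"
      using that(2) by (simp only: pos_divide_le_eq mult.commute[of r])
    have "real (tube_steps R r) + 1 \<le> 4 * real R / r + 2" using pos unfolding tube_steps_def by linarith
    also have "\<dots> \<le> 4 * real R / r + 2 / r" using that by (simp add: field_simps)
    finally show "real (tube_steps R r) + 1 \<le> (4 * real R + 2) / r" by (simp add: add_divide_distrib)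
  qed
  have tub: "tube (tube_steps R r) r a b \<in> sets borel \<and> bounded (tube (tube_steps R r) r a b) \<and>
      area (tube (tube_steps R r) r a b) \<le> ((4 * real R + 2) * (16 * pi)) * r"
    if "1 \<le> R" "0 < r" "r \<le> 1" for R :: nat and r :: real and a b
  proof -
    have "area (tube (tube_steps R r) r a b) \<le> (real (tube_steps R r) + 1) * (16 * pi * r\<^sup>2)"
      using that by (intro tube_measure) auto
    also have "\<dots> \<le> (4 * real R + 2) / r * (16 * pi * r\<^sup>2)"
      using n(3)[OF that] by (intro mult_right_mono) auto
    also have "\<dots> = ((4 * real R + 2) * (16 * pi)) * r" using that by (simp add: power2_eq_square)
    finally show ?thesis using tube_measure(1,2) that by auto
  qed
  have 0: "AE x in M. \<not> tuple_hits R 0 (\<lambda>qs p. Im p = 0) (\<omega> x)"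
    if R: "1 \<le> R" for R :: nat
  proof (rule rare_tuple[OF M pp R, where K = "4 * real R" and
        T = "\<lambda>r cs. cbox (Complex (- real R) (- r)) (Complex (real R) r)"])
    fix r :: real and qs cs :: "complex list" and p
    assume "0 < r" "set (p # qs) \<subseteq> cball 0 (real R)" "Im p = 0"
    then show "p \<in> cbox (Complex (- real R) (- r)) (Complex (real R) r)"
      using abs_Re_le_cmod[of p] by (auto simp: in_cbox_complex_iff)
  qed (auto simp: measure_rect)
  have 1: "AE x in M. \<not> tuple_hits R 1 (\<lambda>qs p. Im p = Im (qs ! 0)) (\<omega> x)"
    if R: "1 \<le> R" for R :: nat
  proof (rule rare_tuple[OF M pp R, where K = "8 * real R" and
        T = "\<lambda>r cs. cbox (Complex (- real R) (Im (cs ! 0) - 2 * r)) (Complex (real R) (Im (cs ! 0) + 2 * r))"])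
    fix r :: real and qs cs :: "complex list" and p
    assume *: "0 < r" "set (p # qs) \<subseteq> cball 0 (real R)" "Im p = Im (qs ! 0)"
      "\<forall>i<1. norm (qs ! i - cs ! i) \<le> 2 * r"
    then have "\<bar>Im (qs ! 0) - Im (cs ! 0)\<bar> \<le> 2 * r"
      using abs_Im_le_cmod[of "qs ! 0 - cs ! 0"] by auto
    then show "p \<in> cbox (Complex (- real R) (Im (cs ! 0) - 2 * r)) (Complex (real R) (Im (cs ! 0) + 2 * r))"
      using abs_Re_le_cmod[of p] * by (auto simp: in_cbox_complex_iff)
  qed (auto simp: measure_rect)
  have 2: "AE x in M. \<not> tuple_hits R 1 (\<lambda>qs p. p \<in> open_segment 0 (qs ! 0)) (\<omega> x)"
    if R: "1 \<le> R" for R :: nat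
  proof (rule rare_tuple[OF M pp R, where K = "(4 * real R + 2) * (16 * pi)" and
        T = "\<lambda>r cs. tube (tube_steps R r) r 0 (cs ! 0)"])
    fix r :: real and qs cs :: "complex list" and p
    assume *: "0 < r" "r \<le> 1" "set (p # qs) \<subseteq> cball 0 (real R)" "p \<in> open_segment 0 (qs ! 0)"
      "\<forall>i<1. norm (qs ! i - cs ! i) \<le> 2 * r" "length cs = 1" "length qs = 1"
    have "qs ! 0 \<in> set qs" using *(7) by simp
    then have "qs ! 0 \<in> cball 0 (real R)" using *(3) by auto
    then have "norm (cs ! 0) \<le> 2 * r + real R"
      using *(5) norm_triangle_ineq4[of "qs ! 0" "qs ! 0 - cs ! 0"] by auto
    also have "\<dots> \<le> 4 * real R" using *(2) R by simp
    finally have "norm (cs ! 0 - 0) \<le> r * real (tube_steps R r)"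
      using n(2)[OF R *(1,2)] by simp
    then show "p \<in> tube (tube_steps R r) r 0 (cs ! 0)"
      using * n(1)[OF R *(1,2)] by (intro in_tube[of r _ _ _ 0 "qs ! 0"]) auto
  qed (use tub[OF R] in auto)
  have 3: "AE x in M. \<not> tuple_hits R 2 (\<lambda>qs p. p \<in> open_segment (qs ! 0) (qs ! 1)) (\<omega> x)"
    if R: "1 \<le> R" for R :: nat
  proof (rule rare_tuple[OF M pp R, where K = "(4 * real (2 * R) + 2) * (16 * pi)" and
        T = "\<lambda>r cs. tube (tube_steps (2 * R) r) r (cs ! 0) (cs ! 1)"])
    fix r :: real and qs cs :: "complex list" and p
    assume *: "0 < r" "r \<le> 1" "set (p # qs) \<subseteq> cball 0 (real R)" "p \<in> open_segment (qs ! 0) (qs ! 1)"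
      "\<forall>i<2. norm (qs ! i - cs ! i) \<le> 2 * r" "length cs = 2" "length qs = 2"
    \<comment> \<open>Two displaced points may be up to \<open>2 * R + 4 * r\<close> apart, which
      can exceed \<open>4 * R\<close>; hence the doubled radius.\<close>
    have R2: "1 \<le> 2 * R" using R by simp
    have "qs ! 0 \<in> set qs" "qs ! 1 \<in> set qs" using *(7) by auto
    then have "norm (qs ! 0) \<le> real R" "norm (qs ! 1) \<le> real R" using *(3) by auto
    moreover have "norm (qs ! 0 - cs ! 0) \<le> 2 * r" "norm (qs ! 1 - cs ! 1) \<le> 2 * r" using *(5) by auto
    moreover have "norm (cs ! 1 - cs ! 0) \<le> norm (qs ! 0) + norm (qs ! 1) + norm (qs ! 0 - cs ! 0) + norm (qs ! 1 - cs ! 1)"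
    proof -
      have "cs ! 1 - cs ! 0 = (qs ! 1 - qs ! 0) + ((qs ! 0 - cs ! 0) - (qs ! 1 - cs ! 1))" by simp
      then show ?thesis
        using norm_triangle_ineq[of "qs ! 1 - qs ! 0" "(qs ! 0 - cs ! 0) - (qs ! 1 - cs ! 1)"]
          norm_triangle_ineq4[of "qs ! 0 - cs ! 0" "qs ! 1 - cs ! 1"] norm_triangle_ineq4[of "qs ! 1" "qs ! 0"] by simp
    qed
    ultimately have "norm (cs ! 1 - cs ! 0) \<le> 4 * real (2 * R)" using *(2) R by simp
    then have "norm (cs ! 1 - cs ! 0) \<le> r * real (tube_steps (2 * R) r)"
      using n(2)[OF R2 *(1,2)] by simp
    then show "p \<in> tube (tube_steps (2 * R) r) r (cs ! 0) (cs ! 1)"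
      using * n(1)[OF R2 *(1,2)] by (intro in_tube[of r _ _ _ "qs ! 0" "qs ! 1"]) auto
  qed (use tub[of "2 * R"] R in auto)
  have "AE x in M. \<forall>R. 1 \<le> R \<longrightarrow>
     \<not> tuple_hits R 0 (\<lambda>qs p. Im p = 0) (\<omega> x) \<and>
     \<not> tuple_hits R 1 (\<lambda>qs p. Im p = Im (qs ! 0)) (\<omega> x) \<and>
     \<not> tuple_hits R 1 (\<lambda>qs p. p \<in> open_segment 0 (qs ! 0)) (\<omega> x) \<and>
     \<not> tuple_hits R 2 (\<lambda>qs p. p \<in> open_segment (qs ! 0) (qs ! 1)) (\<omega> x)"
    unfolding AE_all_countable using 0 1 2 3 by auto
  then show ?thesis
  proof eventually_elim
    case (elim x)
    have big: "\<exists>R::nat. 1 \<le> R \<and> set l \<subseteq> cball 0 (real R)" for l :: "complex list"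
    proof -
      have "finite (set l)" by simp
      then have "bounded (set l)" by (rule finite_imp_bounded)
      then obtain b where b: "\<forall>z\<in>set l. norm z \<le> b" by (auto simp: bounded_iff)
      obtain R :: nat where "b \<le> real R" using real_arch_simple by blast
      then have "b \<le> real (Suc R)" by simp
      then show ?thesis using b by (intro exI[of _ "Suc R"]) force
    qed
    show "generic (\<omega> x)"
      unfolding generic_def
    proof (intro conjI ballI impI notI)
      fix p assume p: "p \<in> \<omega> x" "Im p = 0"
      obtain R where R: "1 \<le> R" "set [p] \<subseteq> cball 0 (real R)" using big by blast
      have "tuple_hits R 0 (\<lambda>qs p. Im p = 0) (\<omega> x)"
        unfolding tuple_hits_def using p R(2) by (intro exI[of _ "[]"] exI[of _ p]) auto
      then show False using elim R(1) by blast
    next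
      fix p q assume p: "p \<in> \<omega> x" "q \<in> \<omega> x" "p \<noteq> q" "Im p = Im q"
      obtain R where R: "1 \<le> R" "set [p, q] \<subseteq> cball 0 (real R)" using big by blast
      have "tuple_hits R 1 (\<lambda>qs p. Im p = Im (qs ! 0)) (\<omega> x)"
        unfolding tuple_hits_def using p R(2) by (intro exI[of _ "[q]"] exI[of _ p]) auto
      then show False using elim R(1) by blast
    next
      fix p q assume p: "p \<in> \<omega> x" "q \<in> \<omega> x" "p \<in> open_segment 0 q"
      obtain R where R: "1 \<le> R" "set [p, q] \<subseteq> cball 0 (real R)" using big by blast
      have "p \<noteq> q" using p(3) by (auto simp: open_segment_def)
      then have "tuple_hits R 1 (\<lambda>qs p. p \<in> open_segment 0 (qs ! 0)) (\<omega> x)"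
        unfolding tuple_hits_def using p R(2) by (intro exI[of _ "[q]"] exI[of _ p]) auto
      then show False using elim R(1) by blast
    next
      fix p q w assume p: "p \<in> \<omega> x" "q \<in> \<omega> x" "w \<in> \<omega> x" "p \<in> open_segment q w"
      obtain R where R: "1 \<le> R" "set [p, q, w] \<subseteq> cball 0 (real R)" using big by blast
      have "p \<noteq> q" "p \<noteq> w" "q \<noteq> w" using p(4) by (auto simp: open_segment_def)
      then have "tuple_hits R 2 (\<lambda>qs p. p \<in> open_segment (qs ! 0) (qs ! 1)) (\<omega> x)"
        unfolding tuple_hits_def using p R(2) by (intro exI[of _ "[q, w]"] exI[of _ p]) auto
      then show False using elim R(1) by blast
    qed
  qed
qed

section \<open>Optimal lists and their stability\<close>

text \<open>\<open>2 * \<rho>\<close> for every vertex, the origin included, and another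
  \<open>\<rho>\<close> for the final horizontal edge.\<close>

lemma pin_len_perturb:
  assumes "length xs = length ys" "\<forall>i<length xs. norm (xs ! i - ys ! i) \<le> \<rho>" "0 \<le> \<rho>"
  shows "pin_len t ys \<le> pin_len t xs + 3 * \<rho> * (length xs + 1)"
proof -
  have "plen (0 # ys) \<le> plen (0 # xs) + 2 * \<rho> * length (0 # xs)"
    using assms by (intro plen_perturb) (auto simp: nth_Cons' split: nat.splits)
  moreover have "norm (last (0 # xs) - last (0 # ys)) \<le> \<rho>"
    using assms by (cases "xs = []") (auto simp: last_conv_nth)
  then have "\<bar>Re (last (0 # xs)) - Re (last (0 # ys))\<bar> \<le> \<rho>"
    using abs_Re_le_cmod[of "last (0 # xs) - last (0 # ys)"] by simp
  then have "\<bar>t - Re (last (0 # ys))\<bar> \<le> \<bar>t - Re (last (0 # xs))\<bar> + \<rho>" by linarith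
  moreover have "\<rho> \<le> \<rho> * (length xs + 1)" using assms(3) by (simp add: mult_le_cancel_left1)
  ultimately show ?thesis unfolding pin_len_def by (simp add: algebra_simps)
qed

text \<open>The squared length \<open>L^2\<close> grows by at most \<open>d * (2 * L + d)\<close>,
  and \<open>L \<le> 4 * t\<close> and \<open>d \<le> t\<close> bound this by
  \<open>9 * t * d\<close>.\<close>

lemma score_change:
  assumes "0 < s" "pin_len t ys \<le> pin_len t xs + d" "pin_len t xs \<le> 4 * t" "0 \<le> d" "d \<le> t"
  shows "score t s xs + (real (length ys) - real (length xs)) - 9 * t * d / (2 * s) \<le> score t s ys"
proof -
  have nn: "0 \<le> pin_len t ys" using pin_len_ge[of t ys] by simp
  have "(pin_len t ys)\<^sup>2 \<le> (pin_len t xs + d)\<^sup>2" using assms nn by (intro power_mono) auto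
  also have "\<dots> = (pin_len t xs)\<^sup>2 + d * (2 * pin_len t xs + d)" by (simp add: power2_eq_square algebra_simps)
  also have "\<dots> \<le> (pin_len t xs)\<^sup>2 + d * (9 * t)" using assms by (intro add_left_mono mult_left_mono) auto
  finally have "(pin_len t ys)\<^sup>2 / (2 * s) \<le> ((pin_len t xs)\<^sup>2 + d * (9 * t)) / (2 * s)"
    using assms(1) by (intro divide_right_mono) auto
  then show ?thesis by (simp add: score_def add_divide_distrib mult_ac)
qed

text \<open>The robust form of \<open>strip_max\<close>: doubled width, relaxed length, optimality
  up to 1. Only competitors bounded in length and in number of points are stable under moving
  points; \<open>4 * t\<close> and \<open>2 * k\<close> leave room for inserting points and
  rotating.\<close>

definition near_max :: "real \<Rightarrow> real \<Rightarrow> real \<Rightarrow> nat \<Rightarrow> complex set \<Rightarrow> bool" where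
  "near_max t s w k P \<longleftrightarrow> (\<exists>l. distinct l \<and> set l \<subseteq> P \<and> (\<forall>p\<in>set l. \<bar>Im p\<bar> \<le> 2 * w) \<and>
     pin_len t l \<le> 3 * t \<and> length l \<le> k \<and>
     (\<forall>l2. distinct l2 \<and> set l2 \<subseteq> P \<and> pin_len t l2 \<le> 4 * t \<and> length l2 \<le> 2 * k \<longrightarrow>
        score t s l2 \<le> score t s l + 1))"

definition strip_max :: "real \<Rightarrow> real \<Rightarrow> real \<Rightarrow> nat \<Rightarrow> complex set \<Rightarrow> bool" where
  "strip_max t s w k P \<longleftrightarrow> (\<exists>l. distinct l \<and> set l \<subseteq> P \<and> (\<forall>p\<in>set l. \<bar>Im p\<bar> \<le> w) \<and>
     pin_len t l \<le> 2 * t \<and> length l \<le> k \<and>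
     (\<forall>l2. distinct l2 \<and> set l2 \<subseteq> P \<longrightarrow> score t s l2 \<le> score t s l))"

lemma cell_bijection:
  assumes "disjoint_family_on B I"
    and "\<And>i. i \<in> I \<Longrightarrow> finite (P \<inter> B i) \<and> finite (Q \<inter> B i) \<and> card (P \<inter> B i) = card (Q \<inter> B i)"
  shows "\<exists>\<beta>. bij_betw \<beta> (P \<inter> (\<Union>i\<in>I. B i)) (Q \<inter> (\<Union>i\<in>I. B i)) \<and> (\<forall>i\<in>I. \<forall>p\<in>P \<inter> B i. \<beta> p \<in> B i)"
proof -
  have "\<forall>i\<in>I. \<exists>f. bij_betw f (P \<inter> B i) (Q \<inter> B i)"
    using assms(2) by (auto intro: finite_same_card_bij)
  then obtain f where f: "\<And>i. i \<in> I \<Longrightarrow> bij_betw (f i) (P \<inter> B i) (Q \<inter> B i)" by metis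
  define idx where "idx p = (THE i. i \<in> I \<and> p \<in> B i)" for p
  have idx: "idx p = i" if "i \<in> I" "p \<in> B i" for i p
    unfolding idx_def using that assms(1) by (intro the_equality) (auto simp: disjoint_family_on_def)
  define \<beta> where "\<beta> p = f (idx p) p" for p
  have b: "bij_betw \<beta> (P \<inter> B i) (Q \<inter> B i)" if "i \<in> I" for i
    using f[OF that] by (rule bij_betw_cong[THEN iffD1, rotated]) (use idx that in \<open>auto simp: \<beta>_def\<close>)
  have "bij_betw \<beta> (\<Union>i\<in>I. P \<inter> B i) (\<Union>i\<in>I. Q \<inter> B i)"
    using b assms(1) by (intro bij_betw_UNION_disjoint) (fastforce simp: disjoint_family_on_def)+
  moreover have "\<beta> p \<in> B i" if "i \<in> I" "p \<in> P \<inter> B i" for i p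
    using b[OF that(1)] that(2) by (auto simp: bij_betw_def)
  ultimately show ?thesis unfolding Int_UN_distrib by blast
qed

text \<open>Equal counts give a bijection moving every point within its cell. The optimal list is
  carried from \<open>P\<close> to \<open>Q\<close> and the competitors back, each at a loss of at
  most \<open>1 / 2\<close>, which explains the \<open>+ 1\<close> in \<open>near_max\<close>. The
  covered ball contains all lists involved.\<close>

lemma strip_max_stable:
  assumes P: "locfin P" "locfin Q" and B: "disjoint_family_on B I" "\<And>i. i \<in> I \<Longrightarrow> bounded (B i)"
    and diam: "\<And>i p q. i \<in> I \<Longrightarrow> p \<in> B i \<Longrightarrow> q \<in> B i \<Longrightarrow> norm (p - q) \<le> \<rho>"
    and cover: "cball 0 (4 * t) \<subseteq> (\<Union>i\<in>I. B i)"
    and cards: "\<And>i. i \<in> I \<Longrightarrow> card (P \<inter> B i) = card (Q \<inter> B i)"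
    and par: "0 \<le> \<rho>" "\<rho> \<le> w" "0 < t" "0 < s" "3 * \<rho> * (2 * real k + 1) \<le> t" "9 * t * (3 * \<rho> * (2 * real k + 1)) \<le> s"
    and sm: "strip_max t s w k P"
  shows "near_max t s w k Q"
proof -
  define H where "H = (\<Union>i\<in>I. B i)"
  define d where "d = 3 * \<rho> * (2 * real k + 1)"
  have d: "0 \<le> d" "d \<le> t" "9 * t * d / (2 * s) \<le> 1 / 2"
    using par by (auto simp: d_def field_simps)
  have "finite (P \<inter> B i) \<and> finite (Q \<inter> B i) \<and> card (P \<inter> B i) = card (Q \<inter> B i)" if "i \<in> I" for i
    using P B(2)[OF that] cards[OF that] by (auto simp: locfin_def)
  from cell_bijection[OF B(1) this] obtain \<beta> where bij: "bij_betw \<beta> (P \<inter> H) (Q \<inter> H)"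
    and loc: "\<And>i p. i \<in> I \<Longrightarrow> p \<in> P \<inter> B i \<Longrightarrow> \<beta> p \<in> B i"
    unfolding H_def by blast
  have near: "norm (p - \<beta> p) \<le> \<rho>" if "p \<in> P \<inter> H" for p
    using that loc diam unfolding H_def by blast
  have move: "pin_len t (map f l) \<le> pin_len t l + d"
    if "\<And>p. p \<in> set l \<Longrightarrow> norm (p - f p) \<le> \<rho>" "length l \<le> 2 * k" for f and l
  proof -
    have "pin_len t (map f l) \<le> pin_len t l + 3 * \<rho> * (length l + 1)"
      using that par by (intro pin_len_perturb) auto
    also have "3 * \<rho> * (length l + 1) \<le> d"
      unfolding d_def using that(2) par by (intro mult_left_mono) auto
    finally show ?thesis by simp
  qed
  obtain l where l: "distinct l" "set l \<subseteq> P" "\<forall>p\<in>set l. \<bar>Im p\<bar> \<le> w" "pin_len t l \<le> 2 * t" "length l \<le> k"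
    and max: "\<And>l2. distinct l2 \<Longrightarrow> set l2 \<subseteq> P \<Longrightarrow> score t s l2 \<le> score t s l"
    using sm unfolding strip_max_def by blast
  have lH: "set l \<subseteq> P \<inter> H"
  proof
    fix p assume p: "p \<in> set l"
    then have "p \<in> cball 0 (4 * t)" using norm_le_pin_len[OF p, of t] l(4) par by simp
    then show "p \<in> P \<inter> H" using cover p l(2) by (auto simp: H_def)
  qed
  have near_l: "norm (p - \<beta> p) \<le> \<rho>" if "p \<in> set l" for p using near lH that by blast
  show ?thesis
    unfolding near_max_def
  proof (intro exI[of _ "map \<beta> l"] conjI allI impI)
    show "distinct (map \<beta> l)"
      using l(1) bij lH by (auto simp: distinct_map bij_betw_def intro: inj_on_subset)
    show "set (map \<beta> l) \<subseteq> Q" using bij lH by (auto simp: bij_betw_def)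
    show "\<forall>p\<in>set (map \<beta> l). \<bar>Im p\<bar> \<le> 2 * w"
    proof
      fix p assume "p \<in> set (map \<beta> l)"
      then obtain q where q: "q \<in> set l" "p = \<beta> q" by auto
      then have "\<bar>Im q - Im p\<bar> \<le> \<rho>" using near_l[OF q(1)] abs_Im_le_cmod[of "q - p"] by simp
      then show "\<bar>Im p\<bar> \<le> 2 * w" using l(3) q(1) par by fastforce
    qed
    show "pin_len t (map \<beta> l) \<le> 3 * t" using move[of l \<beta>] near_l l(4,5) d by fastforce
    show "length (map \<beta> l) \<le> k" using l(5) by simp
    fix l2 assume l2: "distinct l2 \<and> set l2 \<subseteq> Q \<and> pin_len t l2 \<le> 4 * t \<and> length l2 \<le> 2 * k"
    have l2H: "set l2 \<subseteq> Q \<inter> H"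
    proof
      fix p assume p: "p \<in> set l2"
      then have "p \<in> cball 0 (4 * t)" using norm_le_pin_len[OF p, of t] l2 by simp
      then show "p \<in> Q \<inter> H" using cover p l2 by (auto simp: H_def)
    qed
    define \<alpha> where "\<alpha> = inv_into (P \<inter> H) \<beta>"
    have \<alpha>: "\<alpha> q \<in> P \<inter> H" "\<beta> (\<alpha> q) = q" if "q \<in> Q \<inter> H" for q
    proof -
      have "q \<in> \<beta> ` (P \<inter> H)" using bij that by (simp add: bij_betw_def)
      then show "\<alpha> q \<in> P \<inter> H" "\<beta> (\<alpha> q) = q"
        unfolding \<alpha>_def by (rule inv_into_into, rule f_inv_into_f)
    qed
    have near_l2: "norm (q - \<alpha> q) \<le> \<rho>" if "q \<in> set l2" for q
      using near[of "\<alpha> q"] \<alpha>[of q] l2H that by (metis norm_minus_commute subsetD)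
    have "distinct (map \<alpha> l2)"
      using l2 l2H \<alpha>(2) by (auto simp: distinct_map intro!: inj_onI) (metis Int_iff subsetD)
    moreover have "set (map \<alpha> l2) \<subseteq> P" using \<alpha>(1) l2H by auto
    ultimately have "score t s (map \<alpha> l2) \<le> score t s l" by (rule max)
    moreover have "pin_len t (map \<alpha> l2) \<le> pin_len t l2 + d" using move[of l2 \<alpha>] near_l2 l2 by blast
    then have "score t s l2 - 9 * t * d / (2 * s) \<le> score t s (map \<alpha> l2)"
      using score_change[of s t "map \<alpha> l2" l2 d] par l2 d by simp
    then have "score t s l2 - 1 / 2 \<le> score t s (map \<alpha> l2)" using d(3) by linarith
    moreover have "pin_len t (map \<beta> l) \<le> pin_len t l + d" using move[of l \<beta>] near_l l(5) by force
    then have "score t s l - 9 * t * d / (2 * s) \<le> score t s (map \<beta> l)"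
      using score_change[of s t "map \<beta> l" l d] par l d by simp
    then have "score t s l - 1 / 2 \<le> score t s (map \<beta> l)" using d(3) by linarith
    ultimately show "score t s l2 \<le> score t s (map \<beta> l) + 1" by simp
  qed
qed

lemma finite_distinct_lists: "finite A \<Longrightarrow> finite {l. distinct l \<and> set l \<subseteq> A}"
  using finite_subset[OF _ finite_lists_length_le[of A "card A"]]
  by (auto simp: card_mono distinct_card[symmetric] subset_iff)

text \<open>A list longer than \<open>2 * t\<close> is no better than the empty one, so the maximum
  is over finitely many lists and attained. Some minimiser passes through the points of a maximal
  list, and these must then lie in the strip.\<close>

lemma minimizer_strip_max:
  assumes P: "locfin P" "generic P"
    and lin: "\<And>l. distinct l \<Longrightarrow> set l \<subseteq> P \<Longrightarrow> real (length l) \<le> 40 * (plen (0 # l) + 2 * t)"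
    and c: "0 < c" "c \<le> 1 / 200" and t: "0 < t" and k: "160 * t \<le> real k"
    and min: "minimizer_in P (line_at t) (c * t) (cyl 1 w)"
  shows "strip_max t (c * t) w k P"
proof -
  define s where "s = c * t"
  have s: "0 < s" using c t by (simp add: s_def)
  have empty: "pin_len t [] = t" using t by (simp add: pin_len_def)
  have long: "score t s l \<le> score t s []" if l: "distinct l" "set l \<subseteq> P" "2 * t < pin_len t l" for l
  proof -
    define L where "L = pin_len t l"
    have "real (length l) \<le> 40 * (plen (0 # l) + 2 * t)" using lin l by blast
    also have "\<dots> \<le> 80 * L"
    proof -
      have "plen (0 # l) \<le> L" by (simp add: L_def pin_len_def)
      then show ?thesis using l(3) by (simp add: L_def[symmetric])
    qed
    also have "\<dots> \<le> (L\<^sup>2 - t\<^sup>2) / (2 * s)"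
    proof -
      \<comment> \<open>The bound on \<open>c\<close> enters here, as
        \<open>160 * c \<le> 1\<close>.\<close>
      have "80 * L * (2 * s) = (160 * c) * (t * L)" by (simp add: s_def)
      also have "\<dots> \<le> 1 * (t * L)" using c t l(3) by (intro mult_right_mono) (auto simp: L_def)
      also have "\<dots> \<le> L * L - t * t"
      proof -
        have "t * (2 * t) \<le> t * L" "(2 * t) * L \<le> L * L"
          using t l(3) by (auto simp: L_def intro!: mult_left_mono mult_right_mono)
        then have "2 * (t * t) \<le> t * L" "2 * (t * L) \<le> L * L" by (simp_all add: mult_ac)
        moreover have "0 \<le> t * t" using t by simp
        ultimately show ?thesis by linarith
      qed
      finally show ?thesis using s by (simp add: pos_le_divide_eq power2_eq_square)
    qed
    finally show ?thesis by (simp add: score_def empty L_def diff_divide_distrib)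
  qed
  define S where "S = {l. distinct l \<and> set l \<subseteq> P \<and> pin_len t l \<le> 2 * t}"
  have "S \<subseteq> {l. distinct l \<and> set l \<subseteq> P \<inter> cball 0 (2 * t)}"
    using norm_le_pin_len[of _ _ t] by (fastforce simp: S_def)
  moreover have "finite (P \<inter> cball 0 (2 * t))" using P(1) by (simp add: locfin_def)
  ultimately have finS: "finite S" by (rule finite_subset[OF _ finite_distinct_lists])
  have neS: "[] \<in> S" using empty t by (simp add: S_def)
  have "Max (score t s ` S) \<in> score t s ` S" using finS neS by (intro Max_in) auto
  then obtain l where l: "l \<in> S" "score t s l = Max (score t s ` S)" by auto
  have maxS: "score t s l' \<le> score t s l" if "l' \<in> S" for l' using l(2) finS that by simp
  have max: "score t s l' \<le> score t s l" if "distinct l'" "set l' \<subseteq> P" for l'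
  proof (cases "pin_len t l' \<le> 2 * t")
    case True
    then show ?thesis using that by (intro maxS) (simp add: S_def)
  next
    case False
    then show ?thesis using long[OF that] maxS[OF neS] by simp
  qed
  obtain \<gamma> where \<gamma>: "is_minimizer P (line_at t) s \<gamma>" "set l \<subseteq> \<gamma> ` {0..s}"
    using minimizer_exists[OF P s t, of l] l(1) max by (auto simp: S_def)
  then have "set l \<subseteq> cyl 1 w" using min unfolding minimizer_in_def s_def by blast
  then have Im: "\<forall>p\<in>set l. \<bar>Im p\<bar> \<le> w" by (auto simp: cyl_1)
  have "real (length l) \<le> 40 * (plen (0 # l) + 2 * t)" using l(1) by (intro lin) (auto simp: S_def)
  \<comment> \<open>The origin of \<open>160 * t\<close>: 40 points per unit, for a length of at
    most \<open>2 * t\<close> plus the additive \<open>2 * t\<close>.\<close>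
  also have "\<dots> \<le> real k"
  proof -
    have "plen (0 # l) \<le> pin_len t l" by (simp add: pin_len_def)
    moreover have "pin_len t l \<le> 2 * t" using l(1) by (simp add: S_def)
    ultimately have "40 * (plen (0 # l) + 2 * t) \<le> 40 * (2 * t + 2 * t)"
      by (intro mult_left_mono add_mono) auto
    then show ?thesis using k by simp
  qed
  finally have "length l \<le> k" by simp
  then show ?thesis
    unfolding strip_max_def s_def[symmetric] using l(1) Im max by (intro exI[of _ l]) (auto simp: S_def)
qed

section \<open>Rotated and enriched configurations\<close>

lemma plen_rotate: "norm u = 1 \<Longrightarrow> plen (map ((*) u) l) = plen l" for u :: complex
proof (induction l rule: plen.induct)
  case (3 x y l)
  have "norm (u * y - u * x) = norm (y - x)"
    using 3(2) by (simp add: norm_mult flip: right_diff_distrib)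
  then show ?case using 3 by simp
qed auto

text \<open>A rotation preserves the polygon and alters only the horizontal distance of its last
  point to the line. Because that point has small imaginary part, the change is of order
  \<open>w^2 / t\<close>, not \<open>w\<close>, for \<open>\<theta>\<close> of order
  \<open>w / t\<close>.\<close>

lemma pin_len_rotate:
  assumes u: "norm u = 1" "1 - Re u \<le> \<theta>\<^sup>2" "Re u \<le> 1" "\<bar>Im u\<bar> \<le> \<theta>"
    and l: "\<forall>p\<in>set l. \<bar>Im p\<bar> \<le> 3 * w" "pin_len t l \<le> 4 * t" "0 \<le> w" "0 \<le> t"
  shows "pin_len t (map ((*) u) l) \<le> pin_len t l + (4 * t * \<theta>\<^sup>2 + 3 * w * \<theta>)"
proof -
  define z where "z = last (0 # l)"
  have lz: "last (0 # map ((*) u) l) = u * z"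
    by (auto simp: z_def last_map)
  have pl: "plen (0 # map ((*) u) l) = plen (0 # l)"
    using plen_rotate[OF u(1), of "0 # l"] by simp
  have z: "norm z \<le> 4 * t" "\<bar>Im z\<bar> \<le> 3 * w"
  proof -
    show "norm z \<le> 4 * t"
      using norm_le_pin_len[of "last l" l t] l by (cases "l = []") (auto simp: z_def intro: order_trans)
    show "\<bar>Im z\<bar> \<le> 3 * w" using l by (cases "l = []") (auto simp: z_def)
  qed
  have \<theta>0: "0 \<le> \<theta>" using u(4) by linarith
  have "\<bar>Re z - Re (u * z)\<bar> = \<bar>Re z * (1 - Re u) + Im z * Im u\<bar>" by (simp add: algebra_simps)
  also have "\<dots> \<le> \<bar>Re z\<bar> * (1 - Re u) + \<bar>Im z\<bar> * \<bar>Im u\<bar>"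
    using u(3) abs_triangle_ineq[of "Re z * (1 - Re u)" "Im z * Im u"] by (simp add: abs_mult)
  also have "\<dots> \<le> (4 * t) * \<theta>\<^sup>2 + (3 * w) * \<theta>"
    using u z abs_Re_le_cmod[of z] l by (intro add_mono mult_mono) auto
  finally have "\<bar>t - Re (u * z)\<bar> \<le> \<bar>t - Re z\<bar> + (4 * t * \<theta>\<^sup>2 + 3 * w * \<theta>)" by linarith
  then show ?thesis unfolding pin_len_def lz pl z_def[symmetric] by simp
qed

text \<open>Every extra point near the polyline is collected by a detour from it and back.\<close>

lemma insert_points:
  assumes "finite Q" "distinct l" "Q \<inter> set l = {}" "\<forall>q\<in>Q. \<exists>z\<in>polygon (0 # l @ [foot t l]). norm (q - z) \<le> \<rho>"
  obtains l2 where "distinct l2" "set l2 = set l \<union> Q" "length l2 = length l + card Q"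
    "pin_len t l2 \<le> pin_len t l + 2 * \<rho> * card Q"
proof -
  define vs where "vs = 0 # l @ [foot t l]"
  have "vs \<noteq> []" by (simp add: vs_def)
  from polygon_insert_finite[OF assms(1) this, of \<rho>] assms(4)
  obtain ws where ws: "plen ws \<le> plen vs + 2 * \<rho> * card Q" "subseq vs ws" "Q \<subseteq> set ws" "ws \<noteq> []"
    "hd ws = hd vs" "last ws = last vs"
    unfolding vs_def[symmetric] by blast
  have "set l \<subseteq> set ws"
  proof
    fix x assume "x \<in> set l"
    then have "subseq [x] vs" by (simp add: subseq_singleton_left vs_def)
    then have "subseq [x] ws" using ws(2) by (rule subseq_order.order_trans)
    then show "x \<in> set ws" by (simp add: subseq_singleton_left)
  qed
  then have "set l \<union> Q \<subseteq> set ws" using ws(3) by blast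
  moreover have "hd ws = 0" "Re (last ws) = t" using ws(5,6) by (auto simp: vs_def foot_def)
  ultimately obtain l2 where l2: "distinct l2" "set l2 = set l \<union> Q" "pin_len t l2 \<le> plen ws"
    using visit_list[of "set l \<union> Q" ws t] ws(4) by metis
  have "length l2 = card (set l \<union> Q)" using l2 distinct_card by metis
  also have "\<dots> = length l + card Q"
    using assms by (simp add: card_Un_disjoint Int_commute distinct_card)
  finally show ?thesis
    using that l2 ws(1) by (simp add: pin_len_eq vs_def)
qed

text \<open>If the optimal path stays in the strip both for the rotated configuration and for the
  configuration enriched inside the rotated strip, then the enriched rotated path would have to be
  beaten by a path that does not see the enrichment.\<close>

lemma enrichment_contradiction:
  assumes u: "norm u = 1" "1 - Re u \<le> \<theta>\<^sup>2" "Re u \<le> 1" "\<bar>Im u\<bar> \<le> \<theta>"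
    and par: "0 < s" "0 \<le> w" "0 < t" "0 \<le> \<rho>" "2 * \<rho> * real G \<le> t / 2" "4 * t * \<theta>\<^sup>2 + 3 * w * \<theta> \<le> t / 2"
      "18 * t * \<rho> \<le> s" "G \<le> k" "2 + 9 * t * (4 * t * \<theta>\<^sup>2 + 3 * w * \<theta>) / s < real G / 2"
    and V: "\<And>z. z \<in> V \<Longrightarrow> \<bar>Im (cnj u * z)\<bar> \<le> 3 * w" "\<And>z. z \<in> V \<Longrightarrow> 2 * w < \<bar>Im z\<bar>"
    and l1: "distinct l1" "set l1 \<subseteq> (*) (cnj u) ` P" "\<forall>p\<in>set l1. \<bar>Im p\<bar> \<le> 2 * w" "pin_len t l1 \<le> 3 * t" "length l1 \<le> k"
    and max: "\<And>l2. distinct l2 \<Longrightarrow> set l2 \<subseteq> (*) (cnj u) ` P \<Longrightarrow> pin_len t l2 \<le> 4 * t \<Longrightarrow> length l2 \<le> 2 * k \<Longrightarrow>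
        score t s l2 \<le> score t s l1 + 1"
    and Q: "finite Q" "card Q = G" "Q \<subseteq> A \<inter> V" "Q \<inter> P = {}"
      "\<forall>q\<in>Q. \<exists>z\<in>polygon (0 # l1 @ [foot t l1]). norm (cnj u * q - z) \<le> \<rho>"
    and nm: "near_max t s w k (P \<union> (A \<inter> V))"
  shows False
proof -
  define \<eta> where "\<eta> = 4 * t * \<theta>\<^sup>2 + 3 * w * \<theta>"
  have uu: "u * cnj u = 1" "cnj u * u = 1"
    using complex_norm_square[of u] u(1) by (simp_all add: mult.commute[of "cnj u"])
  have cancel: "u * (cnj u * z) = z" "cnj u * (u * z) = z" for z
    using uu by (simp_all add: mult.assoc[symmetric])
  have "u \<noteq> 0" using u(1) by auto
  then have inj: "inj ((*) u)" "inj ((*) (cnj u))" by (auto simp: inj_def)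
  have \<theta>0: "0 \<le> \<theta>" using u(4) by linarith
  have \<eta>: "0 \<le> \<eta>" "\<eta> \<le> t / 2" using par \<theta>0 by (auto simp: \<eta>_def)
  define Q' where "Q' = (*) (cnj u) ` Q"
  have Q': "finite Q'" "card Q' = G"
    using Q(1,2) card_image[OF inj_on_subset[OF inj(2) subset_UNIV], of Q] by (simp_all add: Q'_def)
  have disj: "Q' \<inter> set l1 = {}"
  proof -
    have "Q' \<inter> (*) (cnj u) ` P = (*) (cnj u) ` (Q \<inter> P)" using inj(2) by (simp add: Q'_def image_Int)
    then show ?thesis using Q(4) l1(2) by auto
  qed
  have nearQ: "\<forall>q\<in>Q'. \<exists>z\<in>polygon (0 # l1 @ [foot t l1]). norm (q - z) \<le> \<rho>"
    using Q(5) by (auto simp: Q'_def)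
  from insert_points[OF Q'(1) l1(1) disj nearQ] obtain l2 where l2: "distinct l2" "set l2 = set l1 \<union> Q'"
    "length l2 = length l1 + G" "pin_len t l2 \<le> pin_len t l1 + 2 * \<rho> * real G"
    unfolding Q'(2) by metis
  have s1: "score t s l1 + real G - 9 * t * (2 * \<rho> * real G) / (2 * s) \<le> score t s l2"
    using score_change[of s t l2 l1 "2 * \<rho> * real G"] l2(3,4) par l1(4) by simp
  \<comment> \<open>The radius \<open>\<rho>\<close> is so small that the detours use up at most
    half of the \<open>G\<close> points collected.\<close>
  have "9 * t * (2 * \<rho> * real G) / (2 * s) \<le> real G / 2"
  proof -
    have "18 * t * \<rho> * real G \<le> s * real G" using par(7) by (intro mult_right_mono) auto
    then show ?thesis using par(1) by (simp add: field_simps)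
  qed
  with s1 have S1: "score t s l1 + real G / 2 \<le> score t s l2" by linarith
  have l2len: "pin_len t l2 \<le> 7 / 2 * t" using l2(4) l1(4) par(5) by simp
  have Iml2: "\<forall>p\<in>set l2. \<bar>Im p\<bar> \<le> 3 * w"
    using l1(3) l2(2) Q(3) V(1) par(2) by (fastforce simp: Q'_def)
  define l2u where "l2u = map ((*) u) l2"
  have len2u: "pin_len t l2u \<le> pin_len t l2 + \<eta>"
    unfolding l2u_def \<eta>_def using l2len par Iml2 by (intro pin_len_rotate u) auto
  have S2: "score t s l2 - 9 * t * \<eta> / (2 * s) \<le> score t s l2u"
    using score_change[of s t l2u l2 \<eta>] len2u l2len par \<eta> by (simp add: l2u_def)
  obtain l3 where l3: "distinct l3" "set l3 \<subseteq> P \<union> (A \<inter> V)" "\<forall>p\<in>set l3. \<bar>Im p\<bar> \<le> 2 * w"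
    "pin_len t l3 \<le> 3 * t" "length l3 \<le> k"
    and max3: "\<And>l. distinct l \<Longrightarrow> set l \<subseteq> P \<union> (A \<inter> V) \<Longrightarrow> pin_len t l \<le> 4 * t \<Longrightarrow> length l \<le> 2 * k \<Longrightarrow>
        score t s l \<le> score t s l3 + 1"
    using nm unfolding near_max_def by blast
  have "score t s l2u \<le> score t s l3 + 1"
  proof (rule max3)
    show "distinct l2u" using l2(1) inj_on_subset[OF inj(1) subset_UNIV] by (simp add: l2u_def distinct_map)
    have unrot: "(*) u ` (*) (cnj u) ` X = X" for X
      using cancel(1) by (simp only: image_image image_ident)
    have "(*) u ` set l1 \<subseteq> P" using image_mono[OF l1(2), of "(*) u"] by (simp only: unrot)
    moreover have "(*) u ` Q' \<subseteq> A \<inter> V" using Q(3) by (simp only: Q'_def unrot)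
    ultimately show "set l2u \<subseteq> P \<union> (A \<inter> V)" by (auto simp: l2u_def l2(2))
    show "pin_len t l2u \<le> 4 * t" using len2u l2len \<eta> by linarith
    show "length l2u \<le> 2 * k" using l2(3) l1(5) par(8) by (simp add: l2u_def)
  qed
  \<comment> \<open>The near-optimal list of the enriched configuration stays where \<open>V\<close>
    has no points, so it is a list of \<open>P\<close> alone.\<close>
  moreover have l3P: "set l3 \<subseteq> P" using l3(2,3) V(2) by fastforce
  define l3u where "l3u = map ((*) (cnj u)) l3"
  have len3u: "pin_len t l3u \<le> pin_len t l3 + \<eta>"
    unfolding l3u_def \<eta>_def using l3(3,4) par u by (intro pin_len_rotate) auto
  have S3: "score t s l3 - 9 * t * \<eta> / (2 * s) \<le> score t s l3u"
    using score_change[of s t l3u l3 \<eta>] len3u l3(4) par \<eta> by (simp add: l3u_def)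
  have "score t s l3u \<le> score t s l1 + 1"
  proof (rule max)
    show "distinct l3u" using l3(1) inj_on_subset[OF inj(2) subset_UNIV] by (simp add: l3u_def distinct_map)
    show "set l3u \<subseteq> (*) (cnj u) ` P" using l3P by (auto simp: l3u_def)
    show "pin_len t l3u \<le> 4 * t" using len3u l3(4) \<eta> par(3) by linarith
    show "length l3u \<le> 2 * k" using l3(5) by (simp add: l3u_def)
  qed
  moreover have "9 * t * \<eta> / (2 * s) + 9 * t * \<eta> / (2 * s) = 9 * t * \<eta> / s"
    using par(1) by (simp add: field_simps)
  \<comment> \<open>Around the cycle \<open>l1\<close>, \<open>l2\<close>, \<open>l2u\<close>,
    \<open>l3\<close>, \<open>l3u\<close>, \<open>l1\<close> the gain is \<open>G / 2\<close>; the
    two rotations cost \<open>9 * t * \<eta> / s\<close> in total and the two near-optimality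
    comparisons 1 each.\<close>
  ultimately show False using S1 S2 S3 par(9) unfolding \<eta>_def[symmetric] by linarith
qed

section \<open>Transversal fluctuations\<close>

text \<open>Natural numbers index the cells because independence is assumed for such families;
  positive areas serve as denominators in the change of intensity.\<close>

lemma grid_exists:
  assumes "0 < r"
  shows "\<exists>(I :: nat set) (B :: nat \<Rightarrow> complex set). finite I \<and> disjoint_family_on B I \<and>
    (\<forall>i\<in>I. B i \<in> sets borel \<and> bounded (B i) \<and> 0 < area (B i)) \<and>
    (\<forall>i\<in>I. \<forall>p\<in>B i. \<forall>q\<in>B i. norm (p - q) \<le> 4 * r) \<and> cball 0 a \<subseteq> (\<Union>i\<in>I. B i)"
proof -
  define m where "m = \<lceil>a / r\<rceil>"
  define G where "G = {-m..m} \<times> {-m..m}"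
  have "finite G" by (simp add: G_def)
  then obtain e where e: "bij_betw e {0..<card G} G" using ex_bij_betw_nat_finite by blast
  have "disjoint_family_on (\<lambda>i. cell r (e i)) {0..<card G}"
    using e by (fastforce simp: disjoint_family_on_def cell_def bij_betw_def inj_on_def)
  moreover have "norm (p - q) \<le> 4 * r" if "p \<in> cell r g" "q \<in> cell r g" for p q g
    using cell_corner[OF assms that(1)] cell_corner[OF assms that(2)]
      norm_triangle_ineq4[of "p - corner r g" "q - corner r g"] by simp
  moreover have "z \<in> (\<Union>i\<in>{0..<card G}. cell r (e i))" if "z \<in> cball 0 a" for z
  proof -
    have *: "\<lfloor>b / r\<rfloor> \<in> {-m..m}" if "\<bar>b\<bar> \<le> a" for b
    proof -
      have "b / r \<le> a / r" "- (a / r) \<le> b / r"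
        using that assms by (auto simp: field_simps)
      moreover have "a / r \<le> real_of_int m" by (simp add: m_def)
      ultimately have "b / r \<le> real_of_int m" "real_of_int (- m) \<le> b / r" by simp_all
      then show ?thesis by (auto simp: floor_le_iff le_floor_iff)
    qed
    have "cell_of r z \<in> G"
      using that *[of "Re z"] *[of "Im z"] abs_Re_le_cmod[of z] abs_Im_le_cmod[of z]
      by (simp add: G_def cell_of_def)
    then have "cell_of r z \<in> e ` {0..<card G}" using e by (simp add: bij_betw_def)
    then obtain i where "i \<in> {0..<card G}" "e i = cell_of r z" by (metis imageE)
    then show ?thesis by (auto simp: cell_def intro!: bexI[of _ i])
  qed
  ultimately show ?thesis
    using cell_measure[OF assms] assms
    by (intro exI[of _ "{0..<card G}"] exI[of _ "\<lambda>i. cell r (e i)"]) (auto simp: subset_iff)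
qed

text \<open>On \<open>[0, 1]\<close> the cosine is at least \<open>cos (pi / 3) = 1 / 2\<close>,
  since \<open>pi > 3\<close>.\<close>

lemma half_le_sin: "0 \<le> x \<Longrightarrow> x \<le> 1 \<Longrightarrow> x / 2 \<le> sin x" for x :: real
proof -
  assume x: "0 \<le> x" "x \<le> 1"
  have "sin 0 - 0 / 2 \<le> sin x - x / 2"
  proof (rule DERIV_nonneg_imp_nondecreasing[OF x(1)])
    fix y :: real assume y: "0 \<le> y" "y \<le> x"
    have "cos (pi / 3) \<le> cos y"
      using y x pi_gt3 by (intro cos_monotone_0_pi_le) auto
    then have "0 \<le> cos y - 1 / 2" by (simp add: cos_60)
    moreover have "((\<lambda>y. sin y - y / 2) has_real_derivative cos y - 1 / 2) (at y)"
      by (auto intro!: derivative_eq_intros)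
    ultimately show "\<exists>D. ((\<lambda>y. sin y - y / 2) has_real_derivative D) (at y) \<and> 0 \<le> D" by blast
  qed
  then show ?thesis by simp
qed

lemma one_minus_cos_le: "1 - cos x \<le> x\<^sup>2" for x :: real
proof -
  have "1 - cos x = 2 * (sin (x / 2))\<^sup>2" using cos_double_sin[of "x / 2"] by simp
  also have "\<dots> \<le> 2 * (x / 2)\<^sup>2"
    using abs_sin_x_le_abs_x[of "x / 2"] unfolding abs_le_square_iff by (rule mult_left_mono) simp
  also have "\<dots> \<le> x\<^sup>2" by (simp add: power2_eq_square)
  finally show ?thesis .
qed

lemma locfin_image: "u \<noteq> 0 \<Longrightarrow> locfin P \<Longrightarrow> locfin ((*) u ` P)"
  unfolding locfin_def
proof (intro allI impI)
  fix B :: "complex set" assume u: "u \<noteq> 0" and P: "\<forall>B. bounded B \<longrightarrow> finite (P \<inter> B)" and B: "bounded B"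
  have "(*) u ` P \<inter> B \<subseteq> (*) u ` (P \<inter> (*) (inverse u) ` B)"
    using u by (auto simp: image_iff) (metis mult.assoc left_inverse mult_1)
  moreover have "bounded ((*) (inverse u) ` B)"
    by (intro bounded_linear_image[OF B] bounded_linear_mult_right)
  ultimately show "finite ((*) u ` P \<inter> B)" using P finite_subset by blast
qed

lemma locfin_Un_Int: "locfin P \<Longrightarrow> locfin A \<Longrightarrow> locfin (P \<union> (A \<inter> V))"
  unfolding locfin_def
proof (intro allI impI)
  fix B :: "complex set"
  assume "\<forall>B. bounded B \<longrightarrow> finite (P \<inter> B)" "\<forall>B. bounded B \<longrightarrow> finite (A \<inter> B)" "bounded B"
  then have "finite ((P \<inter> B) \<union> (A \<inter> B))" by simp
  then show "finite ((P \<union> (A \<inter> V)) \<inter> B)" by (rule rev_finite_subset) auto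
qed

definition cell_counts :: "nat set \<Rightarrow> (nat \<Rightarrow> complex set) \<Rightarrow> complex set \<Rightarrow> nat \<Rightarrow> nat" where
  "cell_counts I B Q = (\<lambda>i. if i \<in> I then card (Q \<inter> B i) else 0)"

text \<open>One failing configuration makes a vector bad. A vector outside this set therefore
  certifies \<open>near_max\<close> for every locally finite configuration with these
  counts.\<close>

definition bad_counts :: "real \<Rightarrow> real \<Rightarrow> real \<Rightarrow> nat \<Rightarrow> nat set \<Rightarrow> (nat \<Rightarrow> complex set) \<Rightarrow> (nat \<Rightarrow> nat) set" where
  "bad_counts t s w k I B = cell_counts I B ` {Q. locfin Q \<and> \<not> near_max t s w k Q}"

lemma near_max_if_counts: "locfin Q \<Longrightarrow> cell_counts I B Q \<notin> bad_counts t s w k I B \<Longrightarrow> near_max t s w k Q"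
  by (auto simp: bad_counts_def)

text \<open>Centres of disjoint balls along the path, one in each of \<open>J\<close> columns in the second half of the
  strip: the union is the region in which extra points pay off.\<close>

lemma path_balls:
  assumes l: "\<forall>p\<in>set l. \<bar>Im p\<bar> \<le> 2 * w" and par: "0 < \<rho>" "\<rho> \<le> w" "0 < t" "2 * \<rho> * real J \<le> t / 2"
  shows "\<exists>U. U \<in> sets borel \<and> bounded U \<and> area U = real J * (pi * \<rho>\<^sup>2) \<and>
    U \<subseteq> cbox (Complex (t / 2) (- (3 * w))) (Complex t (3 * w)) \<and>
    (\<forall>q\<in>U. \<exists>z\<in>polygon (0 # l @ [foot t l]). norm (q - z) \<le> \<rho>)"
proof -
  define vs where "vs = 0 # l @ [foot t l]"
  have Imv: "\<forall>v\<in>set vs. \<bar>Im v\<bar> \<le> 2 * w"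
    using l par by (cases "l = []") (auto simp: vs_def foot_def)
  \<comment> \<open>Column \<open>j\<close> has width \<open>2 * \<rho>\<close> and the centre line
    shown here; the last one still ends before \<open>t\<close>.\<close>
  have a: "t / 2 + \<rho> * (2 * real j + 1) \<le> t - \<rho>" if "j < J" for j
  proof -
    have "real j + 1 \<le> real J" using that by linarith
    then have "2 * \<rho> * (real j + 1) \<le> 2 * \<rho> * real J" using par(1) by (intro mult_left_mono) auto
    then show ?thesis using par(4) by (simp add: algebra_simps)
  qed
  have "\<exists>z\<in>polygon vs. Re z = t / 2 + \<rho> * (2 * real j + 1) \<and> \<bar>Im z\<bar> \<le> 2 * w" if "j < J" for j
    using a[OF that] par Imv by (intro polygon_Re) (auto simp: vs_def foot_def)
  then obtain z where z: "\<And>j. j < J \<Longrightarrow> z j \<in> polygon vs \<and> Re (z j) = t / 2 + \<rho> * (2 * real j + 1) \<and> \<bar>Im (z j)\<bar> \<le> 2 * w"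
    by metis
  define U where "U = (\<Union>j\<in>{..<J}. ball (z j) \<rho>)"
  have sub: "ball (z j) \<rho> \<subseteq> cbox (Complex (t / 2) (- (3 * w))) (Complex t (3 * w))" if "j < J" for j
  proof
    fix q assume "q \<in> ball (z j) \<rho>"
    then have "norm (q - z j) < \<rho>" by (simp add: dist_norm norm_minus_commute)
    then have "\<bar>Re q - Re (z j)\<bar> < \<rho>" "\<bar>Im q - Im (z j)\<bar> < \<rho>"
      using abs_Re_le_cmod[of "q - z j"] abs_Im_le_cmod[of "q - z j"] by simp_all
    moreover have "t / 2 + \<rho> \<le> Re (z j)" "Re (z j) \<le> t - \<rho>" "\<bar>Im (z j)\<bar> \<le> 2 * w"
      using z[OF that] a[OF that] par by (auto simp: algebra_simps)
    ultimately show "q \<in> cbox (Complex (t / 2) (- (3 * w))) (Complex t (3 * w))"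
      using par by (auto simp: in_cbox_complex_iff)
  qed
  have dis: "disjoint_family_on (\<lambda>j. ball (z j) \<rho>) {..<J}"
  proof (unfold disjoint_family_on_def, intro ballI impI)
    fix i j assume ij: "i \<in> {..<J}" "j \<in> {..<J}" "i \<noteq> j"
    have "Re (z i) - Re (z j) = 2 * \<rho> * (real i - real j)"
      using ij z[of i] z[of j] by (simp add: algebra_simps)
    then have "\<bar>Re (z i) - Re (z j)\<bar> = 2 * \<rho> * \<bar>real i - real j\<bar>" using par(1) by (simp add: abs_mult)
    moreover have "1 \<le> \<bar>real i - real j\<bar>" using ij(3) by linarith
    then have "2 * \<rho> * 1 \<le> 2 * \<rho> * \<bar>real i - real j\<bar>" using par(1) by (intro mult_left_mono) auto
    ultimately have "2 * \<rho> \<le> norm (z i - z j)" using abs_Re_le_cmod[of "z i - z j"] by simp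
    then show "ball (z i) \<rho> \<inter> ball (z j) \<rho> = {}"
      by (intro disjoint_ballI) (simp add: dist_norm)
  qed
  have "area U = (\<Sum>j\<in>{..<J}. area (ball (z j) \<rho>))"
    unfolding U_def by (rule measure_finite_Union) (use dis emeasure_lborel_ball_finite in \<open>auto simp: less_top\<close>)
  also have "\<dots> = real J * (pi * \<rho>\<^sup>2)"
    using par(1) by (simp add: content_ball unit_ball_vol_2)
  finally have "area U = real J * (pi * \<rho>\<^sup>2)" .
  moreover have "U \<in> sets borel" "bounded U" unfolding U_def by (auto intro!: sets.finite_UN)
  moreover have "U \<subseteq> cbox (Complex (t / 2) (- (3 * w))) (Complex t (3 * w))"
    using sub by (auto simp: U_def)
  moreover have "\<exists>z\<in>polygon vs. norm (q - z) \<le> \<rho>" if q: "q \<in> U" for q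
  proof -
    obtain j where "j < J" "q \<in> ball (z j) \<rho>" using q by (auto simp: U_def)
    then show ?thesis using z[of j] by (intro bexI[of _ "z j"]) (auto simp: dist_norm norm_minus_commute)
  qed
  ultimately show ?thesis unfolding vs_def by blast
qed

text \<open>If bad vectors were rarer, changing the law with \<open>K = 32\<close> would leave both
  the rotated and the enriched configuration good with high probability, and a single pair of
  samples would meet all hypotheses of \<open>enrichment_contradiction\<close>.\<close>

lemma bad_counts_probability:
  fixes M :: "'a measure" and I :: "nat set"
  assumes M: "prob_space M" and pp: "poisson_pp M \<omega>"
    and I: "finite I" "disjoint_family_on B I"
    and B: "\<And>i. i \<in> I \<Longrightarrow> B i \<in> sets borel \<and> bounded (B i) \<and> 0 < area (B i)"
    and par: "0 < s" "1 \<le> w" "0 < t" "0 < \<rho>" "\<rho> \<le> 1" "\<theta> = 24 * w / t" "\<theta> \<le> 1" "18 * t * \<rho> \<le> s" "G \<le> k"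
      "2 * \<rho> * real G \<le> t / 2" "4 * t * \<theta>\<^sup>2 + 3 * w * \<theta> \<le> t / 2" "2 * \<rho> * real J \<le> t / 2"
      "2 + 9 * t * (4 * t * \<theta>\<^sup>2 + 3 * w * \<theta>) / s < real G / 2"
      "2 ^ G * exp (- (real J * (pi * \<rho>\<^sup>2) / sqrt (3 * w * t) / 2)) \<le> 1 / 4"
  shows "{x\<in>space M. cell_counts I B (\<omega> x) \<in> bad_counts t s w k I B} \<in> sets M \<and>
    1 / 512 \<le> measure M {x\<in>space M. cell_counts I B (\<omega> x) \<in> bad_counts t s w k I B}"
proof
  interpret M: prob_space M by fact
  interpret MM: pair_prob_space M M ..
  define E where "E = bad_counts t s w k I B"
  define N where "N i x = card (\<omega> x \<inter> B i)" for i x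
  have cN: "poisson_counts M N (\<lambda>i. area (B i)) I"
    unfolding N_def by (rule poisson_pp_counts[OF M pp I]) (use B in auto)
  have vecN: "count_vec I N x = cell_counts I B (\<omega> x)" for x
    by (auto simp: count_vec_def cell_counts_def N_def)
  define p where "p = measure M {x\<in>space M. count_vec I N x \<in> E}"
  show "{x\<in>space M. cell_counts I B (\<omega> x) \<in> bad_counts t s w k I B} \<in> sets M"
    using count_vec_event(1)[OF M cN I(1), of E] by (simp add: vecN E_def)
  have loc: "locfin (\<omega> x)" if "x \<in> space M" for x
    using pp that by (auto simp: poisson_pp_def locfin_def)
  define u where "u = cis \<theta>"
  have \<theta>: "0 \<le> \<theta>" using par by simp
  have u: "norm u = 1" "1 - Re u \<le> \<theta>\<^sup>2" "Re u \<le> 1" "\<bar>Im u\<bar> \<le> \<theta>"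
    using one_minus_cos_le[of \<theta>] abs_sin_x_le_abs_x[of \<theta>] \<theta> by (simp_all add: u_def)
  have u0: "cnj u \<noteq> 0" "norm (cnj u) = 1" using u(1) by auto
  define V where "V = (*) (cnj u) -` cbox (Complex (t / 2) (- (3 * w))) (Complex t (3 * w))"
  have V: "V \<in> sets borel" "bounded V" "area V = 3 * w * t"
    using measure_mult_vimage[OF u0(1), of "cbox (Complex (t / 2) (- (3 * w))) (Complex t (3 * w))"] par u0(2)
    by (simp_all add: V_def measure_rect)
  have V1: "\<bar>Im (cnj u * z)\<bar> \<le> 3 * w" if "z \<in> V" for z
    using that by (auto simp: V_def in_cbox_complex_iff)
  \<comment> \<open>The factor 24 in \<open>\<theta>\<close> is made for this:
    \<open>sin \<theta>\<close> is at least \<open>12 * w / t\<close>, so beyond distance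
    \<open>t / 2\<close> the axis of the rotated strip has height at least about
    \<open>6 * w\<close>, and the half-width takes away at most \<open>3 * w\<close>.\<close>
  have V2: "2 * w < \<bar>Im z\<bar>" if "z \<in> V" for z
  proof -
    define y where "y = cnj u * z"
    have "u * cnj u = 1" using complex_norm_square[of u] u(1) by simp
    then have "z = u * y" by (simp add: y_def mult.assoc[symmetric])
    then have Im: "Im z = sin \<theta> * Re y + cos \<theta> * Im y" by (simp add: u_def algebra_simps)
    have y: "t / 2 \<le> Re y" "\<bar>Im y\<bar> \<le> 3 * w"
      using that by (auto simp: V_def in_cbox_complex_iff y_def)
    have sin: "12 * w / t \<le> sin \<theta>" "0 \<le> sin \<theta>"
      using half_le_sin[OF \<theta> par(7)] \<theta> par(6) by auto
    have "12 * w / t * (t / 2) \<le> sin \<theta> * Re y"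
      by (rule mult_mono[OF sin(1) y(1) sin(2)]) (use par in auto)
    then have "6 * w \<le> sin \<theta> * Re y" using par by simp
    moreover have "\<bar>cos \<theta> * Im y\<bar> \<le> 1 * (3 * w)"
      unfolding abs_mult using y(2) by (intro mult_mono) auto
    ultimately show ?thesis unfolding Im using par by linarith
  qed
  define Nb where "Nb i x = card ((*) (cnj u) ` \<omega> x \<inter> B i)" for i x
  \<comment> \<open>Isotropy leaves the rates unchanged; the summand \<open>0\<close> lets
    \<open>poisson_transfer\<close> serve both configurations.\<close>
  have cNb: "poisson_counts M Nb (\<lambda>i. area (B i) + 0) I"
    using poisson_counts_image[OF M pp I u0(1)] B u0(2) by (simp add: Nb_def[abs_def])
  have pb: "measure M {x\<in>space M. count_vec I Nb x \<in> E} \<le> 32 * p + 1 / 32"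
    using poisson_transfer[OF M M I(1) cN cNb, of 32 E] B by (simp add: p_def)
  \<comment> \<open>Dilation by \<open>\<sigma>\<close> lowers the intensity to
    \<open>1 / sqrt (3 * w * t)\<close>, whose square times the area of \<open>V\<close> is
    1.\<close>
  define \<sigma> where "\<sigma> = complex_of_real (sqrt (sqrt (3 * w * t)))"
  have wt: "0 < 3 * w * t" using par by simp
  have \<sigma>: "\<sigma> \<noteq> 0" "(norm \<sigma>)\<^sup>2 = sqrt (3 * w * t)" using wt par by (auto simp: \<sigma>_def)
  define Na where "Na i x = card ((*) \<sigma> ` \<omega> x \<inter> (V \<inter> B i))" for i x
  define mu where "mu i = area (V \<inter> B i) / sqrt (3 * w * t)" for i
  have cNa: "poisson_counts M Na mu I"
    unfolding Na_def mu_def[abs_def] \<sigma>(2)[symmetric]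
  proof (rule poisson_counts_image[OF M pp I(1) _ \<sigma>(1)])
    show "disjoint_family_on (\<lambda>i. V \<inter> B i) I" using I(2) by (fastforce simp: disjoint_family_on_def)
    show "V \<inter> B i \<in> sets borel \<and> bounded (V \<inter> B i)" if "i \<in> I" for i
      using V B[OF that] by auto
  qed
  define Nc where "Nc i z = N i (fst z) + Na i (snd z)" for i z
  have cNc: "poisson_counts (M \<Otimes>\<^sub>M M) Nc (\<lambda>i. area (B i) + mu i) I"
    unfolding Nc_def by (rule poisson_counts_add[OF M M I(1) cN cNa])
  have MM: "prob_space (M \<Otimes>\<^sub>M M)" by unfold_locales
  have ex: "(\<Sum>i\<in>I. (mu i)\<^sup>2 / area (B i)) \<le> 1"
  proof -
    have le: "area (V \<inter> B i) \<le> area (B i)" if "i \<in> I" for i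
      using V B[OF that] by (intro measure_mono_fmeasurable) (auto intro!: fmeasurableI emeasure_bounded_finite)
    have "(\<Sum>i\<in>I. (mu i)\<^sup>2 / area (B i)) \<le>
        (\<Sum>i\<in>I. area (V \<inter> B i) / (3 * w * t))"
    proof (rule sum_mono)
      fix i assume i: "i \<in> I"
      have "(area (V \<inter> B i))\<^sup>2 / area (B i) \<le> area (V \<inter> B i)"
        using le[OF i] B[OF i] by (simp add: divide_le_eq power2_eq_square mult_left_mono)
      then have "(area (V \<inter> B i))\<^sup>2 / area (B i) / (3 * w * t) \<le> area (V \<inter> B i) / (3 * w * t)"
        using wt by (intro divide_right_mono) auto
      moreover have "(mu i)\<^sup>2 = (area (V \<inter> B i))\<^sup>2 / (3 * w * t)"
        using wt by (simp add: mu_def power_divide)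
      ultimately show "(mu i)\<^sup>2 / area (B i) \<le> area (V \<inter> B i) / (3 * w * t)"
        by (simp add: mult.commute)
    qed
    also have "\<dots> = (\<Sum>i\<in>I. area (V \<inter> B i)) / (3 * w * t)" by (rule sum_divide_distrib[symmetric])
    also have "(\<Sum>i\<in>I. area (V \<inter> B i)) = area (\<Union>i\<in>I. V \<inter> B i)"
    proof (rule measure_finite_Union[symmetric])
      show "disjoint_family_on (\<lambda>i. V \<inter> B i) I" using I(2) by (fastforce simp: disjoint_family_on_def)
      show "emeasure lborel (V \<inter> B i) \<noteq> \<infinity>" for i
        using emeasure_bounded_finite[OF bounded_subset[OF V(2), of "V \<inter> B i"]] by (simp add: less_top)
    qed (use I V B in auto)
    also have "\<dots> \<le> area V"
      using V B I by (intro measure_mono_fmeasurable) (auto intro!: fmeasurableI emeasure_bounded_finite sets.finite_UN)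
    finally have "(\<Sum>i\<in>I. (mu i)\<^sup>2 / area (B i)) \<le> 3 * w * t / (3 * w * t)"
      using V(3) wt by (simp add: divide_right_mono)
    moreover have "3 * w * t / (3 * w * t) = 1" using wt by (intro divide_self) auto
    ultimately show ?thesis by linarith
  qed
  have pc: "measure (M \<Otimes>\<^sub>M M) {z\<in>space (M \<Otimes>\<^sub>M M). count_vec I Nc z \<in> E} \<le> 32 * p + 3 / 32"
  proof -
    have "measure (M \<Otimes>\<^sub>M M) {z\<in>space (M \<Otimes>\<^sub>M M). count_vec I Nc z \<in> E} \<le>
        32 * p + exp (\<Sum>i\<in>I. (mu i)\<^sup>2 / area (B i)) / 32"
      unfolding p_def by (rule poisson_transfer[OF M MM I(1) cN cNc]) (use B par in \<open>auto simp: mu_def\<close>)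
    also have "exp (\<Sum>i\<in>I. (mu i)\<^sup>2 / area (B i)) \<le> exp 1"
      using ex by simp
    also have "exp (1::real) \<le> 3" by (rule exp_le)
    finally show ?thesis by simp
  qed
  show "1 / 512 \<le> measure M {x\<in>space M. cell_counts I B (\<omega> x) \<in> bad_counts t s w k I B}"
  proof (rule ccontr)
    assume "\<not> ?thesis"
    then have p: "p < 1 / 512" by (simp add: p_def vecN E_def)
    define Sb where "Sb = {x\<in>space M. count_vec I Nb x \<in> E}"
    define Sc where "Sc = {z\<in>space (M \<Otimes>\<^sub>M M). count_vec I Nc z \<in> E}"
    \<comment> \<open>The assumption gives \<open>32 * p < 1 / 16\<close>; the additional terms are
      \<open>1 / 32\<close> and, using \<open>exp 1 \<le> 3\<close>, \<open>3 / 32\<close>.\<close>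
    have Sb: "Sb \<in> sets M" "measure M Sb \<le> 1 / 8"
      unfolding Sb_def using count_vec_event(1)[OF M cNb I(1), of E] pb p by auto
    have Sc: "Sc \<in> sets (M \<Otimes>\<^sub>M M)" "measure (M \<Otimes>\<^sub>M M) Sc \<le> 5 / 32"
    proof -
      show "Sc \<in> sets (M \<Otimes>\<^sub>M M)"
        unfolding Sc_def by (rule count_vec_event(1)[OF MM cNc I(1)]) (use par in \<open>auto simp: mu_def\<close>)
      show "measure (M \<Otimes>\<^sub>M M) Sc \<le> 5 / 32" unfolding Sc_def using pc p by linarith
    qed
    \<comment> \<open>Fubini: otherwise \<open>Sc\<close> would have probability at least
      \<open>1 / 2 * 7 / 8\<close>. Fixing \<open>x1\<close> fixes \<open>P\<close> and its rotated
      optimal list before the second sample is drawn.\<close>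
    have "\<exists>x1\<in>space M - Sb. measure M (Pair x1 -` Sc) < 1 / 2"
    proof (rule ccontr)
      assume "\<not> ?thesis"
      then have ge: "1 / 2 \<le> measure M (Pair x1 -` Sc)" if "x1 \<in> space M - Sb" for x1
        using that by (meson not_le)
      have "ennreal (7 / 16) \<le> ennreal (1 / 2) * emeasure M (space M - Sb)"
      proof -
        have "7 / 8 \<le> measure M (space M - Sb)" using M.prob_compl[OF Sb(1)] Sb(2) by simp
        then have "ennreal (1 / 2) * ennreal (7 / 8) \<le> ennreal (1 / 2) * emeasure M (space M - Sb)"
          unfolding M.emeasure_eq_measure by (intro mult_left_mono ennreal_leI) auto
        moreover have "ennreal (1 / 2) * ennreal (7 / 8) = ennreal (7 / 16)"
          by (subst ennreal_mult[symmetric]) auto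
        ultimately show ?thesis by (simp only:)
      qed
      also have "\<dots> = (\<integral>\<^sup>+ x. ennreal (1 / 2) * indicator (space M - Sb) x \<partial>M)"
        using Sb(1) by (simp add: nn_integral_cmult_indicator)
      also have "\<dots> \<le> (\<integral>\<^sup>+ x. emeasure M (Pair x -` Sc) \<partial>M)"
      proof (rule nn_integral_mono)
        fix x assume "x \<in> space M"
        show "ennreal (1 / 2) * indicator (space M - Sb) x \<le> emeasure M (Pair x -` Sc)"
        proof (cases "x \<in> space M - Sb")
          case True
          then show ?thesis
            unfolding M.emeasure_eq_measure indicator_simps(1)[OF True] mult_1_right by (intro ennreal_leI ge)
        next
          case False
          then show ?thesis by (auto simp: indicator_def)
        qed
      qed
      also have "\<dots> = emeasure (M \<Otimes>\<^sub>M M) Sc" by (rule M.emeasure_pair_measure_alt[OF Sc(1), symmetric])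
      also have "\<dots> \<le> ennreal (5 / 32)"
        unfolding MM.emeasure_eq_measure using Sc(2) by (rule ennreal_leI)
      finally show False by (subst (asm) ennreal_le_iff) auto
    qed
    then obtain x1 where x1: "x1 \<in> space M" "x1 \<notin> Sb" and sec: "measure M (Pair x1 -` Sc) < 1 / 2" by blast
    define P where "P = \<omega> x1"
    have locP: "locfin P" using loc x1 by (simp add: P_def)
    have "count_vec I Nb x1 = cell_counts I B ((*) (cnj u) ` P)"
      by (auto simp: count_vec_def cell_counts_def Nb_def P_def)
    then have "near_max t s w k ((*) (cnj u) ` P)"
      using x1 locfin_image[OF u0(1) locP] unfolding Sb_def E_def by (intro near_max_if_counts[of _ I B]) auto
    then obtain l1 where l1: "distinct l1" "set l1 \<subseteq> (*) (cnj u) ` P" "\<forall>p\<in>set l1. \<bar>Im p\<bar> \<le> 2 * w"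
      "pin_len t l1 \<le> 3 * t" "length l1 \<le> k"
      and max: "\<And>l2. distinct l2 \<Longrightarrow> set l2 \<subseteq> (*) (cnj u) ` P \<Longrightarrow> pin_len t l2 \<le> 4 * t \<Longrightarrow> length l2 \<le> 2 * k \<Longrightarrow>
        score t s l2 \<le> score t s l1 + 1"
      unfolding near_max_def by blast
    obtain U0 where U0: "U0 \<in> sets borel" "bounded U0" "area U0 = real J * (pi * \<rho>\<^sup>2)"
      "U0 \<subseteq> cbox (Complex (t / 2) (- (3 * w))) (Complex t (3 * w))"
      "\<forall>q\<in>U0. \<exists>z\<in>polygon (0 # l1 @ [foot t l1]). norm (q - z) \<le> \<rho>"
      using path_balls[OF l1(3), of \<rho> t J] par by auto
    define U where "U = (*) (cnj u) -` U0"
    have U: "U \<in> sets borel" "bounded U" "area U = real J * (pi * \<rho>\<^sup>2)"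
      using measure_mult_vimage[OF u0(1) U0(1,2)] u0(2) U0(3) by (simp_all add: U_def)
    have UV: "U \<subseteq> V" using U0(4) by (auto simp: U_def V_def)
    have finPU: "finite (P \<inter> U)" using locP U(2) by (simp add: locfin_def)
    \<comment> \<open>Removing finitely many points leaves the area unchanged and ensures that the
      collected points are new.\<close>
    define U' where "U' = U - P \<inter> U"
    have U': "U' \<in> sets borel" "bounded U'" "area U' = real J * (pi * \<rho>\<^sup>2)"
    proof -
      show "U' \<in> sets borel" unfolding U'_def by (rule sets.Diff[OF U(1) borel_closed[OF finite_imp_closed[OF finPU]]])
      show "bounded U'" using U(2) by (rule bounded_subset) (auto simp: U'_def)
      show "area U' = real J * (pi * \<rho>\<^sup>2)"
        unfolding U'_def U(3)[symmetric]
        by (rule measure_Diff_null_set[OF _ finite_imp_null_set_lborel[OF finPU]]) (use U(1) in simp)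
    qed
    \<comment> \<open>The dilated sample almost surely avoids these finitely many points, so that
      counts of the union are sums of counts.\<close>
    define F where "F = P \<inter> (\<Union>i\<in>I. B i)"
    have "bounded (\<Union>i\<in>I. B i)" using I B by (intro bounded_UN) auto
    then have F: "finite F" unfolding F_def using locP by (simp add: locfin_def)
    have F': "F \<in> sets borel" "bounded F" "area F = 0"
      using F finite_imp_closed borel_closed finite_imp_bounded finite_imp_null_set_lborel[OF F]
      by (auto simp: measure_def null_sets_def)
    define T1 where "T1 = {x\<in>space M. card ((*) \<sigma> ` \<omega> x \<inter> U') \<in> {..G}}"
    define T2 where "T2 = {x\<in>space M. card ((*) \<sigma> ` \<omega> x \<inter> F) \<in> {1..}}"
    have T1: "T1 \<in> sets M" "measure M T1 \<le> 1 / 4"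
      unfolding T1_def poisson_pp_image_prob(2)[OF M pp \<sigma>(1) U'(1,2)] \<sigma>(2) U'(3)
      using poisson_pp_image_prob(1)[OF M pp \<sigma>(1) U'(1,2), of "{..G}"]
        poisson_lower_tail[of "real J * (pi * \<rho>\<^sup>2) / sqrt (3 * w * t)" G] par(14) wt by auto
    have T2: "T2 \<in> sets M" "measure M T2 \<le> 0"
      unfolding T2_def poisson_pp_image_prob(2)[OF M pp \<sigma>(1) F'(1,2)] F'(3)
      using poisson_pp_image_prob(1)[OF M pp \<sigma>(1) F'(1,2), of "{1..}"] poisson_ge_1[of 0] by simp_all
    have secM: "Pair x1 -` Sc \<in> sets M" using Sc(1) by (rule sets_Pair1)
    have "measure M (Pair x1 -` Sc \<union> T1 \<union> T2) \<le> measure M (Pair x1 -` Sc \<union> T1) + measure M T2"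
      using secM T1 T2 by (intro measure_Un_le) auto
    also have "measure M (Pair x1 -` Sc \<union> T1) \<le> measure M (Pair x1 -` Sc) + measure M T1"
      using secM T1 by (intro measure_Un_le) auto
    \<comment> \<open>The three exceptional sets have probabilities below \<open>1 / 2\<close>, at
      most \<open>1 / 4\<close>, and \<open>0\<close>.\<close>
    finally have "measure M (Pair x1 -` Sc \<union> T1 \<union> T2) < 1" using sec T1 T2 by simp
    then have "Pair x1 -` Sc \<union> T1 \<union> T2 \<noteq> space M" using M.prob_space by auto
    moreover have "Pair x1 -` Sc \<union> T1 \<union> T2 \<subseteq> space M"
      using secM T1 T2 by (auto dest: sets.sets_into_space)
    ultimately obtain x2 where x2: "x2 \<in> space M" "(x1, x2) \<notin> Sc" "x2 \<notin> T1" "x2 \<notin> T2" by blast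
    define A where "A = (*) \<sigma> ` \<omega> x2"
    have locA: "locfin A" unfolding A_def using locfin_image[OF \<sigma>(1) loc[OF x2(1)]] .
    have AF: "A \<inter> F = {}"
    proof -
      have "card (A \<inter> F) = 0" using x2(1,4) by (simp add: T2_def A_def)
      then show ?thesis using F by simp
    qed
    have "count_vec I Nc (x1, x2) = cell_counts I B (P \<union> (A \<inter> V))"
    proof
      fix i
      have "card ((P \<union> (A \<inter> V)) \<inter> B i) = card (P \<inter> B i) + card (A \<inter> (V \<inter> B i))" if "i \<in> I"
      proof -
        have eq: "(P \<union> (A \<inter> V)) \<inter> B i = (P \<inter> B i) \<union> (A \<inter> (V \<inter> B i))" by blast
        have "bounded (V \<inter> B i)" using V(2) by blast
        then show ?thesis
          unfolding eq using locP locA B[OF that] AF that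
          by (intro card_Un_disjoint) (auto simp: locfin_def F_def)
      qed
      then show "count_vec I Nc (x1, x2) i = cell_counts I B (P \<union> (A \<inter> V)) i"
        by (auto simp: count_vec_def cell_counts_def Nc_def N_def Na_def P_def A_def)
    qed
    then have "cell_counts I B (P \<union> (A \<inter> V)) \<notin> E"
      using x1(1) x2(1,2) by (auto simp: Sc_def space_pair_measure)
    then have nm: "near_max t s w k (P \<union> (A \<inter> V))"
      unfolding E_def by (rule near_max_if_counts[OF locfin_Un_Int[OF locP locA]])
    have "G \<le> card (A \<inter> U')" using x2(1,3) by (simp add: T1_def A_def)
    then obtain Q where Q: "Q \<subseteq> A \<inter> U'" "card Q = G" "finite Q" by (rule obtain_subset_with_card_n)
    show False
    proof (rule enrichment_contradiction[OF u par(1) _ par(3) _ par(10) par(11) par(8) par(9) par(13) V1 V2 l1 max Q(3,2) _ _ _ nm])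
      show "0 \<le> w" "0 \<le> \<rho>" using par by auto
      show "Q \<subseteq> A \<inter> V" using Q(1) UV by (auto simp: U'_def)
      show "Q \<inter> P = {}" using Q(1) by (auto simp: U'_def)
      show "\<forall>q\<in>Q. \<exists>z\<in>polygon (0 # l1 @ [foot t l1]). norm (cnj u * q - z) \<le> \<rho>"
        using Q(1) U0(5) by (auto simp: U'_def U_def)
    qed
  qed
qed

text \<open>The origin of \<open>3 / 5\<close>. With \<open>w = t powr g\<close> the rotations cost
  order \<open>w^2 / t = t powr (2 * g - 1)\<close>, while the new points gain order
  \<open>sqrt (t / w) = t powr ((1 - g) / 2)\<close>; the gain has the larger exponent exactly when
  \<open>g < 3 / 5\<close>.\<close>

lemma eventually_scales:
  fixes c g :: real
  assumes c: "0 < c" and g: "1 / 2 < g" "g < 3 / 5"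
  shows "eventually (\<lambda>t. 11 \<le> t \<and> 1 \<le> t powr g \<and> 24 * t powr g \<le> t \<and>
    2376 * (t powr g)\<^sup>2 / t \<le> t / 2 \<and> 8 \<le> c / 144 * t powr ((1 - g) / 2) \<and>
    2 + 21384 / c * ((t powr g)\<^sup>2 / t) < (c / 144 * t powr ((1 - g) / 2) / 4 - 1) / 2) at_top"
proof -
  have inf: "filterlim (\<lambda>t. t powr a) at_top at_top" if "0 < a" for a :: real
    unfolding filterlim_at_top
  proof
    fix Z :: real
    show "eventually (\<lambda>t. Z \<le> t powr a) at_top"
      using eventually_ge_at_top[of "max Z 1 powr (1 / a)"]
    proof eventually_elim
      case (elim t)
      have "max Z 1 = (max Z 1 powr (1 / a)) powr a" using that by (simp add: powr_powr)
      also have "\<dots> \<le> t powr a" using elim that by (intro powr_mono2) auto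
      finally show ?case by simp
    qed
  qed
  have null: "((\<lambda>t::real. t powr a) \<longlongrightarrow> 0) at_top" if "a < 0" for a :: real
    by (rule tendsto_neg_powr[OF that filterlim_ident])
  have e1: "eventually (\<lambda>t::real. 1 \<le> t powr g) at_top"
    using inf[of g] g by (auto simp: filterlim_at_top)
  have e2: "eventually (\<lambda>t::real. t powr (g - 1) < 1 / 24) at_top"
    using order_tendstoD(2)[OF null[of "g - 1"], of "1 / 24"] g by auto
  have e3: "eventually (\<lambda>t::real. t powr (2 * g - 2) < 1 / 4752) at_top"
    using order_tendstoD(2)[OF null[of "2 * g - 2"], of "1 / 4752"] g by auto
  have e4: "eventually (\<lambda>t::real. 4 * (2304 / c) \<le> t powr ((1 - g) / 2)) at_top"
    using inf[of "(1 - g) / 2"] g by (auto simp: filterlim_at_top)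
  have e5: "eventually (\<lambda>t::real. t powr (2 * g - 1 - (1 - g) / 2) < c / 2304 * (c / 21384)) at_top"
    using order_tendstoD(2)[OF null[of "2 * g - 1 - (1 - g) / 2"], of "c / 2304 * (c / 21384)"] g c by auto
  show ?thesis
    using e1 e2 e3 e4 e5 eventually_ge_at_top[of 11]
  proof eventually_elim
    case (elim t)
    then have t: "0 < t" by simp
    define y where "y = t powr ((1 - g) / 2)"
    have sq: "(t powr g)\<^sup>2 = t powr (2 * g)" using t by (simp add: powr_power mult.commute)
    have "t powr g = t powr (g - 1) * t" using t by (simp add: powr_diff)
    moreover have "t powr (g - 1) * t \<le> 1 / 24 * t" using elim(2) t by (intro mult_right_mono) auto
    ultimately have c2: "24 * t powr g \<le> t" by simp
    have "t powr (2 * g) / t = t powr (2 * g - 2) * t"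
      using t by (simp add: powr_diff powr_numeral power2_eq_square field_simps)
    moreover have "t powr (2 * g - 2) * t \<le> 1 / 4752 * t" using elim(3) t by (intro mult_right_mono) auto
    ultimately have c3: "2376 * (t powr g)\<^sup>2 / t \<le> t / 2" unfolding sq by simp
    have c4: "16 \<le> c / 144 * y / 4"
      using elim(4) c by (simp add: y_def field_simps)
    have ypos: "0 < y" using t by (simp add: y_def)
    have "t powr (2 * g) / t = t powr (2 * g - 1)" using t by (simp add: powr_diff)
    also have "\<dots> = t powr ((2 * g - 1 - (1 - g) / 2) + (1 - g) / 2)" by simp
    also have "\<dots> = t powr (2 * g - 1 - (1 - g) / 2) * y" unfolding y_def by (rule powr_add)
    finally have "t powr (2 * g) / t = t powr (2 * g - 1 - (1 - g) / 2) * y" .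
    moreover have "t powr (2 * g - 1 - (1 - g) / 2) * y \<le> c / 2304 * (c / 21384) * y"
      using elim(5) ypos by (intro mult_right_mono) auto
    ultimately have "21384 / c * ((t powr g)\<^sup>2 / t) \<le> 21384 / c * (c / 2304 * (c / 21384) * y)"
      unfolding sq using c by (intro mult_left_mono) auto
    also have "\<dots> = c / 144 * y / 4 / 4" using c by simp
    finally have "21384 / c * ((t powr g)\<^sup>2 / t) \<le> c / 144 * y / 4 / 4" .
    moreover have "2 + a < (z - 1) / 2" if "a \<le> z / 4" "16 \<le> z" for a z :: real
    proof -
      have "2 + a \<le> 2 + z / 4" using that(1) by simp
      also have "2 + z / 4 < (z - 1) / 2" using that(2) by (simp add: field_simps)
      finally show ?thesis .
    qed
    ultimately have c5: "2 + 21384 / c * ((t powr g)\<^sup>2 / t) < (c / 144 * y / 4 - 1) / 2" using c4 by blast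
    have "8 \<le> c / 144 * y" using c4 by linarith
    then show ?case using elim(1,6) c2 c3 c5 by (simp add: y_def)
  qed
qed

lemma outer_prob_le:
  assumes "E \<in> sets M" "A \<subseteq> E"
  shows "outer_prob M A \<le> measure M E"
  unfolding outer_prob_def
proof (rule cInf_lower)
  show "measure M E \<in> {measure M E |E. E \<in> sets M \<and> A \<subseteq> E}" using assms by blast
  show "bdd_below {measure M E |E. E \<in> sets M \<and> A \<subseteq> E}" by (intro bdd_belowI[of _ 0]) auto
qed

text \<open>Outside two small exceptional sets, a sample whose minimisers stay in the strip cannot
  have bad counts. Bad counts have probability at least \<open>1 / 512\<close>, the exceptional sets
  at most \<open>1 / 1024\<close>, uniformly in large \<open>t\<close>.\<close>

lemma outer_prob_strip:
  fixes M :: "'a measure"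
  assumes M: "prob_space M" and pp: "poisson_pp M \<omega>"
    and c: "0 < c" "c < 1 / 200" and g: "1 / 2 < g" "g < 3 / 5"
  shows "eventually (\<lambda>t. outer_prob M {x\<in>space M. minimizer_in (\<omega> x) (line_at t) (c * t) (cyl 1 (t powr g))}
    \<le> 1 - 1 / 1024) at_top"
  using eventually_scales[OF c(1) g]
proof eventually_elim
  case (elim t)
  interpret prob_space M by fact
  define w where "w = t powr g"
  define s where "s = c * t"
  \<comment> \<open>The largest radius with \<open>18 * t * \<rho> \<le> s\<close>, the condition
    that makes detours pay.\<close>
  define \<rho> where "\<rho> = c / 18"
  define \<theta> where "\<theta> = 24 * w / t"
  define k where "k = nat \<lceil>160 * t\<rceil>"
  \<comment> \<open>A lower bound for the mean number of new points in the balls: this is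
    \<open>\<rho> / 8 * t / sqrt (w * t)\<close>.\<close>
  define \<mu> where "\<mu> = c / 144 * t powr ((1 - g) / 2)"
  \<comment> \<open>A quarter of that bound, so that the lower tail
    \<open>2 ^ G * exp (- (\<mu> / 2))\<close> is at most \<open>exp (- 2)\<close> once
    \<open>\<mu> \<ge> 8\<close>.\<close>
  define G where "G = nat \<lfloor>\<mu> / 4\<rfloor>"
  define J where "J = nat \<lfloor>t / (4 * \<rho>)\<rfloor>"
  have t: "11 \<le> t" and w: "1 \<le> w" "24 * w \<le> t" "2376 * w\<^sup>2 / t \<le> t / 2" and \<mu>: "8 \<le> \<mu>"
    and gain: "2 + 21384 / c * (w\<^sup>2 / t) < (\<mu> / 4 - 1) / 2"
    using elim by (auto simp: w_def \<mu>_def)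
  have s: "0 < s" using c t by (simp add: s_def)
  have \<rho>: "0 < \<rho>" "\<rho> \<le> 1" using c by (auto simp: \<rho>_def)
  have k: "160 * t \<le> real k" unfolding k_def by linarith
  have \<theta>: "\<theta> \<le> 1" using w t by (simp add: \<theta>_def)
  \<comment> \<open>\<open>2376 = 4 * 24^2 + 3 * 24\<close>, and the constant in \<open>gain\<close>
    is \<open>21384 = 9 * 2376\<close>.\<close>
  have \<eta>: "4 * t * \<theta>\<^sup>2 + 3 * w * \<theta> = 2376 * w\<^sup>2 / t"
    using t by (simp add: \<theta>_def power2_eq_square field_simps)
  have G: "real G \<le> \<mu> / 4" "\<mu> / 4 - 1 < real G" using \<mu> unfolding G_def by linarith+
  have \<mu>t: "\<mu> / 4 \<le> t"
  proof -
    have "t powr ((1 - g) / 2) \<le> t powr 1" using t g by (intro powr_mono) auto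
    then have "\<mu> \<le> c / 144 * t" using c t unfolding \<mu>_def by (intro mult_left_mono) auto
    also have "\<dots> \<le> 1 * t" using c t by (intro mult_right_mono) auto
    finally show ?thesis using t by simp
  qed
  have J: "real J \<le> t / (4 * \<rho>)" "t / (8 * \<rho>) \<le> real J"
  proof -
    have "8 * \<rho> \<le> t" using \<rho> t by linarith
    then have "1 \<le> t / (8 * \<rho>)" using \<rho> by simp
    moreover have "t / (4 * \<rho>) = t / (8 * \<rho>) + t / (8 * \<rho>)" using \<rho> by (simp add: field_simps)
    ultimately show "real J \<le> t / (4 * \<rho>)" "t / (8 * \<rho>) \<le> real J" unfolding J_def by linarith+
  qed
  have mean: "\<mu> \<le> real J * (pi * \<rho>\<^sup>2) / sqrt (3 * w * t)"
  proof -
    have "sqrt (3 * w * t) \<le> sqrt (4 * (w * t))" using w t by simp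
    also have "\<dots> = 2 * sqrt (w * t)" by (simp add: real_sqrt_mult)
    finally have sq: "sqrt (3 * w * t) \<le> 2 * sqrt (w * t)" .
    have "sqrt (w * t) = t powr ((1 + g) / 2)"
      using t by (simp add: w_def powr_half_sqrt[symmetric] powr_powr powr_mult_base add.commute mult.commute)
    then have "t powr ((1 - g) / 2) = t / sqrt (w * t)"
      using t by (simp add: powr_diff[symmetric] field_simps powr_add[symmetric])
    then have "\<mu> = \<rho> / 4 * t / (2 * sqrt (w * t))" by (simp add: \<mu>_def \<rho>_def)
    also have "\<dots> \<le> \<rho> / 4 * t / sqrt (3 * w * t)"
      using sq \<rho> t w by (intro divide_left_mono) auto
    also have "\<dots> \<le> real J * (pi * \<rho>\<^sup>2) / sqrt (3 * w * t)"
    proof (rule divide_right_mono)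
      have "\<rho> / 4 * t = t / (8 * \<rho>) * (2 * \<rho>\<^sup>2)" using \<rho> by (simp add: power2_eq_square)
      also have "\<dots> \<le> real J * (pi * \<rho>\<^sup>2)"
        using J(2) pi_gt3 \<rho> t by (intro mult_mono mult_right_mono) auto
      finally show "\<rho> / 4 * t \<le> real J * (pi * \<rho>\<^sup>2)" .
    qed (use w t in auto)
    finally show ?thesis .
  qed
  have tail: "2 ^ G * exp (- (real J * (pi * \<rho>\<^sup>2) / sqrt (3 * w * t) / 2)) \<le> 1 / 4"
  proof -
    have "(2::real) ^ G \<le> exp 1 ^ G" using exp_ge_add_one_self[of 1] by (intro power_mono) auto
    also have "\<dots> = exp (real G)" by (simp add: exp_of_nat_mult[symmetric])
    finally have "2 ^ G * exp (- (real J * (pi * \<rho>\<^sup>2) / sqrt (3 * w * t) / 2)) \<le> exp (real G) * exp (- (\<mu> / 2))"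
      using mean by (intro mult_mono) auto
    also have "\<dots> = exp (real G - \<mu> / 2)" by (simp flip: exp_add)
    also have "\<dots> \<le> exp (- 2)" using G(1) \<mu> by simp
    also have "\<dots> = inverse (exp 1 * exp 1)" by (simp add: exp_minus flip: exp_add)
    also have "\<dots> \<le> inverse (2 * 2)"
      using exp_ge_add_one_self[of 1] by (intro le_imp_inverse_le mult_mono) auto
    finally show ?thesis by simp
  qed
  \<comment> \<open>Moving at most \<open>2 * k\<close> points within cells of diameter at most
    \<open>4 * r\<close> changes the length by at most \<open>c / 9\<close>; as
    \<open>9 * t * (c / 9) = s\<close>, the score changes by at most \<open>1 / 2\<close>.\<close>
  define r where "r = c / (108 * (2 * real k + 1))"
  have r: "0 < r" using c by (simp add: r_def)
  have r': "3 * (4 * r) * (2 * real k + 1) = c / 9" by (simp add: r_def field_simps)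
  from grid_exists[OF r, of "4 * t"] obtain I :: "nat set" and B :: "nat \<Rightarrow> complex set" where I: "finite I" "disjoint_family_on B I"
    and B: "\<forall>i\<in>I. B i \<in> sets borel \<and> bounded (B i) \<and> 0 < area (B i)"
    and diam: "\<forall>i\<in>I. \<forall>p\<in>B i. \<forall>q\<in>B i. norm (p - q) \<le> 4 * r" and cover: "cball 0 (4 * t) \<subseteq> (\<Union>i\<in>I. B i)"
    by blast
  define F where "F = {x\<in>space M. cell_counts I B (\<omega> x) \<in> bad_counts t s w k I B}"
  have F: "F \<in> sets M \<and> 1 / 512 \<le> measure M F"
    unfolding F_def
  proof (rule bad_counts_probability[OF M pp I _ s w(1) _ \<rho> \<theta>_def \<theta> _ _ _ _ _ _ tail])
    show "B i \<in> sets borel \<and> bounded (B i) \<and> 0 < area (B i)" if "i \<in> I" for i using B that by blast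
    show "0 < t" using t by simp
    show "18 * t * \<rho> \<le> s" by (simp add: s_def \<rho>_def)
    show "G \<le> k" using G(1) \<mu>t k t by linarith
    show "2 * \<rho> * real G \<le> t / 2"
    proof -
      have "2 * \<rho> * real G \<le> (1 / 2) * t" using G(1) \<mu>t c \<rho> by (intro mult_mono) (auto simp: \<rho>_def)
      then show ?thesis by simp
    qed
    show "4 * t * \<theta>\<^sup>2 + 3 * w * \<theta> \<le> t / 2" unfolding \<eta> by (rule w(3))
    show "2 * \<rho> * real J \<le> t / 2" using J(1) \<rho> by (simp add: field_simps)
    have eq: "9 * t * (2376 * w\<^sup>2 / t) / s = 21384 / c * (w\<^sup>2 / t)"
      using t c by (simp add: s_def field_simps)
    show "2 + 9 * t * (4 * t * \<theta>\<^sup>2 + 3 * w * \<theta>) / s < real G / 2"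
      unfolding \<eta> eq using less_trans[OF gain, of "real G / 2"] G(2) by simp
  qed
  \<comment> \<open>\<open>m \<ge> 11\<close> makes the exceptional probability
    \<open>2 * (1/2) ^ m\<close> at most \<open>1 / 1024\<close>.\<close>
  define m where "m = nat \<lceil>t\<rceil>"
  have m: "11 \<le> m" "real m \<le> t + 1" using t unfolding m_def by linarith+
  obtain E where E: "E \<in> sets M" "measure M E \<le> 2 * (1/2) ^ m"
    and lin: "\<And>x l. x \<in> space M - E \<Longrightarrow> distinct l \<Longrightarrow> set l \<subseteq> \<omega> x \<Longrightarrow> real (length l) \<le> 40 * (plen (0 # l) + m + 1)"
    using path_points_linear_all[OF M pp, of m] m by auto
  have "(1/2::real) ^ m \<le> (1/2) ^ 11" using m(1) by (intro power_decreasing) auto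
  moreover have "(1/2::real) ^ 11 = 1 / 2048" by (simp add: power_divide)
  ultimately have PE: "measure M E \<le> 1 / 1024" using E(2) by linarith
  obtain Z where Z: "{x\<in>space M. \<not> generic (\<omega> x)} \<subseteq> Z" "emeasure M Z = 0" "Z \<in> sets M"
    using AE_E[OF AE_generic[OF M pp]] by blast
  define S where "S = {x\<in>space M. minimizer_in (\<omega> x) (line_at t) (c * t) (cyl 1 (t powr g))}"
  have sub: "S \<subseteq> (space M - F) \<union> E \<union> Z"
  proof
    fix x assume x: "x \<in> S"
    show "x \<in> (space M - F) \<union> E \<union> Z"
    proof (rule ccontr)
      assume n: "x \<notin> (space M - F) \<union> E \<union> Z"
      have xM: "x \<in> space M" using x by (simp add: S_def)
      have loc: "locfin (\<omega> x)" using pp xM by (auto simp: poisson_pp_def locfin_def)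
      have "generic (\<omega> x)" using Z(1) n xM by blast
      then have sm: "strip_max t s w k (\<omega> x)"
        unfolding s_def
      proof (rule minimizer_strip_max[OF loc _ _ c(1) _ _ k])
        show "real (length l) \<le> 40 * (plen (0 # l) + 2 * t)" if "distinct l" "set l \<subseteq> \<omega> x" for l
        proof -
          have "real (length l) \<le> 40 * (plen (0 # l) + m + 1)" using n xM that by (intro lin) auto
          also have "\<dots> \<le> 40 * (plen (0 # l) + 2 * t)" using m(2) t by simp
          finally show ?thesis .
        qed
        show "minimizer_in (\<omega> x) (line_at t) (c * t) (cyl 1 w)" using x by (simp add: S_def w_def)
      qed (use c t in auto)
      have "cell_counts I B (\<omega> x) \<in> bad_counts t s w k I B" using n xM by (simp add: F_def)
      then obtain Q where Q: "locfin Q" "\<not> near_max t s w k Q" "cell_counts I B (\<omega> x) = cell_counts I B Q"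
        by (auto simp: bad_counts_def)
      have "near_max t s w k Q"
      proof (rule strip_max_stable[OF loc Q(1) I(2) _ _ cover _ _ _ _ s _ _ sm])
        show "card (\<omega> x \<inter> B i) = card (Q \<inter> B i)" if "i \<in> I" for i
          using fun_cong[OF Q(3), of i] that by (simp add: cell_counts_def)
        show "bounded (B i)" if "i \<in> I" for i using B that by blast
        show "norm (p - q) \<le> 4 * r" if "i \<in> I" "p \<in> B i" "q \<in> B i" for i p q using diam that by blast
        show "0 \<le> 4 * r" "0 < t" using r t by auto
        show "4 * r \<le> w"
        proof -
          have "4 * r * 1 \<le> 4 * r * (2 * real k + 1)" using r by (intro mult_left_mono) auto
          then show ?thesis using r' c w by simp
        qed
        show "3 * (4 * r) * (2 * real k + 1) \<le> t" unfolding r' using c t by simp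
        show "9 * t * (3 * (4 * r) * (2 * real k + 1)) \<le> s" unfolding r' by (simp add: s_def)
      qed
      then show False using Q(2) by simp
    qed
  qed
  have "outer_prob M S
      \<le> measure M ((space M - F) \<union> E \<union> Z)"
    by (rule outer_prob_le[OF _ sub]) (use F E Z in auto)
  also have "\<dots> \<le> measure M ((space M - F) \<union> E) + measure M Z"
    using F E Z by (intro measure_Un_le) auto
  also have "measure M ((space M - F) \<union> E) \<le> measure M (space M - F) + measure M E"
    using F E Z by (intro measure_Un_le) auto
  also have "measure M (space M - F) = 1 - measure M F" using F by (intro prob_compl) auto
  finally show ?case using F PE Z(2) by (simp add: S_def measure_def)
qed

theorem theorem2p3:
  fixes M :: "'a measure" and \<omega> :: "'a \<Rightarrow> complex set"
  assumes "prob_space M" and "poisson_pp M \<omega>"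
  shows "\<exists>cs\<in>{0<..1::real}. \<forall>c\<in>{0<..<cs}. xi_exp M \<omega> c \<ge> ereal (3/5)"
\<comment> \<open>The value \<open>1 / 200\<close> is inherited from
  \<open>minimizer_strip_max\<close>, where it excludes long paths.\<close>
proof (intro bexI[of _ "1 / 200"] ballI)
  fix c :: real assume c: "c \<in> {0<..<1 / 200}"
  have ge: "ereal g \<le> xi_exp M \<omega> c" if g: "1 / 2 < g" "g < 3 / 5" for g
    unfolding xi_exp_def
  proof (intro Sup_upper CollectI exI[of _ g] conjI refl)
    let ?f = "\<lambda>t. ereal (outer_prob M
        {x\<in>space M. minimizer_in (\<omega> x) (line_at t) (c * t) (cyl 1 (t powr g))})"
    have "eventually (\<lambda>t. ?f t \<le> ereal (1 - 1 / 1024)) at_top"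
      using outer_prob_strip[OF assms, of c g] c g by (auto elim!: eventually_mono)
    then have "Limsup at_top ?f \<le> ereal (1 - 1 / 1024)"
      by (rule Limsup_bounded)
    also have "\<dots> < 1" by simp
    finally show "Limsup at_top ?f < 1" .
  qed
  show "ereal (3 / 5) \<le> xi_exp M \<omega> c"
  proof (rule ccontr)
    assume "\<not> ?thesis"
    then have "max (ereal (1 / 2)) (xi_exp M \<omega> c) < ereal (3 / 5)" by simp
    then obtain g where "max (ereal (1 / 2)) (xi_exp M \<omega> c) < ereal g" "ereal g < ereal (3 / 5)"
      using ereal_dense2 by blast
    then show False using ge[of g] by auto
  qed
qed auto

end
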